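(* Let $W(x,y)=-\log g_\tau(y-(\alpha+\beta x))$ be a linear-Gaussian reference potential, with $\tau$ positive definite, $\alpha\in\mathbb{R}^d$, $\beta\in\mathbb{R}^{d\times d}$ invertible, and put $\kappa:=\|\tau^{-1}\beta\|_2$. Consider the Sinkhorn bridges associated with $(\mu,\eta,\mathcal{K}_0)=(\lambda_U,\lambda_V,K_W)$. (1) Assume that $\mu=\lambda_U$ satisfies the $\mathbb{T}_2(\|u_+\|_2)$ inequality and that $\nabla^2V(y)\ge v_+^{-1}1_{\|y\|_2\ge\delta}-\overline v_+1_{\|y\|_2<\delta}$ for all $y$, for some positive definite $u_+,v_+$, positive semi-definite $\overline v_+$ and $\delta\ge0$. Let $\varepsilon_{u,v}:=\kappa^2\,\rho(\|v_+\|_2^{-1},\|\overline v_+\|_2,\delta)\,\|u_+\|_2$. Then for all $n\ge1$, $p\ge0$ $$\mathcal{H}(P_{\mu,\eta}|\mathcal{P}_{2(n+p)})\le\left(1+\varepsilon_{u,v}^{-1}\right)^{-n}\mathcal{H}(P_{\mu,\eta}|\mathcal{P}_{2p}).$$ If moreover $\nabla^2V\ge v_+^{-1}$ everywhere, the estimate holds with $\varepsilon_{u,v}$ replaced by $\varepsilon:=\|\tau^{-1}\beta\|_2^2\,\|u_+\|_2\,\|v_+\|_2$. (2) Assume that $\eta=\lambda_V$ satisfies the $\mathbb{T}_2(\|v_+\|_2)$ inequality and that $\nabla^2U(x)\ge u_+^{-1}1_{\|x\|_2\ge\delta}-\overline u_+1_{\|x\|_2<\delta}$ for all $x$, for some positive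 definite $u_+,v_+$, positive semi-definite $\overline u_+$ and $\delta\ge0$. Let $\varepsilon_{v,u}:=\kappa^2\,\rho(\|u_+\|_2^{-1},\|\overline u_+\|_2,\delta)\,\|v_+\|_2$. Then for all $n\ge1$, $p\ge0$ $$\mathcal{H}(P_{\mu,\eta}|\mathcal{P}_{2(n+p)+1})\le\left(1+\varepsilon_{v,u}^{-1}\right)^{-n}\mathcal{H}(P_{\mu,\eta}|\mathcal{P}_{2p+1}).$$ If moreover $\nabla^2U\ge u_+^{-1}$ everywhere, the estimate holds with $\varepsilon_{v,u}$ replaced by $\varepsilon=\|\tau^{-1}\beta\|_2^2\,\|u_+\|_2\,\|v_+\|_2$.
   Context: $\lambda$ is Lebesgue measure on $\mathbb{R}^d$, $g_\tau$ is the density of the centered Gaussian with covariance $\tau$. $\lambda_U(dx)=e^{-U(x)}\lambda(dx)$ and $K_W(x,dy)=e^{-W(x,y)}\lambda(dy)$; $U,V$ are smooth and $\mu=\lambda_U$, $\eta=\lambda_V$ are probability measures. $(\mu\times\mathcal{K})(d(x,y))=\mu(dx)\mathcal{K}(x,dy)$; $\mathcal{H}$ is relative entropy; $\Pi(\mu,\eta)$ is the set of couplings. The reference is $P=\mu\times K_W$; it is assumed that some $Q\in\Pi(\mu,\eta)$ has $\mathcal{H}(Q|P)<\infty$, and $P_{\mu,\eta}=\arg\min_{Q\in\Pi(\mu,\eta)}\mathcal{H}(Q|P)$. Sinkhorn: $\mathcal{K}_0=K_W$. Given $\mathcal{K}_{2n}$, put $\pi_{2n}=\mu\mathcal{K}_{2n}$,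 $\mathcal{P}_{2n}=\mu\times\mathcal{K}_{2n}$, and let $\mathcal{K}_{2n+1}$ be defined by $\mu(dx)\mathcal{K}_{2n}(x,dy)=\pi_{2n}(dy)\mathcal{K}_{2n+1}(y,dx)$. Then $\pi_{2n+1}=\eta\mathcal{K}_{2n+1}$, $\mathcal{P}_{2n+1}(d(x,y))=\eta(dy)\mathcal{K}_{2n+1}(y,dx)$, and $\mathcal{K}_{2(n+1)}$ is defined by $\eta(dy)\mathcal{K}_{2n+1}(y,dx)=\pi_{2n+1}(dx)\mathcal{K}_{2(n+1)}(x,dy)$. The log-densities of the Sinkhorn transitions are assumed smooth, with differentiation under the integral sign allowed. $\|\cdot\|_2$ is the Euclidean/spectral norm; matrix inequalities are in the Loewner order; $\mathcal{D}_2$ is the $2$-Wasserstein distance. $\mu$ satisfies $\mathbb{T}_2(\rho)$ if $\frac12\mathcal{D}_2(\nu,\mu)^2\le\rho\,\mathcal{H}(\nu|\mu)$ for all probability measures $\nu$. $\mu$ satisfies the log-Sobolev inequality $LS(\rho)$ if $\mathcal{H}(\nu|\mu)\le\frac\rho2\,\nu(\|\nabla\log(d\nu/d\mu)\|_2^2)$ for all probability measures $\nu\ll\mu$. For $a>0$, $b,\delta\ge0$, $\rho(a,b,\delta)>0$ denotes a fixed constant (depending only on $(a,b,\delta)$; such a constant exists by the Holley-Stroock perturbation lemma) such that every probability measure $\lambda_F$ with smooth $F$ satisfying $\nabla^2F(x)\ge a\,1_{\|x\|_2\ge\delta}I-b\,1_{\|x\|_2<\delta}I$ satisfies $LS(\rho(a,b,\delta))$.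 *)

theory Defs
  imports "HOL-Probability.Probability"
begin

section \<open>Matrices\<close>

text \<open>The library \<open>norm\<close> on \<open>real^'n^'n\<close> is the Frobenius norm; the spectral norm is the operator norm.\<close>

definition spectral_norm :: "real^'n^'n \<Rightarrow> real" where
  "spectral_norm A = onorm (\<lambda>x. A *v x)"

definition pos_semidef :: "real^'n^'n \<Rightarrow> bool" where
  "pos_semidef A \<longleftrightarrow> transpose A = A \<and> (\<forall>x. 0 \<le> x \<bullet> (A *v x))"

definition pos_def :: "real^'n^'n \<Rightarrow> bool" where
  "pos_def A \<longleftrightarrow> transpose A = A \<and> (\<forall>x. x \<noteq> 0 \<longrightarrow> 0 < x \<bullet> (A *v x))"

text \<open>Only used for symmetric matrices (Hessians of smooth functions are symmetric).\<close>

definition loewner_le :: "real^'n^'n \<Rightarrow> real^'n^'n \<Rightarrow> bool" where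
  "loewner_le A B \<longleftrightarrow> (\<forall>x. x \<bullet> (A *v x) \<le> x \<bullet> (B *v x))"

section \<open>Smooth functions, gradient and Hessian\<close>

text \<open>In finite dimension, \<open>f\<close> is \<open>C\<^sup>k\<^sup>+\<^sup>1\<close> iff it is differentiable and all its
  directional derivatives are \<open>C\<^sup>k\<close>.\<close>

primrec times_cont_diff :: "nat \<Rightarrow> ('a::euclidean_space \<Rightarrow> real) \<Rightarrow> bool" where
  "times_cont_diff 0 f \<longleftrightarrow> continuous_on UNIV f"
| "times_cont_diff (Suc k) f \<longleftrightarrow>
     (\<forall>x. f differentiable (at x)) \<and>
     (\<forall>v. times_cont_diff k (\<lambda>x. frechet_derivative f (at x) v))"

definition smooth :: "('a::euclidean_space \<Rightarrow> real) \<Rightarrow> bool" where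
  "smooth f \<longleftrightarrow> (\<forall>k. times_cont_diff k f)"

definition gradient :: "(real^'n \<Rightarrow> real) \<Rightarrow> real^'n \<Rightarrow> real^'n" where
  "gradient f x = (\<chi> i. frechet_derivative f (at x) (axis i 1))"

definition hessian :: "(real^'n \<Rightarrow> real) \<Rightarrow> real^'n \<Rightarrow> real^'n^'n" where
  "hessian f x = jacobian (gradient f) (at x)"

text \<open>\<open>\<nabla>\<^sup>2F(x) \<ge> A 1\<^bsub>|x| \<ge> \<delta>\<^esub> - B 1\<^bsub>|x| < \<delta>\<^esub>\<close> for all \<open>x\<close>.\<close>

definition curvature_bound ::
    "(real^'n \<Rightarrow> real) \<Rightarrow> real^'n^'n \<Rightarrow> real^'n^'n \<Rightarrow> real \<Rightarrow> bool" where
  "curvature_bound F A B \<delta> \<longleftrightarrow>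
     (\<forall>x. loewner_le (indicator {x. \<delta> \<le> norm x} x *\<^sub>R A - indicator {x. norm x < \<delta>} x *\<^sub>R B)
                     (hessian F x))"

section \<open>Gibbs measures and the linear-Gaussian reference transition\<close>

definition gibbs :: "('a::euclidean_space \<Rightarrow> real) \<Rightarrow> 'a measure" where
  "gibbs U = density lborel (\<lambda>x. ennreal (exp (- U x)))"

definition gibbs_kernel :: "('a \<Rightarrow> 'b::euclidean_space \<Rightarrow> real) \<Rightarrow> 'a \<Rightarrow> 'b measure" where
  "gibbs_kernel W x = gibbs (W x)"

definition gaussian_density :: "real^'n^'n \<Rightarrow> real^'n \<Rightarrow> real" where
  "gaussian_density \<tau> z =
     exp (- (z \<bullet> (matrix_inv \<tau> *v z)) / 2) / sqrt ((2 * pi) ^ CARD('n) * det \<tau>)"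

definition linear_gaussian_potential ::
    "real^'n^'n \<Rightarrow> real^'n \<Rightarrow> real^'n^'n \<Rightarrow> real^'n \<Rightarrow> real^'n \<Rightarrow> real" where
  "linear_gaussian_potential \<tau> \<alpha> \<beta> x y = - ln (gaussian_density \<tau> (y - (\<alpha> + \<beta> *v x)))"

section \<open>Products with kernels and couplings\<close>

text \<open>\<open>fwd_prod \<mu> K (d(x,y)) = \<mu>(dx) K(x,dy)\<close> and \<open>bwd_prod \<eta> K (d(x,y)) = \<eta>(dy) K(y,dx)\<close>.\<close>

definition fwd_prod ::
    "'a::euclidean_space measure \<Rightarrow> ('a \<Rightarrow> 'b::euclidean_space measure) \<Rightarrow> ('a \<times> 'b) measure" where
  "fwd_prod \<mu> K = \<mu> \<bind> (\<lambda>x. distr (K x) borel (\<lambda>y. (x, y)))"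

definition bwd_prod ::
    "'b::euclidean_space measure \<Rightarrow> ('b \<Rightarrow> 'a::euclidean_space measure) \<Rightarrow> ('a \<times> 'b) measure" where
  "bwd_prod \<eta> K = \<eta> \<bind> (\<lambda>y. distr (K y) borel (\<lambda>x. (x, y)))"

definition couplings ::
    "'a::euclidean_space measure \<Rightarrow> 'b::euclidean_space measure \<Rightarrow> ('a \<times> 'b) measure set" where
  "couplings \<mu> \<eta> = {Q. sets Q = sets borel \<and> distr Q borel fst = \<mu> \<and> distr Q borel snd = \<eta>}"

section \<open>Relative entropy, Wasserstein distance, functional inequalities\<close>

text \<open>\<open>rel_entropy \<nu> \<mu>\<close> is \<open>H(\<nu>|\<mu>)\<close>, for probability measures. The negative part of
  \<open>log (d\<nu>/d\<mu>)\<close> is always \<open>\<nu>\<close>-integrable, so non-integrability means \<open>H(\<nu>|\<mu>) = \<infinity>\<close>; and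
  \<open>KL_divergence\<close> is nonnegative, so \<open>ennreal\<close> truncates nothing.\<close>

definition rel_entropy :: "'a measure \<Rightarrow> 'a measure \<Rightarrow> ennreal" where
  "rel_entropy \<nu> \<mu> =
     (if absolutely_continuous \<mu> \<nu> \<and> integrable \<nu> (entropy_density (exp 1) \<mu> \<nu>)
      then ennreal (KL_divergence (exp 1) \<mu> \<nu>) else \<infinity>)"

text \<open>The square of the 2-Wasserstein distance.\<close>

definition wasserstein2_sq :: "(real^'n) measure \<Rightarrow> (real^'n) measure \<Rightarrow> ennreal" where
  "wasserstein2_sq \<nu> \<mu> =
     (INF Q\<in>couplings \<nu> \<mu>. \<integral>\<^sup>+z. ennreal ((norm (fst z - snd z))\<^sup>2) \<partial>Q)"

definition talagrand_T2 :: "(real^'n) measure \<Rightarrow> real \<Rightarrow> bool" where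
  "talagrand_T2 \<mu> \<rho> \<longleftrightarrow>
     (\<forall>\<nu>. prob_space \<nu> \<and> sets \<nu> = sets borel \<longrightarrow>
        ennreal (1/2) * wasserstein2_sq \<nu> \<mu> \<le> ennreal \<rho> * rel_entropy \<nu> \<mu>)"

text \<open>\<open>\<nu>(|\<nabla> log (d\<nu>/d\<mu>)|\<^sup>2)\<close>. The gradient is that of a differentiable version \<open>f\<close> of the
  density, and the value is \<open>\<infinity>\<close> (the infimum of the empty set) if there is none. If \<open>\<mu>\<close> has
  full support the version is unique. The points where \<open>f = 0\<close> are \<open>\<nu>\<close>-null.\<close>

definition fisher_information :: "(real^'n) measure \<Rightarrow> (real^'n) measure \<Rightarrow> ennreal" where
  "fisher_information \<nu> \<mu> =
     (INF f\<in>{f. (\<forall>x. f differentiable (at x)) \<and> (\<forall>x. 0 \<le> f x) \<and> \<nu> = density \<mu> (\<lambda>x. ennreal (f x))}.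
        \<integral>\<^sup>+x. ennreal ((norm (gradient (\<lambda>z. ln (f z)) x))\<^sup>2) \<partial>\<nu>)"

definition log_sobolev :: "(real^'n) measure \<Rightarrow> real \<Rightarrow> bool" where
  "log_sobolev \<mu> \<rho> \<longleftrightarrow>
     (\<forall>\<nu>. prob_space \<nu> \<and> sets \<nu> = sets borel \<and> absolutely_continuous \<mu> \<nu> \<longrightarrow>
        rel_entropy \<nu> \<mu> \<le> ennreal (\<rho> / 2) * fisher_information \<nu> \<mu>)"

section \<open>Schroedinger bridges and the Sinkhorn recursion\<close>

definition is_schroedinger_bridge ::
    "'a::euclidean_space measure \<Rightarrow> 'b::euclidean_space measure \<Rightarrow>
     ('a \<times> 'b) measure \<Rightarrow> ('a \<times> 'b) measure \<Rightarrow> bool" where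
  "is_schroedinger_bridge \<mu> \<eta> P Q \<longleftrightarrow>
     is_arg_min (\<lambda>Q. rel_entropy Q P) (\<lambda>Q. Q \<in> couplings \<mu> \<eta>) Q"

text \<open>Even-indexed kernels go from the first to the second coordinate, odd-indexed ones from the
  second to the first.\<close>

definition sinkhorn_marginal ::
    "'a::euclidean_space measure \<Rightarrow> 'a measure \<Rightarrow> (nat \<Rightarrow> 'a \<Rightarrow> 'a measure) \<Rightarrow> nat \<Rightarrow> 'a measure" where
  "sinkhorn_marginal \<mu> \<eta> K m = (if even m then \<mu> \<bind> K m else \<eta> \<bind> K m)"

definition sinkhorn_bridge ::
    "'a::euclidean_space measure \<Rightarrow> 'a measure \<Rightarrow> (nat \<Rightarrow> 'a \<Rightarrow> 'a measure) \<Rightarrow> nat \<Rightarrow> ('a \<times> 'a) measure" where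
  "sinkhorn_bridge \<mu> \<eta> K m = (if even m then fwd_prod \<mu> (K m) else bwd_prod \<eta> (K m))"

definition sinkhorn_kernels ::
    "'a::euclidean_space measure \<Rightarrow> 'a measure \<Rightarrow> ('a \<Rightarrow> 'a measure) \<Rightarrow>
     (nat \<Rightarrow> 'a \<Rightarrow> 'a measure) \<Rightarrow> bool" where
  "sinkhorn_kernels \<mu> \<eta> K0 K \<longleftrightarrow>
     K 0 = K0 \<and>
     (\<forall>m. K m \<in> borel \<rightarrow>\<^sub>M prob_algebra borel) \<and>
     (\<forall>n. fwd_prod \<mu> (K (2 * n)) = bwd_prod (sinkhorn_marginal \<mu> \<eta> K (2 * n)) (K (2 * n + 1))) \<and>
     (\<forall>n. bwd_prod \<eta> (K (2 * n + 1)) =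
            fwd_prod (sinkhorn_marginal \<mu> \<eta> K (2 * n + 1)) (K (2 * (n + 1))))"

definition smooth_transitions :: "(nat \<Rightarrow> 'a::euclidean_space \<Rightarrow> 'a measure) \<Rightarrow> bool" where
  "smooth_transitions K \<longleftrightarrow>
     (\<forall>m. \<exists>w. smooth (\<lambda>(x, y). w x y) \<and> K m = gibbs_kernel w)"

end

theory Submission
  imports Defs
begin

text \<open>Write \<open>P\<^sub>m\<close> for the Sinkhorn bridges, \<open>\<pi>\<^sub>m\<close> for their free marginals, \<open>M\<^sub>m\<close> for \<open>\<mu>\<close> or
  \<open>\<eta>\<close> according to the parity of \<open>m\<close>, and \<open>Q\<close> for a coupling of \<open>\<mu>\<close> and \<open>\<eta>\<close>. One Sinkhorn step
  multiplies the density by a function of one coordinate, so the chain rule gives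
  \<open>H(Q|P\<^sub>m) = H(M\<^sub>m\<^sub>+\<^sub>1|\<pi>\<^sub>m) + H(Q|P\<^sub>m\<^sub>+\<^sub>1)\<close> (\<open>entropy_chain_coupling\<close>). The first term does not
  depend on \<open>Q\<close>. Hence the Schroedinger bridge \<open>P\<close> minimises \<open>H(.|P\<^sub>m)\<close> over all couplings for every
  \<open>m\<close>, not only for \<open>m = 0\<close> (\<open>minimizer_bridge\<close>).

  The contraction compares \<open>P\<close> with one well chosen coupling. Take a coupling \<open>\<gamma>\<close> of \<open>\<pi>\<^sub>m\<^sub>+\<^sub>1\<close> and
  \<open>M\<^sub>m\<close>, and given \<open>(x', x)\<close> draw \<open>y\<close> from \<open>K\<^sub>m\<^sub>+\<^sub>2(x', .)\<close>. As \<open>\<pi>\<^sub>m\<^sub>+\<^sub>1 K\<^sub>m\<^sub>+\<^sub>2 = M\<^sub>m\<^sub>+\<^sub>1\<close>, the law of \<open>(x, y)\<close>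
  couples \<open>M\<^sub>m\<close> with \<open>M\<^sub>m\<^sub>+\<^sub>1\<close>, and its entropy relative to \<open>P\<^sub>m\<^sub>+\<^sub>2 = M\<^sub>m \<times> K\<^sub>m\<^sub>+\<^sub>2\<close> is at most the
  \<open>\<gamma>\<close>-mean of \<open>H(K\<^sub>m\<^sub>+\<^sub>2(x', .)|K\<^sub>m\<^sub>+\<^sub>2(x, .))\<close> (\<open>couplings_glue\<close>). If this entropy is at most
  \<open>D |x - x'|\<^sup>2 / 2\<close>, then minimality, Talagrand's inequality for \<open>M\<^sub>m\<close> with constant \<open>t\<close>, and the data
  processing inequality \<open>H(\<pi>\<^sub>m\<^sub>+\<^sub>1|M\<^sub>m) \<le> H(M\<^sub>m\<^sub>+\<^sub>1|\<pi>\<^sub>m)\<close> give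
  \<open>H(P|P\<^sub>m\<^sub>+\<^sub>2) \<le> D t H(M\<^sub>m\<^sub>+\<^sub>1|\<pi>\<^sub>m) \<le> D t (H(P|P\<^sub>m) - H(P|P\<^sub>m\<^sub>+\<^sub>2))\<close>,
  which is the contraction by \<open>(1 + 1/(D t))\<^sup>-\<^sup>1\<close> (\<open>entropy_contraction_step\<close>).

  It remains to find \<open>D\<close>. For a linear-Gaussian reference all transition potentials have the form
  \<open>f(x) + g(y) - (B x) \<bullet> y\<close> with \<open>B = \<tau>\<^sup>-\<^sup>1 \<beta>\<close> or its transpose. So \<open>K\<^sub>k(x', .)\<close> is the exponential
  tilt of \<open>K\<^sub>k(x, .)\<close> with parameter \<open>B (x' - x)\<close>. Normalisation of the previous transition makes
  its \<open>f\<close> a log-Laplace transform, hence convex, so the potential of \<open>K\<^sub>k(x, .)\<close> inherits the lower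
  Hessian bound of \<open>V\<close> or \<open>U\<close> (\<open>hessian_transition_ge\<close>). Then \<open>K\<^sub>k(x, .)\<close> satisfies the log-Sobolev
  inequality with constant \<open>r\<close>. The Fisher information of an exponential tilt is the constant
  \<open>|B (x' - x)|\<^sup>2\<close>, which gives \<open>D = \<kappa>\<^sup>2 r\<close>.

  For uniformly convex potentials the constant must be the sharp one. Only exponential tilts matter,
  so the full Bakry-Emery criterion is avoided: by the Prekopa-Leindler inequality the log-Laplace
  transform of an \<open>a\<close>-uniformly log-concave density differs from \<open>|\<theta>|\<^sup>2 / (2 a)\<close> by a concave
  function, and this bounds the entropy of the tilt by \<open>|\<theta>|\<^sup>2 / (2 a)\<close>
  (\<open>tilt_entropy_strongly_convex\<close>).\<close>

section \<open>Relative entropy\<close>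

text \<open>The function \<open>t ln t - t + 1\<close> has the same integral as \<open>t ln t\<close> against densities of
  probability measures, but it is nonnegative. Entropies become nonnegative integrals, and
  identities between them need no integrability conditions.\<close>

definition entropy_fun :: "real \<Rightarrow> real" where
  "entropy_fun t = t * ln t - t + 1"

lemma entropy_fun_nonneg: "0 \<le> t \<Longrightarrow> 0 \<le> entropy_fun t"
proof (cases "t = 0")
  case False
  assume "0 \<le> t"
  with False have t: "0 < t" by simp
  have "- ln t \<le> inverse t - 1"
    using ln_le_minus_one[of "inverse t"] t by (simp add: ln_inverse)
  then have "t * (- ln t) \<le> t * (inverse t - 1)"
    using t by (intro mult_left_mono) auto
  with t show ?thesis by (simp add: entropy_fun_def algebra_simps)
qed (simp add: entropy_fun_def)

lemma measurable_entropy_fun[measurable]: "entropy_fun \<in> borel_measurable borel"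
  unfolding entropy_fun_def[abs_def] by measurable

lemma nn_integral_density_prob_eq_1:
  assumes "prob_space (density M f)" and [measurable]: "f \<in> borel_measurable M"
  shows "(\<integral>\<^sup>+x. f x \<partial>M) = 1"
proof -
  have "emeasure (density M f) (space M) = (\<integral>\<^sup>+x. f x \<partial>M)"
    by (subst emeasure_density) (auto intro!: nn_integral_cong)
  with prob_space.emeasure_space_1[OF assms(1)] show ?thesis by simp
qed

lemma rel_entropy_density:
  assumes M: "prob_space M" and f[measurable]: "f \<in> borel_measurable M" and nn: "\<And>x. 0 \<le> f x"
    and D: "prob_space (density M (\<lambda>x. ennreal (f x)))"
  shows "rel_entropy (density M (\<lambda>x. ennreal (f x))) M = (\<integral>\<^sup>+x. ennreal (entropy_fun (f x)) \<partial>M)"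
proof -
  interpret prob_space M by fact
  have int1: "(\<integral>\<^sup>+x. ennreal (f x) \<partial>M) = 1"
    by (rule nn_integral_density_prob_eq_1[OF D]) simp
  have intf: "integrable M f"
    using int1 nn by (intro integrableI_nonneg) auto
  have f1: "(\<integral>x. f x \<partial>M) = 1"
    using int1 nn by (simp add: integral_eq_nn_integral)
  let ?N = "density M (\<lambda>x. ennreal (f x))"
  have ac: "absolutely_continuous M ?N"
    by (rule absolutely_continuousI_density) simp
  have m[measurable]: "entropy_density (exp 1) M ?N \<in> borel_measurable M"
    by simp
  have eq: "AE x in M. RN_deriv M ?N x = f x"
  proof (rule AE_symmetric[OF RN_deriv_unique])
  qed auto
  have ae: "AE x in M. f x * entropy_density (exp 1) M ?N x = f x * ln (f x)"
    using eq by eventually_elim (simp add: entropy_density_def nn log_def)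
  have "integrable ?N (entropy_density (exp 1) M ?N)
      \<longleftrightarrow> integrable M (\<lambda>x. f x * entropy_density (exp 1) M ?N x)"
    using nn by (subst integrable_real_density) auto
  also have "\<dots> \<longleftrightarrow> integrable M (\<lambda>x. f x * ln (f x))"
    using ae by (intro integrable_cong_AE) auto
  also have "\<dots> \<longleftrightarrow> integrable M (\<lambda>x. entropy_fun (f x))"
  proof
    assume "integrable M (\<lambda>x. f x * ln (f x))"
    with intf show "integrable M (\<lambda>x. entropy_fun (f x))"
      unfolding entropy_fun_def by auto
  next
    assume "integrable M (\<lambda>x. entropy_fun (f x))"
    then have "integrable M (\<lambda>x. entropy_fun (f x) + f x - 1)" using intf by auto
    then show "integrable M (\<lambda>x. f x * ln (f x))" by (simp add: entropy_fun_def)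
  qed
  finally have iff: "integrable ?N (entropy_density (exp 1) M ?N)
      \<longleftrightarrow> integrable M (\<lambda>x. entropy_fun (f x))" .
  show ?thesis
  proof (cases "integrable M (\<lambda>x. entropy_fun (f x))")
    case True
    have "(\<integral>x. entropy_fun (f x) \<partial>M) = (\<integral>x. f x * ln (f x) \<partial>M)"
    proof -
      have "integrable M (\<lambda>x. entropy_fun (f x) + f x - 1)" using intf True by auto
      then have "integrable M (\<lambda>x. f x * ln (f x))" by (simp add: entropy_fun_def)
      then show ?thesis using intf f1 by (simp add: entropy_fun_def prob_space)
    qed
    also have "\<dots> = KL_divergence (exp 1) M ?N"
      using nn by (subst KL_density) (auto simp: log_def)
    finally have "KL_divergence (exp 1) M ?N = (\<integral>x. entropy_fun (f x) \<partial>M)" ..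
    then show ?thesis
      using True ac iff nn entropy_fun_nonneg
      by (simp add: rel_entropy_def nn_integral_eq_integral)
  next
    case False
    have "(\<integral>\<^sup>+x. ennreal (entropy_fun (f x)) \<partial>M) = \<infinity>"
    proof (rule ccontr)
      assume "(\<integral>\<^sup>+x. ennreal (entropy_fun (f x)) \<partial>M) \<noteq> \<infinity>"
      then have "integrable M (\<lambda>x. entropy_fun (f x))"
        using nn entropy_fun_nonneg by (intro integrableI_nonneg) (auto simp: less_top)
      with False show False by simp
    qed
    with False iff show ?thesis by (simp add: rel_entropy_def)
  qed
qed

lemma rel_entropy_not_ac: "\<not> absolutely_continuous M N \<Longrightarrow> rel_entropy N M = \<infinity>"
  by (simp add: rel_entropy_def)

lemma absolutely_continuous_density_real:
  assumes M: "prob_space M" and N: "prob_space N" and s: "sets N = sets M"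
    and ac: "absolutely_continuous M N"
  obtains f where "f \<in> borel_measurable M" "\<And>x. 0 \<le> f x" "N = density M (\<lambda>x. ennreal (f x :: real))"
proof -
  interpret M: prob_space M by fact
  interpret N: prob_space N by fact
  obtain D where D: "D \<in> borel_measurable M" "AE x in M. RN_deriv M N x = ennreal (D x)"
     "AE x in N. 0 < D x" "\<And>x. 0 \<le> D x"
    using M.real_RN_deriv[OF N.finite_measure_axioms ac s] by blast
  have "N = density M (RN_deriv M N)" by (rule M.density_RN_deriv[OF ac s, symmetric])
  also have "\<dots> = density M (\<lambda>x. ennreal (D x))"
    using D by (intro density_cong) auto
  finally show ?thesis using that D by blast
qed

text \<open>The tangent of \<open>entropy_fun\<close> at \<open>s\<close>, that is Jensen's inequality in pointwise form.\<close>

lemma entropy_fun_tangent: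
  assumes "0 \<le> f" "0 < s"
  shows "f * ln s + 1 \<le> entropy_fun f + s"
proof (cases "f = 0")
  case True then show ?thesis using assms by (simp add: entropy_fun_def)
next
  case False
  with assms have f: "0 < f" by simp
  have "ln (s / f) \<le> s / f - 1" using f assms by (intro ln_le_minus_one) auto
  then have "f * (ln s - ln f) \<le> f * (s / f - 1)"
    using f assms by (intro mult_left_mono) (auto simp: ln_div)
  with f show ?thesis by (simp add: entropy_fun_def algebra_simps)
qed

text \<open>The data processing inequality. With \<open>f\<close>, \<open>g\<close> the densities before and after the map, integrate the
  tangent inequality at \<open>s = g (T x)\<close>. The positive and negative parts of \<open>ln g\<close> are kept on
  different sides. Only the integral of the negative part, which is at most 1, has to be cancelled.\<close>

lemma rel_entropy_distr_le:
  assumes M: "prob_space M" and N: "prob_space N" and s: "sets N = sets M"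
    and T: "T \<in> M \<rightarrow>\<^sub>M L"
  shows "rel_entropy (distr N L T) (distr M L T) \<le> rel_entropy N M"
proof (cases "absolutely_continuous M N")
  case False
  then show ?thesis by (simp add: rel_entropy_not_ac)
next
  case True
  interpret M: prob_space M by fact
  interpret N: prob_space N by fact
  have Ts: "T \<in> N \<rightarrow>\<^sub>M L" using T s by (simp cong: measurable_cong_sets)
  obtain f where f[measurable]: "f \<in> borel_measurable M" and f0: "\<And>x. 0 \<le> f x"
    and Nf: "N = density M (\<lambda>x. ennreal (f x))"
    using absolutely_continuous_density_real[OF M N s True] by auto
  note [measurable] = T Ts
  let ?M' = "distr M L T" and ?N' = "distr N L T"
  have M': "prob_space ?M'" by (rule M.prob_space_distr) fact
  have N': "prob_space ?N'" by (rule N.prob_space_distr) fact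
  have ac': "absolutely_continuous ?M' ?N'"
    unfolding absolutely_continuous_def
  proof
    fix A assume "A \<in> null_sets ?M'"
    then have A: "A \<in> sets L" "emeasure M (T -` A \<inter> space M) = 0"
      using T by (auto simp: null_sets_distr_iff)
    then have "T -` A \<inter> space M \<in> null_sets M" using T by auto
    with True have "T -` A \<inter> space M \<in> null_sets N" by (auto simp: absolutely_continuous_def)
    then show "A \<in> null_sets ?N'"
      using A Ts s sets_eq_imp_space_eq[OF s] by (auto simp: null_sets_distr_iff)
  qed
  obtain g where g[measurable]: "g \<in> borel_measurable ?M'" and g0: "\<And>x. 0 \<le> g x"
    and Ng: "?N' = density ?M' (\<lambda>x. ennreal (g x))"
    using absolutely_continuous_density_real[OF M' N' _ ac'] by auto
  have g'[measurable]: "g \<in> borel_measurable L" using g by simp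
  have gint: "(\<integral>\<^sup>+x. ennreal (g x) \<partial>?M') = 1"
    using N' unfolding Ng by (rule nn_integral_density_prob_eq_1) simp
  then have gint': "(\<integral>\<^sup>+x. ennreal (g (T x)) \<partial>M) = 1"
    by (simp add: nn_integral_distr)
  have transfer: "(\<integral>\<^sup>+x. ennreal (f x) * h (T x) \<partial>M) = (\<integral>\<^sup>+x. ennreal (g x) * h x \<partial>?M')"
    if h[measurable]: "h \<in> borel_measurable L" for h
  proof -
    have "(\<integral>\<^sup>+x. ennreal (f x) * h (T x) \<partial>M) = (\<integral>\<^sup>+x. h (T x) \<partial>N)"
      unfolding Nf by (subst nn_integral_density) auto
    also have "\<dots> = (\<integral>\<^sup>+x. h x \<partial>?N')" by (subst nn_integral_distr) auto
    also have "\<dots> = (\<integral>\<^sup>+x. ennreal (g x) * h x \<partial>?M')"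
      unfolding Ng by (subst nn_integral_density) auto
    finally show ?thesis .
  qed
  \<comment> \<open>The tangent inequality needs \<open>s > 0\<close>; where \<open>g (T x) = 0\<close>, almost surely \<open>f x = 0\<close>.\<close>
  have zero: "AE x in M. g (T x) = 0 \<longrightarrow> f x = 0"
  proof -
    have "(\<integral>\<^sup>+x. ennreal (f x) * indicator {y. g y = 0} (T x) \<partial>M)
        = (\<integral>\<^sup>+x. ennreal (g x) * indicator {y. g y = 0} x \<partial>?M')"
      using transfer[of "\<lambda>y. if g y = 0 then 1 else 0"] by (simp add: indicator_def of_bool_def)
    also have "\<dots> = (\<integral>\<^sup>+x. 0 \<partial>?M')" by (intro nn_integral_cong) (auto simp: indicator_def)
    finally have z: "(\<integral>\<^sup>+x. ennreal (f x) * indicator {y. g y = 0} (T x) \<partial>M) = 0" by simp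
    have "AE x in M. ennreal (f x) * indicator {y. g y = 0} (T x) = 0"
      by (subst nn_integral_0_iff_AE[symmetric])
         (use z in \<open>auto simp: indicator_def of_bool_def\<close>)
    then show ?thesis
      by eventually_elim (auto simp: indicator_def ennreal_eq_0_iff intro: antisym f0 split: if_splits)
  qed
  let ?p = "\<lambda>y. ennreal (max 0 (ln (g y)))" and ?m = "\<lambda>y. ennreal (max 0 (- ln (g y)))"
  let ?B = "\<integral>\<^sup>+x. ennreal (g x) * ?m x \<partial>?M'"
  have B: "?B \<noteq> \<infinity>"
  proof -
    have "?B \<le> (\<integral>\<^sup>+x. 1 \<partial>?M')"
    proof (rule nn_integral_mono)
      fix x
      have "0 \<le> entropy_fun (g x)" using entropy_fun_nonneg g0 by blast
      then have "g x * max 0 (- ln (g x)) \<le> 1"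
      proof (cases "g x = 0 \<or> ln (g x) \<ge> 0")
        case False
        then have "g x * max 0 (- ln (g x)) = - (g x * ln (g x))" by auto
        also have "\<dots> \<le> 1 - g x" using \<open>0 \<le> entropy_fun (g x)\<close> by (simp add: entropy_fun_def)
        finally show ?thesis using g0[of x] by linarith
      qed auto
      then show "ennreal (g x) * ?m x \<le> 1"
        using g0[of x] by (simp add: ennreal_mult[symmetric] del: ennreal_1 ennreal_max_0 ennreal_max_0' add: ennreal_1[symmetric])
    qed
    also have "\<dots> = 1" using prob_space.emeasure_space_1[OF M'] by simp
    finally show ?thesis by (auto simp: top_unique)
  qed
  have "(\<integral>\<^sup>+x. ennreal (f x) * ?p (T x) + 1 \<partial>M)
      \<le> (\<integral>\<^sup>+x. ennreal (entropy_fun (f x)) + ennreal (g (T x)) + ennreal (f x) * ?m (T x) \<partial>M)"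
  proof (rule nn_integral_mono_AE)
    show "AE x in M. ennreal (f x) * ?p (T x) + 1
        \<le> ennreal (entropy_fun (f x)) + ennreal (g (T x)) + ennreal (f x) * ?m (T x)"
      using zero
    proof eventually_elim
      fix x assume z: "g (T x) = 0 \<longrightarrow> f x = 0"
      have "f x * max 0 (ln (g (T x))) + 1
          \<le> entropy_fun (f x) + g (T x) + f x * max 0 (- ln (g (T x)))"
      proof (cases "g (T x) = 0")
        case True then show ?thesis using z by (simp add: entropy_fun_def)
      next
        case False
        then have "0 < g (T x)" using g0[of "T x"] by simp
        from entropy_fun_tangent[OF f0[of x] this]
        have "f x * (max 0 (ln (g (T x))) - max 0 (- ln (g (T x)))) + 1 \<le> entropy_fun (f x) + g (T x)"
          by (auto simp: max_def)
        then show ?thesis by (simp add: algebra_simps)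
      qed
      then show "ennreal (f x) * ?p (T x) + 1
          \<le> ennreal (entropy_fun (f x)) + ennreal (g (T x)) + ennreal (f x) * ?m (T x)"
        using f0[of x] g0[of "T x"] entropy_fun_nonneg[OF f0[of x]]
        by (simp add: ennreal_mult[symmetric] ennreal_plus[symmetric]
             del: ennreal_plus ennreal_1 ennreal_max_0 ennreal_max_0' add: ennreal_1[symmetric])
    qed
  qed
  also have "\<dots> = (\<integral>\<^sup>+x. ennreal (entropy_fun (f x)) \<partial>M) + 1 + ?B"
    using transfer[of ?m] by (simp add: nn_integral_add gint')
  finally have "(\<integral>\<^sup>+x. ennreal (g x) * ?p x \<partial>?M') + 1 \<le> (\<integral>\<^sup>+x. ennreal (entropy_fun (f x)) \<partial>M) + 1 + ?B"
    using transfer[of ?p] by (simp add: nn_integral_add M.emeasure_space_1)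
  also have "(\<integral>\<^sup>+x. ennreal (g x) * ?p x \<partial>?M') + 1
      = (\<integral>\<^sup>+x. ennreal (entropy_fun (g x)) \<partial>?M') + 1 + ?B"
  proof -
    have "(\<integral>\<^sup>+x. ennreal (g x) * ?p x \<partial>?M') + 1 = (\<integral>\<^sup>+x. ennreal (g x) * ?p x + 1 \<partial>?M')"
      using prob_space.emeasure_space_1[OF M'] by (simp add: nn_integral_add)
    also have "\<dots> = (\<integral>\<^sup>+x. ennreal (entropy_fun (g x)) + ennreal (g x) + ennreal (g x) * ?m x \<partial>?M')"
    proof (rule nn_integral_cong)
      fix x
      have "g x * max 0 (ln (g x)) + 1 = entropy_fun (g x) + g x + g x * max 0 (- ln (g x))"
        by (auto simp: entropy_fun_def max_def)
      then show "ennreal (g x) * ?p x + 1 = ennreal (entropy_fun (g x)) + ennreal (g x) + ennreal (g x) * ?m x"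
        using g0[of x] entropy_fun_nonneg[OF g0[of x]]
        by (simp add: ennreal_mult[symmetric] ennreal_plus[symmetric]
             del: ennreal_plus ennreal_1 ennreal_max_0 ennreal_max_0' add: ennreal_1[symmetric])
    qed
    also have "\<dots> = (\<integral>\<^sup>+x. ennreal (entropy_fun (g x)) \<partial>?M') + 1 + ?B"
      using gint by (simp add: nn_integral_add)
    finally show ?thesis .
  qed
  finally have "(1 + ?B) + (\<integral>\<^sup>+x. ennreal (entropy_fun (g x)) \<partial>?M')
      \<le> (1 + ?B) + (\<integral>\<^sup>+x. ennreal (entropy_fun (f x)) \<partial>M)"
    by (simp add: ac_simps)
  moreover have "1 + ?B \<noteq> top" using B by simp
  ultimately have "(\<integral>\<^sup>+x. ennreal (entropy_fun (g x)) \<partial>?M') \<le> (\<integral>\<^sup>+x. ennreal (entropy_fun (f x)) \<partial>M)"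
    by (simp add: ennreal_add_left_cancel_le)
  moreover have "rel_entropy ?N' ?M' = (\<integral>\<^sup>+x. ennreal (entropy_fun (g x)) \<partial>?M')"
    using N' unfolding Ng by (intro rel_entropy_density M' g0) auto
  moreover have "rel_entropy N M = (\<integral>\<^sup>+x. ennreal (entropy_fun (f x)) \<partial>M)"
    using N unfolding Nf by (intro rel_entropy_density M f0) auto
  ultimately show ?thesis by simp
qed

text \<open>The product rule behind the chain rule, with all terms moved to the side where they are positive:
  the remainder \<open>(1 - q) (1 - r)\<close> has no sign but integrates to zero.\<close>

lemma entropy_fun_mult:
  assumes "0 \<le> q" "0 < r"
  shows "entropy_fun (q * r) + q + r = r * entropy_fun q + q * entropy_fun r + 1 + q * r"
proof (cases "q = 0")
  case False
  then have "0 < q" using assms by simp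
  then show ?thesis using assms by (simp add: entropy_fun_def ln_mult algebra_simps)
qed (simp add: entropy_fun_def)

text \<open>If \<open>Q\<close> has density \<open>q\<close> with respect to \<open>P' = (r \<circ> T) P\<close>, then it has density \<open>q (r \<circ> T)\<close> with respect to
  \<open>P\<close>. Integrate \<open>entropy_fun_mult\<close> against \<open>P\<close>; the extra terms are all equal to 1. The assumption
  on the image of \<open>Q\<close> says that \<open>P'\<close> has the same \<open>T\<close>-marginal as \<open>Q\<close>.\<close>

lemma rel_entropy_chain:
  assumes P: "prob_space P" and Q: "prob_space Q" and s: "sets Q = sets P"
    and T: "T \<in> P \<rightarrow>\<^sub>M L" and r[measurable]: "r \<in> borel_measurable L" and rp: "\<And>x. 0 < r x"
    and QT: "distr Q L T = density (distr P L T) (\<lambda>x. ennreal (r x))"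
  shows "rel_entropy Q P = rel_entropy (distr Q L T) (distr P L T)
      + rel_entropy Q (density P (\<lambda>x. ennreal (r (T x))))"
proof -
  interpret P: prob_space P by fact
  interpret Q: prob_space Q by fact
  note [measurable] = T
  have Ts[measurable]: "T \<in> Q \<rightarrow>\<^sub>M L" using T s by (simp cong: measurable_cong_sets)
  define P' where "P' = density P (\<lambda>x. ennreal (r (T x)))"
  have QT': "prob_space (distr Q L T)" by (rule Q.prob_space_distr) fact
  have PT': "prob_space (distr P L T)" by (rule P.prob_space_distr) fact
  have rint: "(\<integral>\<^sup>+x. ennreal (r (T x)) \<partial>P) = 1"
  proof -
    have "(\<integral>\<^sup>+x. ennreal (r x) \<partial>distr P L T) = 1"
      using QT' unfolding QT by (rule nn_integral_density_prob_eq_1) simp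
    then show ?thesis by (simp add: nn_integral_distr)
  qed
  have P': "prob_space P'"
    by standard (simp add: P'_def emeasure_density rint cong: nn_integral_cong)
  have sP': "sets P' = sets P" by (simp add: P'_def)
  have PP': "P = density P' (\<lambda>x. ennreal (1 / r (T x)))"
  proof -
    have "density P' (\<lambda>x. ennreal (1 / r (T x))) = density P (\<lambda>x. ennreal (r (T x)) * ennreal (1 / r (T x)))"
      unfolding P'_def by (intro density_density_eq) measurable
    also have "\<dots> = density P (\<lambda>x. 1)"
      using rp by (intro density_cong) (auto simp: ennreal_mult[symmetric] less_imp_le less_imp_neq[symmetric])
    finally show ?thesis by (simp add: density_1)
  qed
  show ?thesis
  proof (cases "absolutely_continuous P' Q")
    case False
    have "\<not> absolutely_continuous P Q"
    proof
      assume ac: "absolutely_continuous P Q"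
      have "absolutely_continuous P' P"
        by (subst PP', rule absolutely_continuousI_density) (simp add: P'_def)
      with ac have "absolutely_continuous P' Q" by (auto simp: absolutely_continuous_def)
      with False show False ..
    qed
    with False show ?thesis by (simp add: rel_entropy_not_ac P'_def[symmetric])
  next
    case True
    obtain q where q[measurable]: "q \<in> borel_measurable P'" and q0: "\<And>x. 0 \<le> q x"
      and Qq: "Q = density P' (\<lambda>x. ennreal (q x))"
      using absolutely_continuous_density_real[OF P' Q _ True] s sP' by auto
    have q'[measurable]: "q \<in> borel_measurable P" using q by (simp add: P'_def)
    have QP: "Q = density P (\<lambda>x. ennreal (q x * r (T x)))"
      unfolding Qq P'_def using q0 rp
      by (subst density_density_eq) (auto simp: ennreal_mult less_imp_le mult.commute)
    have H: "rel_entropy Q P = (\<integral>\<^sup>+x. ennreal (entropy_fun (q x * r (T x))) \<partial>P)"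
      using Q unfolding QP by (intro rel_entropy_density P) (auto simp: q0 rp less_imp_le)
    have H': "rel_entropy Q P' = (\<integral>\<^sup>+x. ennreal (r (T x)) * ennreal (entropy_fun (q x)) \<partial>P)"
    proof -
      have "rel_entropy Q P' = (\<integral>\<^sup>+x. ennreal (entropy_fun (q x)) \<partial>P')"
        using Q unfolding Qq by (intro rel_entropy_density P') (auto simp: q0)
      also have "\<dots> = (\<integral>\<^sup>+x. ennreal (r (T x)) * ennreal (entropy_fun (q x)) \<partial>P)"
        unfolding P'_def by (subst nn_integral_density) auto
      finally show ?thesis .
    qed
    \<comment> \<open>Since \<open>q P = (1/(r \<circ> T)) Q\<close> and \<open>T\<close> maps \<open>Q\<close> to \<open>r (T P)\<close>, it maps \<open>q P\<close> to \<open>T P\<close>.\<close>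
    have tr: "(\<integral>\<^sup>+x. ennreal (q x) * h (T x) \<partial>P) = (\<integral>\<^sup>+x. h x \<partial>distr P L T)"
      if h[measurable]: "h \<in> borel_measurable L" for h
    proof -
      have "(\<integral>\<^sup>+x. ennreal (q x) * h (T x) \<partial>P)
          = (\<integral>\<^sup>+x. ennreal (q x * r (T x)) * (h (T x) / ennreal (r (T x))) \<partial>P)"
      proof (rule nn_integral_cong)
        fix x
        have "ennreal (r (T x)) * (h (T x) / ennreal (r (T x))) = h (T x)"
          using rp[of "T x"] by (simp add: ennreal_times_divide ennreal_mult_divide_eq mult.commute)
        then show "ennreal (q x) * h (T x) = ennreal (q x * r (T x)) * (h (T x) / ennreal (r (T x)))"
          using q0[of x] rp[of "T x"] by (simp add: ennreal_mult less_imp_le mult.assoc)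
      qed
      also have "\<dots> = (\<integral>\<^sup>+x. h (T x) / ennreal (r (T x)) \<partial>Q)"
        unfolding QP by (subst nn_integral_density) auto
      also have "\<dots> = (\<integral>\<^sup>+x. h x / ennreal (r x) \<partial>distr Q L T)"
        by (subst nn_integral_distr) auto
      also have "\<dots> = (\<integral>\<^sup>+x. ennreal (r x) * (h x / ennreal (r x)) \<partial>distr P L T)"
        unfolding QT by (subst nn_integral_density) auto
      also have "\<dots> = (\<integral>\<^sup>+x. h x \<partial>distr P L T)"
      proof (rule nn_integral_cong)
        fix x
        show "ennreal (r x) * (h x / ennreal (r x)) = h x"
          using rp[of x] by (simp add: ennreal_times_divide ennreal_mult_divide_eq mult.commute)
      qed
      finally show ?thesis .
    qed
    have HT: "rel_entropy (distr Q L T) (distr P L T)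
        = (\<integral>\<^sup>+x. ennreal (q x) * ennreal (entropy_fun (r (T x))) \<partial>P)"
    proof -
      have "rel_entropy (distr Q L T) (distr P L T) = (\<integral>\<^sup>+x. ennreal (entropy_fun (r x)) \<partial>distr P L T)"
        using QT' unfolding QT by (intro rel_entropy_density PT') (auto simp: rp less_imp_le)
      then show ?thesis using tr[of "\<lambda>x. ennreal (entropy_fun (r x))"] by simp
    qed
    have qint: "(\<integral>\<^sup>+x. ennreal (q x) \<partial>P) = 1"
      using tr[of "\<lambda>_. 1"] prob_space.emeasure_space_1[OF PT'] by simp
    have qrint: "(\<integral>\<^sup>+x. ennreal (q x * r (T x)) \<partial>P) = 1"
      using Q unfolding QP by (rule nn_integral_density_prob_eq_1) simp
    have "(\<integral>\<^sup>+x. ennreal (entropy_fun (q x * r (T x))) + ennreal (q x) + ennreal (r (T x)) \<partial>P)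
      = (\<integral>\<^sup>+x. ennreal (r (T x)) * ennreal (entropy_fun (q x)) +
              ennreal (q x) * ennreal (entropy_fun (r (T x))) + 1 + ennreal (q x * r (T x)) \<partial>P)"
    proof (rule nn_integral_cong)
      fix x
      have "0 \<le> entropy_fun (q x * r (T x))" "0 \<le> entropy_fun (q x)" "0 \<le> entropy_fun (r (T x))"
        using q0[of x] rp[of "T x"] by (auto intro!: entropy_fun_nonneg simp: less_imp_le)
      then show "ennreal (entropy_fun (q x * r (T x))) + ennreal (q x) + ennreal (r (T x))
         = ennreal (r (T x)) * ennreal (entropy_fun (q x)) +
              ennreal (q x) * ennreal (entropy_fun (r (T x))) + 1 + ennreal (q x * r (T x))"
        using q0[of x] rp[of "T x"] entropy_fun_mult[OF q0[of x] rp[of "T x"]]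
        by (simp add: ennreal_mult[symmetric] ennreal_plus[symmetric] less_imp_le
            del: ennreal_plus ennreal_1 add: ennreal_1[symmetric])
    qed
    then have "rel_entropy Q P + 1 + 1 = rel_entropy Q P' + rel_entropy (distr Q L T) (distr P L T) + 1 + 1"
      by (simp add: nn_integral_add H H' HT qint rint qrint P.emeasure_space_1)
    then have "2 + rel_entropy Q P = 2 + (rel_entropy (distr Q L T) (distr P L T) + rel_entropy Q P')"
      by (simp add: ac_simps flip: one_add_one)
    then show ?thesis unfolding P'_def[symmetric]
      by (subst (asm) ennreal_add_left_cancel) auto
  qed
qed

section \<open>Gibbs measures\<close>

lemma gibbs_nn_integral:
  assumes [measurable]: "u \<in> borel_measurable borel" "f \<in> borel_measurable borel"
  shows "(\<integral>\<^sup>+x. f x \<partial>gibbs u) = (\<integral>\<^sup>+x. ennreal (exp (- u x)) * f x \<partial>lborel)"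
  unfolding gibbs_def by (subst nn_integral_density) auto

lemma sets_gibbs[measurable_cong, simp]: "sets (gibbs u) = sets borel"
  by (simp add: gibbs_def)

lemma space_gibbs[simp]: "space (gibbs u) = UNIV"
  by (simp add: gibbs_def)

lemma density_gibbs:
  assumes [measurable]: "u \<in> borel_measurable borel" "r \<in> borel_measurable borel"
  shows "density (gibbs u) (\<lambda>x. ennreal (exp (r x))) = gibbs (\<lambda>x. u x - r x)"
  unfolding gibbs_def
  by (subst density_density_eq) (auto simp: ennreal_mult[symmetric] exp_add[symmetric] algebra_simps)

lemma AE_lborel_eq_imp_eq:
  fixes f g :: "'a::euclidean_space \<Rightarrow> 'b::t2_space"
  assumes "continuous_on UNIV f" "continuous_on UNIV g" "AE x in lborel. f x = g x"
  shows "f = g"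
proof (rule ccontr)
  assume "f \<noteq> g"
  let ?S = "{x. f x \<noteq> g x}"
  have "open ?S" using open_Collect_neq[OF assms(1,2)] .
  moreover have "?S \<noteq> {}" using \<open>f \<noteq> g\<close> by auto
  ultimately have "\<not> negligible ?S" by (rule open_not_negligible)
  moreover have "?S \<in> null_sets lborel"
    using assms(3) \<open>open ?S\<close> by (subst AE_iff_null_sets) auto
  then have "negligible ?S"
    by (simp add: negligible_iff_null_sets null_sets_completionI)
  ultimately show False ..
qed

text \<open>Almost everywhere identities between Gibbs densities are exact because potentials are continuous.\<close>

lemma gibbs_inject:
  fixes u v :: "'a::euclidean_space \<Rightarrow> real"
  assumes u: "continuous_on UNIV u" and v: "continuous_on UNIV v" and eq: "gibbs u = gibbs v"
  shows "u = v"
proof (rule AE_lborel_eq_imp_eq[OF u v])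
  have [measurable]: "u \<in> borel_measurable borel" "v \<in> borel_measurable borel"
    using u v by (auto intro: borel_measurable_continuous_onI)
  have "AE x in lborel. ennreal (exp (- u x)) = ennreal (exp (- v x))"
    using eq unfolding gibbs_def by (intro sigma_finite_measure.density_unique[OF sigma_finite_lborel]) auto
  then show "AE x in lborel. u x = v x" by eventually_elim simp
qed

lemma measurable_comp_fst:
  assumes "f \<in> borel \<rightarrow>\<^sub>M N"
  shows "(\<lambda>z::'a::euclidean_space \<times> 'b::euclidean_space. f (fst z)) \<in> borel \<rightarrow>\<^sub>M N"
  by (rule measurable_compose[OF borel_measurable_continuous_onI assms]) (intro continuous_intros)

lemma measurable_comp_snd:
  assumes "f \<in> borel \<rightarrow>\<^sub>M N"
  shows "(\<lambda>z::'a::euclidean_space \<times> 'b::euclidean_space. f (snd z)) \<in> borel \<rightarrow>\<^sub>M N"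
  by (rule measurable_compose[OF borel_measurable_continuous_onI assms]) (intro continuous_intros)

lemmas measurable_fst_borel = measurable_comp_fst[OF measurable_ident_sets[OF refl], simplified]
lemmas measurable_snd_borel = measurable_comp_snd[OF measurable_ident_sets[OF refl], simplified]

section \<open>Products of measures and kernels\<close>

abbreviation prob_kernel :: "('a::euclidean_space \<Rightarrow> 'b::euclidean_space measure) \<Rightarrow> bool" where
  "prob_kernel K \<equiv> K \<in> borel \<rightarrow>\<^sub>M prob_algebra borel"

lemma prob_kernelD:
  assumes "prob_kernel K"
  shows "prob_space (K x)" "sets (K x) = sets borel" "space (K x) = UNIV"
proof -
  have "K x \<in> space (prob_algebra borel)" using measurable_space[OF assms] by simp
  then show "prob_space (K x)" "sets (K x) = sets borel" by (auto simp: space_prob_algebra)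
  then show "space (K x) = UNIV" using sets_eq_imp_space_eq by force
qed

lemma prob_kernel_Pair:
  assumes K[measurable]: "prob_kernel K"
  shows "(\<lambda>x. distr (K x) borel (\<lambda>y. (x, y))) \<in> borel \<rightarrow>\<^sub>M prob_algebra borel"
  by (rule measurable_distr_prob_space2[OF K]) measurable

lemma in_prob_algebra:
  "prob_space \<nu> \<Longrightarrow> sets \<nu> = sets borel \<Longrightarrow> \<nu> \<in> space (prob_algebra (borel :: 'a::euclidean_space measure))"
  by (simp add: space_prob_algebra)

lemma fwd_prod_prob:
  assumes "prob_space \<nu>" "sets \<nu> = sets borel" and K: "prob_kernel K"
  shows "prob_space (fwd_prod \<nu> K)" "sets (fwd_prod \<nu> K) = sets borel" "space (fwd_prod \<nu> K) = UNIV"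
proof -
  have "fwd_prod \<nu> K \<in> space (prob_algebra borel)"
    unfolding fwd_prod_def space_prob_algebra
    using prob_space_bind'[OF in_prob_algebra[OF assms(1,2)] prob_kernel_Pair[OF K]]
      sets_bind'[OF in_prob_algebra[OF assms(1,2)] prob_kernel_Pair[OF K]] by simp
  then show "prob_space (fwd_prod \<nu> K)" "sets (fwd_prod \<nu> K) = sets borel"
    by (auto simp: space_prob_algebra)
  then show "space (fwd_prod \<nu> K) = UNIV" using sets_eq_imp_space_eq by force
qed

lemma nn_integral_fwd_prod:
  assumes "prob_space \<nu>" "sets \<nu> = sets borel" and K[measurable]: "prob_kernel K"
    and f[measurable]: "f \<in> borel_measurable borel"
  shows "(\<integral>\<^sup>+z. f z \<partial>fwd_prod \<nu> K) = (\<integral>\<^sup>+x. \<integral>\<^sup>+y. f (x, y) \<partial>K x \<partial>\<nu>)"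
proof -
  note [measurable_cong] = assms(2) prob_kernelD(2)[OF K]
  have m: "(\<lambda>x. distr (K x) borel (\<lambda>y. (x, y))) \<in> \<nu> \<rightarrow>\<^sub>M subprob_algebra borel"
    using measurable_prob_algebraD[OF prob_kernel_Pair[OF K]] by (simp cong: measurable_cong_sets)
  have "(\<integral>\<^sup>+z. f z \<partial>fwd_prod \<nu> K) = (\<integral>\<^sup>+x. \<integral>\<^sup>+z. f z \<partial>distr (K x) borel (\<lambda>y. (x, y)) \<partial>\<nu>)"
    unfolding fwd_prod_def by (rule nn_integral_bind[OF f m])
  also have "\<dots> = (\<integral>\<^sup>+x. \<integral>\<^sup>+y. f (x, y) \<partial>K x \<partial>\<nu>)"
    by (intro nn_integral_cong nn_integral_distr) measurable
  finally show ?thesis .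
qed

lemma measure_eqI_nn_integral:
  assumes "sets M = sets N"
    and "\<And>f. f \<in> borel_measurable M \<Longrightarrow> (\<integral>\<^sup>+x. f x \<partial>M) = (\<integral>\<^sup>+x. f x \<partial>N)"
  shows "M = N"
proof (rule measure_eqI[OF assms(1)])
  fix A assume A: "A \<in> sets M"
  then show "emeasure M A = emeasure N A"
    using assms(2)[of "indicator A"] assms(1) by simp
qed

lemma nn_integral_kernel_bind:
  assumes "prob_space \<nu>" "sets \<nu> = sets borel" and K[measurable]: "prob_kernel K"
    and f[measurable]: "f \<in> borel_measurable borel"
  shows "(\<integral>\<^sup>+z. f z \<partial>(\<nu> \<bind> K)) = (\<integral>\<^sup>+x. \<integral>\<^sup>+y. f y \<partial>K x \<partial>\<nu>)"
  using assms(2) measurable_prob_algebraD[OF K]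
  by (intro nn_integral_bind[OF f]) (simp cong: measurable_cong_sets)

lemma kernel_bind_prob:
  assumes "prob_space \<nu>" "sets \<nu> = sets borel" and K: "prob_kernel K"
  shows "prob_space (\<nu> \<bind> K)" "sets (\<nu> \<bind> K) = sets borel"
proof -
  have "\<nu> \<bind> K \<in> space (prob_algebra borel)"
    unfolding space_prob_algebra
    using prob_space_bind'[OF in_prob_algebra[OF assms(1,2)] K]
      sets_bind'[OF in_prob_algebra[OF assms(1,2)] K] by simp
  then show "prob_space (\<nu> \<bind> K)" "sets (\<nu> \<bind> K) = sets borel"
    by (auto simp: space_prob_algebra)
qed

lemma distr_fwd_prod_fst:
  assumes "prob_space \<nu>" "sets \<nu> = sets borel" and K: "prob_kernel K"
  shows "distr (fwd_prod \<nu> K) borel fst = \<nu>"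
proof (rule measure_eqI_nn_integral)
  note [measurable_cong] = fwd_prod_prob(2)[OF assms]
  fix f :: "_ \<Rightarrow> ennreal" assume "f \<in> borel_measurable (distr (fwd_prod \<nu> K) borel fst)"
  then have f[measurable]: "f \<in> borel_measurable borel" by simp
  have "(\<integral>\<^sup>+x. f x \<partial>distr (fwd_prod \<nu> K) borel fst) = (\<integral>\<^sup>+z. f (fst z) \<partial>fwd_prod \<nu> K)"
    using measurable_fst_borel f
    by (intro nn_integral_distr) (simp_all add: measurable_cong_sets[OF fwd_prod_prob(2)[OF assms] refl])
  also have "\<dots> = (\<integral>\<^sup>+x. \<integral>\<^sup>+y. f x \<partial>K x \<partial>\<nu>)"
    using measurable_comp_fst[OF f] by (subst nn_integral_fwd_prod[OF assms]) auto
  also have "\<dots> = (\<integral>\<^sup>+x. f x \<partial>\<nu>)"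
    using prob_space.emeasure_space_1[OF prob_kernelD(1)[OF K]] by simp
  finally show "(\<integral>\<^sup>+x. f x \<partial>distr (fwd_prod \<nu> K) borel fst) = (\<integral>\<^sup>+x. f x \<partial>\<nu>)" .
qed (use assms in simp)

lemma distr_fwd_prod_snd:
  assumes "prob_space \<nu>" "sets \<nu> = sets borel" and K: "prob_kernel K"
  shows "distr (fwd_prod \<nu> K) borel snd = \<nu> \<bind> K"
proof (rule measure_eqI_nn_integral)
  note [measurable_cong] = fwd_prod_prob(2)[OF assms]
  fix f :: "_ \<Rightarrow> ennreal" assume "f \<in> borel_measurable (distr (fwd_prod \<nu> K) borel snd)"
  then have f[measurable]: "f \<in> borel_measurable borel" by simp
  have "(\<integral>\<^sup>+x. f x \<partial>distr (fwd_prod \<nu> K) borel snd) = (\<integral>\<^sup>+z. f (snd z) \<partial>fwd_prod \<nu> K)"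
    using measurable_snd_borel f
    by (intro nn_integral_distr) (simp_all add: measurable_cong_sets[OF fwd_prod_prob(2)[OF assms] refl])
  also have "\<dots> = (\<integral>\<^sup>+x. \<integral>\<^sup>+y. f y \<partial>K x \<partial>\<nu>)"
    using measurable_comp_snd[OF f] by (subst nn_integral_fwd_prod[OF assms]) auto
  also have "\<dots> = (\<integral>\<^sup>+x. f x \<partial>(\<nu> \<bind> K))"
    by (rule nn_integral_kernel_bind[OF assms, symmetric]) fact
  finally show "(\<integral>\<^sup>+x. f x \<partial>distr (fwd_prod \<nu> K) borel snd) = (\<integral>\<^sup>+x. f x \<partial>(\<nu> \<bind> K))" .
qed (use kernel_bind_prob[OF assms] in simp)

lemma measurable_swap_borel[measurable]:
  "prod.swap \<in> borel \<rightarrow>\<^sub>M (borel :: ('b::euclidean_space \<times> 'a::euclidean_space) measure)"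
  by (intro borel_measurable_continuous_onI continuous_on_swap)

lemma bwd_prod_eq_distr_swap:
  assumes "prob_space \<nu>" "sets \<nu> = sets borel" and K[measurable]: "prob_kernel K"
  shows "bwd_prod \<nu> K = distr (fwd_prod \<nu> K) borel prod.swap"
proof -
  note [measurable_cong] = prob_kernelD(2)[OF K]
  have m: "(\<lambda>x. distr (K x) borel (\<lambda>y. (x, y))) \<in> \<nu> \<rightarrow>\<^sub>M subprob_algebra borel"
    using assms(2) measurable_prob_algebraD[OF prob_kernel_Pair[OF K]] by (simp cong: measurable_cong_sets)
  have "distr (fwd_prod \<nu> K) borel prod.swap
      = \<nu> \<bind> (\<lambda>x. distr (distr (K x) borel (\<lambda>y. (x, y))) borel prod.swap)"
    unfolding fwd_prod_def
    using prob_space.not_empty[OF assms(1)] by (intro distr_bind[OF m]) auto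
  also have "\<dots> = bwd_prod \<nu> K"
    unfolding bwd_prod_def by (intro arg_cong2[where f=bind] ext refl) (simp add: distr_distr comp_def)
  finally show ?thesis ..
qed

lemma distr_swap_swap:
  fixes P :: "('a::euclidean_space \<times> 'b::euclidean_space) measure"
  assumes [measurable_cong]: "sets P = sets borel"
  shows "distr (distr P borel prod.swap) borel prod.swap = P"
proof -
  have "distr (distr P borel prod.swap) borel prod.swap = distr P borel (prod.swap \<circ> prod.swap)"
    by (intro distr_distr) measurable
  also have "\<dots> = distr P P (\<lambda>x. x)"
    using assms by (intro distr_cong) auto
  finally show ?thesis by (simp add: distr_id)
qed

lemma distr_gibbs_swap:
  fixes J :: "'a::euclidean_space \<times> 'b::euclidean_space \<Rightarrow> real"
  assumes [measurable]: "J \<in> borel_measurable borel"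
  shows "distr (gibbs J) borel prod.swap = gibbs (\<lambda>z. J (prod.swap z))"
proof (rule measure_eqI_nn_integral)
  fix f :: "'b \<times> 'a \<Rightarrow> ennreal" assume "f \<in> borel_measurable (distr (gibbs J) borel prod.swap)"
  then have f[measurable]: "f \<in> borel_measurable borel" by simp
  have f2[measurable]: "f \<in> borel_measurable (borel \<Otimes>\<^sub>M borel)"
    and J2[measurable]: "J \<in> borel_measurable (borel \<Otimes>\<^sub>M borel)"
    using f assms by (simp_all add: borel_prod)
  have "(\<integral>\<^sup>+x. f x \<partial>distr (gibbs J) borel prod.swap) = (\<integral>\<^sup>+z. f (prod.swap z) \<partial>gibbs J)"
    by (intro nn_integral_distr) measurable
  also have "\<dots> = (\<integral>\<^sup>+z. ennreal (exp (- J z)) * f (prod.swap z) \<partial>(lborel \<Otimes>\<^sub>M lborel))"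
    by (subst gibbs_nn_integral) (auto simp: lborel_prod)
  also have "\<dots> = (\<integral>\<^sup>+x. \<integral>\<^sup>+y. ennreal (exp (- J (x, y))) * f (y, x) \<partial>lborel \<partial>lborel)"
    by (subst lborel.nn_integral_fst[symmetric]) (auto simp: lborel_prod)
  also have "\<dots> = (\<integral>\<^sup>+y. \<integral>\<^sup>+x. ennreal (exp (- J (x, y))) * f (y, x) \<partial>lborel \<partial>lborel)"
    using J2 f2 by (intro lborel_pair.Fubini') measurable
  also have "\<dots> = (\<integral>\<^sup>+z. ennreal (exp (- J (prod.swap z))) * f z \<partial>(lborel \<Otimes>\<^sub>M lborel))"
    by (subst lborel.nn_integral_fst[symmetric]) (auto simp: lborel_prod)
  also have "\<dots> = (\<integral>\<^sup>+x. f x \<partial>gibbs (\<lambda>z. J (prod.swap z)))"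
    by (subst gibbs_nn_integral) (auto simp: lborel_prod)
  finally show "(\<integral>\<^sup>+x. f x \<partial>distr (gibbs J) borel prod.swap) = (\<integral>\<^sup>+x. f x \<partial>gibbs (\<lambda>z. J (prod.swap z)))" .
qed simp

lemma fwd_prod_density_gibbs_kernel:
  fixes w :: "'a::euclidean_space \<Rightarrow> 'b::euclidean_space \<Rightarrow> real"
  assumes p[measurable]: "p \<in> borel_measurable borel" and P: "prob_space (density lborel p)"
    and w: "(\<lambda>z. w (fst z) (snd z)) \<in> borel_measurable borel" and K: "prob_kernel (gibbs_kernel w)"
  shows "fwd_prod (density lborel p) (gibbs_kernel w)
    = density lborel (\<lambda>z. p (fst z) * ennreal (exp (- w (fst z) (snd z))))"
proof (rule measure_eqI_nn_integral)
  let ?\<nu> = "density lborel p"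
  have s: "sets ?\<nu> = sets borel" by simp
  show "sets (fwd_prod ?\<nu> (gibbs_kernel w))
      = sets (density lborel (\<lambda>z. p (fst z) * ennreal (exp (- w (fst z) (snd z)))))"
    using fwd_prod_prob[OF P s K] by simp
  fix f :: "_ \<Rightarrow> ennreal" assume "f \<in> borel_measurable (fwd_prod ?\<nu> (gibbs_kernel w))"
  then have f[measurable]: "f \<in> borel_measurable borel"
    using fwd_prod_prob[OF P s K] by (simp cong: measurable_cong_sets)
  note w[measurable] measurable_comp_fst[OF p, measurable]
  have [measurable]: "(\<lambda>y. w x y) \<in> borel_measurable borel" for x
    using measurable_compose[OF _ w, of "\<lambda>y. (x, y)"] by simp
  have bp: "borel_measurable (borel \<Otimes>\<^sub>M borel) = borel_measurable (borel :: ('a \<times> 'b) measure)"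
    by (simp add: borel_prod)
  have w2[measurable]: "(\<lambda>(x, y). w x y) \<in> borel_measurable (borel \<Otimes>\<^sub>M borel)"
    using w by (simp add: bp case_prod_beta')
  have f2[measurable]: "f \<in> borel_measurable (borel \<Otimes>\<^sub>M borel)"
    using f by (simp add: bp)
  have "(\<integral>\<^sup>+z. f z \<partial>fwd_prod ?\<nu> (gibbs_kernel w)) = (\<integral>\<^sup>+x. \<integral>\<^sup>+y. f (x, y) \<partial>gibbs_kernel w x \<partial>?\<nu>)"
    by (rule nn_integral_fwd_prod[OF P s K f])
  also have "\<dots> = (\<integral>\<^sup>+x. \<integral>\<^sup>+y. ennreal (exp (- w x y)) * f (x, y) \<partial>lborel \<partial>?\<nu>)"
    unfolding gibbs_kernel_def by (intro nn_integral_cong gibbs_nn_integral) measurable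
  also have "\<dots> = (\<integral>\<^sup>+x. p x * (\<integral>\<^sup>+y. ennreal (exp (- w x y)) * f (x, y) \<partial>lborel) \<partial>lborel)"
    by (intro nn_integral_density) measurable
  also have "\<dots> = (\<integral>\<^sup>+x. \<integral>\<^sup>+y. p x * ennreal (exp (- w x y)) * f (x, y) \<partial>lborel \<partial>lborel)"
    by (simp add: nn_integral_cmult mult.assoc)
  also have "\<dots> = (\<integral>\<^sup>+z. p (fst z) * ennreal (exp (- w (fst z) (snd z))) * f z \<partial>(lborel \<Otimes>\<^sub>M lborel))"
    by (subst lborel.nn_integral_fst[symmetric]) (auto simp: lborel_prod)
  also have "\<dots> = (\<integral>\<^sup>+z. f z \<partial>density lborel (\<lambda>z. p (fst z) * ennreal (exp (- w (fst z) (snd z)))))"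
    by (subst nn_integral_density) (auto simp: lborel_prod)
  finally show "(\<integral>\<^sup>+z. f z \<partial>fwd_prod ?\<nu> (gibbs_kernel w))
    = (\<integral>\<^sup>+z. f z \<partial>density lborel (\<lambda>z. p (fst z) * ennreal (exp (- w (fst z) (snd z)))))" .
qed

lemma fwd_prod_gibbs:
  fixes w :: "'a::euclidean_space \<Rightarrow> 'b::euclidean_space \<Rightarrow> real"
  assumes u[measurable]: "u \<in> borel_measurable borel" and P: "prob_space (gibbs u)"
    and w: "(\<lambda>z. w (fst z) (snd z)) \<in> borel_measurable borel" and K: "prob_kernel (gibbs_kernel w)"
  shows "fwd_prod (gibbs u) (gibbs_kernel w) = gibbs (\<lambda>z. u (fst z) + w (fst z) (snd z))"
  using fwd_prod_density_gibbs_kernel[OF _ _ w K, of "\<lambda>x. ennreal (exp (- u x))"] P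
  by (simp add: gibbs_def ennreal_mult[symmetric] exp_add[symmetric] algebra_simps)

text \<open>A continuous choice of the potential of the marginal. Its density is an integral of \<open>exp (- J)\<close>, whose
  continuity is not clear; but for almost every \<open>y\<close> it agrees almost everywhere with
  \<open>x \<mapsto> exp (w x y - J (x, y))\<close>. So one fixes a good \<open>y\<close>.\<close>

lemma disintegration_gibbs:
  fixes w :: "'a::euclidean_space \<Rightarrow> 'b::euclidean_space \<Rightarrow> real"
  assumes P: "prob_space \<nu>" and s: "sets \<nu> = sets borel"
    and w: "continuous_on UNIV (\<lambda>z. w (fst z) (snd z))" and K: "prob_kernel (gibbs_kernel w)"
    and J: "continuous_on UNIV J" and eq: "fwd_prod \<nu> (gibbs_kernel w) = gibbs J"
  obtains u where "continuous_on UNIV u" "\<nu> = gibbs u" "\<And>x y. J (x, y) = u x + w x y"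
proof -
  have wm[measurable]: "(\<lambda>z. w (fst z) (snd z)) \<in> borel_measurable borel"
    and Jm[measurable]: "J \<in> borel_measurable borel"
    using w J by (auto intro: borel_measurable_continuous_onI)
  have bp: "borel_measurable (borel \<Otimes>\<^sub>M borel) = borel_measurable (borel :: ('a \<times> 'b) measure)"
    by (simp add: borel_prod)
  have J2[measurable]: "J \<in> borel_measurable (borel \<Otimes>\<^sub>M borel)" using Jm by (simp add: bp)
  have w2[measurable]: "(\<lambda>(x, y). w x y) \<in> borel_measurable (borel \<Otimes>\<^sub>M borel)"
    using wm by (simp add: bp case_prod_beta')
  define p where "p x = (\<integral>\<^sup>+y. ennreal (exp (- J (x, y))) \<partial>lborel)" for x
  have p[measurable]: "p \<in> borel_measurable borel"
    unfolding p_def[abs_def] by measurable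
  note [measurable] = measurable_comp_fst[OF p]
  have \<nu>p: "\<nu> = density lborel p"
  proof (rule measure_eqI_nn_integral)
    show "sets \<nu> = sets (density lborel p)" using s by simp
    fix f :: "_ \<Rightarrow> ennreal" assume "f \<in> borel_measurable \<nu>"
    then have f[measurable]: "f \<in> borel_measurable borel" using s by (simp cong: measurable_cong_sets)
    note [measurable] = measurable_comp_fst[OF f]
    have "(\<integral>\<^sup>+x. f x \<partial>\<nu>) = (\<integral>\<^sup>+x. f x \<partial>distr (gibbs J) borel fst)"
      using distr_fwd_prod_fst[OF P s K] eq by simp
    also have "\<dots> = (\<integral>\<^sup>+z. f (fst z) \<partial>gibbs J)"
      using f measurable_fst_borel by (intro nn_integral_distr) (simp_all cong: measurable_cong_sets)
    also have "\<dots> = (\<integral>\<^sup>+z. ennreal (exp (- J z)) * f (fst z) \<partial>(lborel \<Otimes>\<^sub>M lborel))"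
      by (subst gibbs_nn_integral) (auto simp: lborel_prod)
    also have "\<dots> = (\<integral>\<^sup>+x. \<integral>\<^sup>+y. ennreal (exp (- J (x, y))) * f x \<partial>lborel \<partial>lborel)"
      by (subst lborel.nn_integral_fst[symmetric]) (auto simp: lborel_prod)
    also have "\<dots> = (\<integral>\<^sup>+x. p x * f x \<partial>lborel)"
      unfolding p_def by (intro nn_integral_cong nn_integral_multc) measurable
    also have "\<dots> = (\<integral>\<^sup>+x. f x \<partial>density lborel p)"
      by (intro nn_integral_density[symmetric]) auto
    finally show "(\<integral>\<^sup>+x. f x \<partial>\<nu>) = (\<integral>\<^sup>+x. f x \<partial>density lborel p)" .
  qed
  have "density lborel (\<lambda>z. p (fst z) * ennreal (exp (- w (fst z) (snd z))))
      = density lborel (\<lambda>z. ennreal (exp (- J z)))"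
    using fwd_prod_density_gibbs_kernel[OF p _ wm K] P eq by (simp add: \<nu>p gibbs_def)
  then have "AE z in lborel. p (fst z) * ennreal (exp (- w (fst z) (snd z))) = ennreal (exp (- J z))"
    by (intro sigma_finite_measure.density_unique[OF sigma_finite_lborel]) auto
  then have ae: "AE z in lborel \<Otimes>\<^sub>M lborel. p (fst z) * ennreal (exp (- w (fst z) (snd z))) = ennreal (exp (- J z))"
    unfolding lborel_prod .
  have [measurable]: "(\<lambda>z. p (fst z) * ennreal (exp (- w (fst z) (snd z)))) \<in> borel_measurable (lborel \<Otimes>\<^sub>M lborel)"
    "J \<in> borel_measurable (lborel \<Otimes>\<^sub>M lborel)"
    unfolding lborel_prod by simp_all
  have meas: "{z \<in> space (lborel \<Otimes>\<^sub>M lborel). p (fst z) * ennreal (exp (- w (fst z) (snd z))) = ennreal (exp (- J z))}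
      \<in> sets (lborel \<Otimes>\<^sub>M lborel)"
    by measurable
  from ae have "AE x in lborel. AE y in lborel. p x * ennreal (exp (- w x y)) = ennreal (exp (- J (x, y)))"
    using lborel_pair.AE_pair by fastforce
  then have "AE y in lborel. AE x in lborel. p x * ennreal (exp (- w x y)) = ennreal (exp (- J (x, y)))"
    by (subst (asm) lborel_pair.AE_commute) (use meas in auto)
  then have "\<exists>y0. AE x in lborel. p x * ennreal (exp (- w x y0)) = ennreal (exp (- J (x, y0)))"
    using eventually_happens'[of "ae_filter (lborel :: 'b measure)"] by (simp add: ae_filter_eq_bot_iff)
  then obtain y0 where y0: "AE x in lborel. p x * ennreal (exp (- w x y0)) = ennreal (exp (- J (x, y0)))"
    by blast
  define u where "u x = J (x, y0) - w x y0" for x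
  have uc: "continuous_on UNIV u"
    unfolding u_def[abs_def]
    using continuous_on_compose2[OF J, of UNIV "\<lambda>x. (x, y0)"] continuous_on_compose2[OF w, of UNIV "\<lambda>x. (x, y0)"]
    by (intro continuous_on_diff) (simp_all add: continuous_on_Pair)
  have um[measurable]: "u \<in> borel_measurable borel" using uc by (rule borel_measurable_continuous_onI)
  have \<nu>u: "\<nu> = gibbs u"
    unfolding \<nu>p gibbs_def
  proof (rule density_cong)
    show "AE x in lborel. p x = ennreal (exp (- u x))"
      using y0
    proof eventually_elim
      fix x assume *: "p x * ennreal (exp (- w x y0)) = ennreal (exp (- J (x, y0)))"
      have "p x = p x * (ennreal (exp (- w x y0)) * ennreal (exp (w x y0)))"
        by (simp add: ennreal_mult[symmetric] exp_add[symmetric])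
      also have "\<dots> = ennreal (exp (- J (x, y0))) * ennreal (exp (w x y0))"
        by (simp add: * mult.assoc[symmetric])
      also have "\<dots> = ennreal (exp (- u x))"
        by (simp add: ennreal_mult[symmetric] exp_add[symmetric] u_def)
      finally show "p x = ennreal (exp (- u x))" .
    qed
  qed auto
  have "gibbs (\<lambda>z. u (fst z) + w (fst z) (snd z)) = gibbs J"
    using fwd_prod_gibbs[OF um _ wm K] P eq by (simp add: \<nu>u)
  then have "(\<lambda>z. u (fst z) + w (fst z) (snd z)) = J"
    using w J continuous_on_compose2[OF uc continuous_on_fst[OF continuous_on_id], of UNIV]
    by (intro gibbs_inject continuous_on_add) auto
  then have "J (x, y) = u x + w x y" for x y by auto
  with uc \<nu>u show ?thesis using that by blast
qed

text \<open>Draw \<open>(x', x)\<close> from \<open>\<gamma>\<close> and then \<open>y\<close> from the kernel at \<open>x'\<close> (law \<open>R\<close>) or at \<open>x\<close> (law \<open>S\<close>). The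
  relative entropy of \<open>R\<close> with respect to \<open>S\<close> is the \<open>\<gamma>\<close>-mean of the entropies between the kernels, and
  forgetting \<open>x'\<close> can only decrease it.\<close>

lemma couplings_glue:
  fixes w :: "'a::euclidean_space \<Rightarrow> 'b::euclidean_space \<Rightarrow> real"
  assumes w: "(\<lambda>z. w (fst z) (snd z)) \<in> borel_measurable borel" and K: "prob_kernel (gibbs_kernel w)"
    and \<gamma>: "\<gamma> \<in> couplings \<nu> \<mu>" and \<nu>: "prob_space \<nu>" and \<mu>: "prob_space \<mu>"
  obtains Q where "Q \<in> couplings \<mu> (\<nu> \<bind> gibbs_kernel w)"
    "rel_entropy Q (fwd_prod \<mu> (gibbs_kernel w))
      \<le> (\<integral>\<^sup>+z. rel_entropy (gibbs_kernel w (fst z)) (gibbs_kernel w (snd z)) \<partial>\<gamma>)"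
proof -
  have s\<gamma>: "sets \<gamma> = sets borel" and \<gamma>1: "distr \<gamma> borel fst = \<nu>" and \<gamma>2: "distr \<gamma> borel snd = \<mu>"
    using \<gamma> by (auto simp: couplings_def)
  note [measurable_cong] = s\<gamma> and [measurable] = measurable_fst_borel measurable_snd_borel
  have sn: "sets \<nu> = sets borel" "sets \<mu> = sets borel" using \<gamma>1 \<gamma>2 by auto
  have p\<gamma>: "prob_space \<gamma>"
    using \<nu> measurable_fst_borel s\<gamma>
    by (intro prob_space_distrD[of fst \<gamma> borel]) (simp_all add: \<gamma>1 cong: measurable_cong_sets)
  let ?K = "gibbs_kernel w"
  let ?K1 = "\<lambda>z::'a\<times>'a. ?K (fst z)" and ?K2 = "\<lambda>z::'a\<times>'a. ?K (snd z)"
  have K1: "prob_kernel ?K1" by (rule measurable_compose[OF _ K]) measurable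
  have K2: "prob_kernel ?K2" by (rule measurable_compose[OF _ K]) measurable
  note [measurable] = w
  have ws[measurable]: "(\<lambda>y. w x y) \<in> borel_measurable borel" for x
    using measurable_compose[OF _ w, of "\<lambda>y. (x, y)"] by simp
  define R where "R = fwd_prod \<gamma> ?K1"
  define S where "S = fwd_prod \<gamma> ?K2"
  have R: "prob_space R" "sets R = sets borel" unfolding R_def by (rule fwd_prod_prob[OF p\<gamma> s\<gamma> K1])+
  have S: "prob_space S" "sets S = sets borel" unfolding S_def by (rule fwd_prod_prob[OF p\<gamma> s\<gamma> K2])+
  note [measurable_cong] = R(2) S(2)
  define T where "T z = (snd (fst z), snd z)" for z :: "('a\<times>'a)\<times>'b"
  have T[measurable]: "T \<in> borel \<rightarrow>\<^sub>M borel"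
    unfolding T_def[abs_def] by (intro borel_measurable_continuous_onI continuous_intros)
  define h where "h z = exp (w (snd (fst z)) (snd z) - w (fst (fst z)) (snd z))" for z :: "('a\<times>'a)\<times>'b"
  have [measurable]: "(\<lambda>z::('a\<times>'a)\<times>'b. w (snd (fst z)) (snd z)) \<in> borel_measurable borel"
    using measurable_compose[OF T w] by (simp add: T_def)
  have T1: "(\<lambda>z::('a\<times>'a)\<times>'b. (fst (fst z), snd z)) \<in> borel \<rightarrow>\<^sub>M borel"
    by (intro borel_measurable_continuous_onI continuous_intros)
  have [measurable]: "(\<lambda>z::('a\<times>'a)\<times>'b. w (fst (fst z)) (snd z)) \<in> borel_measurable borel"
    using measurable_compose[OF T1 w] by simp
  have h[measurable]: "h \<in> borel_measurable borel"
    unfolding h_def[abs_def] by measurable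
  have hz[measurable]: "(\<lambda>y. h (z, y)) \<in> borel_measurable borel" for z
    unfolding h_def by measurable
  have Kd: "?K (fst z) = density (?K (snd z)) (\<lambda>y. ennreal (h (z, y)))" for z
    unfolding h_def gibbs_kernel_def by (subst density_gibbs) auto
  have RS: "R = density S (\<lambda>z. ennreal (h z))"
  proof (rule measure_eqI_nn_integral)
    show "sets R = sets (density S (\<lambda>z. ennreal (h z)))" using R S by simp
    fix f :: "_ \<Rightarrow> ennreal" assume "f \<in> borel_measurable R"
    then have f[measurable]: "f \<in> borel_measurable borel" using R by (simp cong: measurable_cong_sets)
    have fz[measurable]: "(\<lambda>y. f (z, y)) \<in> borel_measurable borel" for z
      using measurable_compose[OF _ f, of "\<lambda>y. (z, y)"] by simp
    have "(\<integral>\<^sup>+z. f z \<partial>R) = (\<integral>\<^sup>+z. \<integral>\<^sup>+y. f (z, y) \<partial>?K (fst z) \<partial>\<gamma>)"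
      unfolding R_def by (rule nn_integral_fwd_prod[OF p\<gamma> s\<gamma> K1 f])
    also have "\<dots> = (\<integral>\<^sup>+z. \<integral>\<^sup>+y. ennreal (h (z, y)) * f (z, y) \<partial>?K (snd z) \<partial>\<gamma>)"
    proof (rule nn_integral_cong)
      fix z
      show "(\<integral>\<^sup>+y. f (z, y) \<partial>?K (fst z)) = (\<integral>\<^sup>+y. ennreal (h (z, y)) * f (z, y) \<partial>?K (snd z))"
        using prob_kernelD(2)[OF K, of "snd z"]
        by (subst Kd, subst nn_integral_density) (auto cong: measurable_cong_sets)
    qed
    also have "\<dots> = (\<integral>\<^sup>+z. ennreal (h z) * f z \<partial>S)"
      unfolding S_def by (subst nn_integral_fwd_prod[OF p\<gamma> s\<gamma> K2]) auto
    also have "\<dots> = (\<integral>\<^sup>+z. f z \<partial>density S (\<lambda>z. ennreal (h z)))"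
      by (intro nn_integral_density[symmetric]) auto
    finally show "(\<integral>\<^sup>+z. f z \<partial>R) = (\<integral>\<^sup>+z. f z \<partial>density S (\<lambda>z. ennreal (h z)))" .
  qed
  have "rel_entropy R S = (\<integral>\<^sup>+z. ennreal (entropy_fun (h z)) \<partial>S)"
    using R(1) unfolding RS by (intro rel_entropy_density S) (auto simp: h_def)
  also have "\<dots> = (\<integral>\<^sup>+z. \<integral>\<^sup>+y. ennreal (entropy_fun (h (z, y))) \<partial>?K (snd z) \<partial>\<gamma>)"
    unfolding S_def by (subst nn_integral_fwd_prod[OF p\<gamma> s\<gamma> K2]) auto
  also have "\<dots> = (\<integral>\<^sup>+z. rel_entropy (?K (fst z)) (?K (snd z)) \<partial>\<gamma>)"
  proof (rule nn_integral_cong)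
    fix z
    show "(\<integral>\<^sup>+y. ennreal (entropy_fun (h (z, y))) \<partial>?K (snd z)) = rel_entropy (?K (fst z)) (?K (snd z))"
      using prob_kernelD[OF K, of "snd z"] prob_kernelD(1)[OF K, of "fst z"] unfolding Kd[of z]
      by (subst rel_entropy_density) (auto simp: h_def cong: measurable_cong_sets)
  qed
  finally have RSH: "rel_entropy R S = (\<integral>\<^sup>+z. rel_entropy (?K (fst z)) (?K (snd z)) \<partial>\<gamma>)" .
  have ST: "distr S borel T = fwd_prod \<mu> ?K"
  proof (rule measure_eqI_nn_integral)
    show "sets (distr S borel T) = sets (fwd_prod \<mu> ?K)" using fwd_prod_prob[OF \<mu> sn(2) K] by simp
    fix f :: "_ \<Rightarrow> ennreal" assume "f \<in> borel_measurable (distr S borel T)"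
    then have f[measurable]: "f \<in> borel_measurable borel" by simp
    have "(\<integral>\<^sup>+z. f z \<partial>distr S borel T) = (\<integral>\<^sup>+z. f (T z) \<partial>S)" by (intro nn_integral_distr) auto
    also have "\<dots> = (\<integral>\<^sup>+z. \<integral>\<^sup>+y. f (snd z, y) \<partial>?K (snd z) \<partial>\<gamma>)"
      unfolding S_def by (subst nn_integral_fwd_prod[OF p\<gamma> s\<gamma> K2]) (auto simp: T_def)
    also have "\<dots> = (\<integral>\<^sup>+x. \<integral>\<^sup>+y. f (x, y) \<partial>?K x \<partial>distr \<gamma> borel snd)"
    proof -
      have "(\<lambda>x. \<integral>\<^sup>+y. f (x, y) \<partial>?K x) \<in> borel_measurable borel"
        using f K by (intro nn_integral_measurable_subprob_algebra2[where N=borel])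
          (auto intro: measurable_prob_algebraD simp: borel_prod case_prod_beta')
      then show ?thesis by (subst nn_integral_distr) auto
    qed
    also have "\<dots> = (\<integral>\<^sup>+z. f z \<partial>fwd_prod \<mu> ?K)"
      unfolding \<gamma>2 by (rule nn_integral_fwd_prod[OF \<mu> sn(2) K f, symmetric])
    finally show "(\<integral>\<^sup>+z. f z \<partial>distr S borel T) = (\<integral>\<^sup>+z. f z \<partial>fwd_prod \<mu> ?K)" .
  qed
  define Q where "Q = distr R borel T"
  have "Q \<in> couplings \<mu> (\<nu> \<bind> ?K)"
    unfolding couplings_def
  proof (intro CollectI conjI)
    show "sets Q = sets borel" by (simp add: Q_def)
    have "distr Q borel fst = distr R borel (snd \<circ> fst)"
      unfolding Q_def by (subst distr_distr) (auto simp: T_def comp_def)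
    also have "\<dots> = distr (distr R borel fst) borel snd"
      by (subst distr_distr) auto
    also have "distr R borel fst = \<gamma>" unfolding R_def by (rule distr_fwd_prod_fst[OF p\<gamma> s\<gamma> K1])
    finally show "distr Q borel fst = \<mu>" using \<gamma>2 by simp
    have "distr Q borel snd = distr R borel snd"
      unfolding Q_def by (subst distr_distr) (auto simp: T_def comp_def)
    also have "\<dots> = \<gamma> \<bind> ?K1" unfolding R_def by (rule distr_fwd_prod_snd[OF p\<gamma> s\<gamma> K1])
    also have "\<dots> = distr \<gamma> borel fst \<bind> ?K"
      using prob_space.not_empty[OF p\<gamma>] measurable_prob_algebraD[OF K]
      by (subst bind_distr[where K=borel]) auto
    finally show "distr Q borel snd = \<nu> \<bind> ?K" using \<gamma>1 by simp
  qed
  moreover have "rel_entropy Q (fwd_prod \<mu> ?K) \<le> rel_entropy R S"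
    unfolding Q_def ST[symmetric] using R S by (intro rel_entropy_distr_le) auto
  ultimately show ?thesis using that RSH by auto
qed

section \<open>Spectral norm and positive matrices\<close>

lemma spectral_norm_bound: "norm (A *v x) \<le> spectral_norm A * norm x"
  unfolding spectral_norm_def by (intro onorm matrix_vector_mul_bounded_linear)

lemma spectral_norm_nonneg: "0 \<le> spectral_norm A"
  unfolding spectral_norm_def by (intro onorm_pos_le matrix_vector_mul_bounded_linear)

text \<open>From \<open>|A\<^sup>T x|\<^sup>2 = x \<bullet> A A\<^sup>T x \<le> |x| |A| |A\<^sup>T x|\<close>.\<close>

lemma spectral_norm_transpose_le:
  fixes A :: "real^'n^'n"
  shows "norm (transpose A *v x) \<le> spectral_norm A * norm x"
proof -
  let ?y = "transpose A *v x"
  have "norm ?y * norm ?y = ?y \<bullet> ?y" by (simp add: power2_norm_eq_inner[symmetric] power2_eq_square)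
  also have "\<dots> = x \<bullet> (A *v ?y)" by (simp add: dot_lmul_matrix)
  also have "\<dots> \<le> norm x * norm (A *v ?y)" by (rule norm_cauchy_schwarz)
  also have "\<dots> \<le> norm x * (spectral_norm A * norm ?y)"
    by (intro mult_left_mono spectral_norm_bound) auto
  finally have "norm ?y * norm ?y \<le> (spectral_norm A * norm x) * norm ?y" by (simp add: algebra_simps)
  then show ?thesis
    by (cases "norm ?y = 0") (auto simp: spectral_norm_nonneg mult_le_cancel_right)
qed

lemma pos_def_invertible:
  assumes "pos_def A" shows "invertible A"
proof -
  have "inj ((*v) A)"
  proof (rule injI)
    fix x y assume "A *v x = A *v y"
    then have "(x - y) \<bullet> (A *v (x - y)) = 0" by (simp add: matrix_vector_mult_diff_distrib)
    with assms show "x = y" unfolding pos_def_def by (metis less_irrefl right_minus_eq)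
  qed
  then show ?thesis
    by (simp add: invertible_left_inverse matrix_left_invertible_injective)
qed

lemma invertible_matrix_inv:
  fixes A :: "real^'n^'n"
  assumes "invertible A" shows "invertible (matrix_inv A)"
proof -
  have "A ** matrix_inv A = mat 1 \<and> matrix_inv A ** A = mat 1"
    using assms unfolding invertible_def matrix_inv_def by (rule someI_ex)
  then show ?thesis by (auto simp: invertible_def)
qed

lemma matrix_inv_mult:
  fixes A :: "real^'n^'n"
  assumes "invertible A" shows "A *v (matrix_inv A *v x) = x" "matrix_inv A *v (A *v x) = x"
proof -
  have "A ** matrix_inv A = mat 1 \<and> matrix_inv A ** A = mat 1"
    using assms unfolding invertible_def matrix_inv_def by (rule someI_ex)
  then show "A *v (matrix_inv A *v x) = x" "matrix_inv A *v (A *v x) = x"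
    by (simp_all add: matrix_vector_mul_assoc)
qed

lemma symmetric_matrix_inner:
  fixes A :: "real^'n^'n"
  assumes "transpose A = A" shows "x \<bullet> (A *v y) = (A *v x) \<bullet> y"
  using dot_lmul_matrix[of x A y] assms by (metis transpose_matrix_vector)

lemma invertible_spectral_norm_pos:
  fixes A :: "real^'n^'n"
  assumes "invertible A" shows "0 < spectral_norm A"
proof -
  obtain b :: "real^'n" where b: "b \<in> Basis" using nonempty_Basis by blast
  have "spectral_norm A \<noteq> 0"
  proof
    assume "spectral_norm A = 0"
    then have "A *v b = 0" using spectral_norm_bound[of A b] by simp
    then have "b = 0" using matrix_inv_mult(2)[OF assms, of b] by simp
    with b show False by simp
  qed
  with spectral_norm_nonneg[of A] show ?thesis by simp
qed

lemma quadratic_form_le_spectral_norm: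
  "x \<bullet> (A *v x) \<le> spectral_norm A * (norm x)\<^sup>2"
proof -
  have "x \<bullet> (A *v x) \<le> norm x * norm (A *v x)" by (rule norm_cauchy_schwarz)
  also have "\<dots> \<le> norm x * (spectral_norm A * norm x)"
    by (intro mult_left_mono spectral_norm_bound) auto
  finally show ?thesis by (simp add: power2_eq_square algebra_simps)
qed

lemma pos_def_Cauchy_Schwarz:
  fixes A :: "real^'n^'n"
  assumes "pos_def A"
  shows "(x \<bullet> (A *v y))\<^sup>2 \<le> (x \<bullet> (A *v x)) * (y \<bullet> (A *v y))"
proof (cases "y = 0")
  case False
  let ?q = "\<lambda>x. x \<bullet> (A *v x)"
  have sym: "transpose A = A" and pos: "\<And>x. 0 \<le> ?q x" and qy: "0 < ?q y"
    using assms False unfolding pos_def_def by (auto, metis inner_zero_left less_eq_real_def)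
  define t where "t = (x \<bullet> (A *v y)) / ?q y"
  have "0 \<le> ?q (x - t *\<^sub>R y)" by (rule pos)
  also have "\<dots> = ?q x - 2 * t * (x \<bullet> (A *v y)) + t\<^sup>2 * ?q y"
    using symmetric_matrix_inner[OF sym, of y x]
    by (simp add: matrix_vector_mult_diff_distrib matrix_vector_mult_scaleR inner_diff_left inner_diff_right
        inner_commute power2_eq_square algebra_simps)
  also have "\<dots> = ?q x - (x \<bullet> (A *v y))\<^sup>2 / ?q y"
    using qy by (simp add: t_def power2_eq_square field_simps)
  finally show ?thesis using qy by (simp add: field_simps)
qed simp

text \<open>Put \<open>u = A\<^sup>-\<^sup>1 x\<close> and apply the Cauchy-Schwarz inequality of the form \<open>A\<close> to \<open>x\<close> and \<open>u\<close>:
  \<open>|x|\<^sup>4 = (x \<bullet> A u)\<^sup>2 \<le> (x \<bullet> A x) (u \<bullet> A u)\<close>.\<close>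

lemma matrix_inv_ge_inverse_spectral_norm:
  fixes A :: "real^'n^'n"
  assumes "pos_def A"
  shows "inverse (spectral_norm A) * (norm x)\<^sup>2 \<le> x \<bullet> (matrix_inv A *v x)"
proof -
  have inv: "invertible A" by (rule pos_def_invertible[OF assms])
  have sp: "0 < spectral_norm A" by (rule invertible_spectral_norm_pos[OF inv])
  define u where "u = matrix_inv A *v x"
  have x: "A *v u = x" by (simp add: u_def matrix_inv_mult[OF inv])
  have q: "0 \<le> u \<bullet> (A *v u)" using assms unfolding pos_def_def by (metis inner_zero_left less_eq_real_def)
  have "((norm x)\<^sup>2)\<^sup>2 = (x \<bullet> (A *v u))\<^sup>2" by (simp add: x power2_norm_eq_inner)
  also have "\<dots> \<le> (x \<bullet> (A *v x)) * (u \<bullet> (A *v u))" by (rule pos_def_Cauchy_Schwarz[OF assms])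
  also have "\<dots> \<le> (spectral_norm A * (norm x)\<^sup>2) * (u \<bullet> (A *v u))"
    by (intro mult_right_mono quadratic_form_le_spectral_norm q)
  finally have "(norm x)\<^sup>2 * (norm x)\<^sup>2 \<le> (norm x)\<^sup>2 * (spectral_norm A * (u \<bullet> x))"
    by (simp only: x power2_eq_square[of "(norm x)\<^sup>2"] mult_ac)
  then have "(norm x)\<^sup>2 \<le> spectral_norm A * (u \<bullet> x)"
    using mult_left_le_imp_le[of "(norm x)\<^sup>2" "(norm x)\<^sup>2"] by (cases "x = 0") auto
  then show ?thesis using sp by (simp add: u_def inner_commute field_simps)
qed

section \<open>Smooth functions\<close>

lemma smooth_differentiable: "smooth f \<Longrightarrow> f differentiable (at x)"
  unfolding smooth_def using times_cont_diff.simps(2)[of 0 f] by blast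

lemma smooth_continuous: "smooth f \<Longrightarrow> continuous_on UNIV f"
  unfolding smooth_def using times_cont_diff.simps(1)[of f] by blast

lemma smooth_frechet_derivative: "smooth f \<Longrightarrow> smooth (\<lambda>x. frechet_derivative f (at x) v)"
  unfolding smooth_def by (metis times_cont_diff.simps(2))

lemma smooth_has_derivative: "smooth f \<Longrightarrow> (f has_derivative frechet_derivative f (at x)) (at x)"
  using smooth_differentiable frechet_derivative_works by blast

lemma times_cont_diff_affine:
  fixes f :: "'a::euclidean_space \<Rightarrow> real" and L :: "'b::euclidean_space \<Rightarrow> 'a"
  assumes L: "bounded_linear L"
  shows "times_cont_diff k f \<Longrightarrow> times_cont_diff k (\<lambda>y. f (c + L y))"
proof (induction k arbitrary: f)
  case 0
  have "continuous_on UNIV (\<lambda>y. c + L y)"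
    by (intro continuous_intros linear_continuous_on L)
  with 0 show ?case by (auto intro: continuous_on_compose2)
next
  case (Suc k)
  have d: "((\<lambda>y. f (c + L y)) has_derivative (\<lambda>h. frechet_derivative f (at (c + L y)) (L h))) (at y)" for y
  proof (rule has_derivative_compose[of "\<lambda>y. c + L y"])
    show "((\<lambda>y. c + L y) has_derivative L) (at y)"
      using bounded_linear_imp_has_derivative[OF L] by (auto intro!: derivative_eq_intros)
    show "(f has_derivative frechet_derivative f (at (c + L y))) (at (c + L y))"
      using Suc.prems by (simp add: frechet_derivative_works[symmetric])
  qed
  have fd: "frechet_derivative (\<lambda>y. f (c + L y)) (at y) v = frechet_derivative f (at (c + L y)) (L v)" for y v
    by (rule fun_cong[OF frechet_derivative_at[OF d], symmetric])
  have "times_cont_diff k (\<lambda>y. frechet_derivative f (at (c + L y)) (L v))" for v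
    using Suc.prems by (intro Suc.IH) auto
  then show ?case by (simp add: fd differentiableI[OF d])
qed

lemma smooth_slice:
  fixes w :: "'a::euclidean_space \<Rightarrow> 'b::euclidean_space \<Rightarrow> real"
  assumes "smooth (\<lambda>(x, y). w x y)"
  shows "smooth (\<lambda>y. w x y)" "smooth (\<lambda>x. w x y)"
proof -
  have "bounded_linear (\<lambda>y. (0::'a, y::'b))" "bounded_linear (\<lambda>x. (x::'a, 0::'b))"
    by (simp_all add: bounded_linear_Pair bounded_linear_zero bounded_linear_ident)
  from times_cont_diff_affine[OF this(1), of _ "\<lambda>(x, y). w x y" "(x, 0)"]
    times_cont_diff_affine[OF this(2), of _ "\<lambda>(x, y). w x y" "(0, y)"]
  show "smooth (\<lambda>y. w x y)" "smooth (\<lambda>x. w x y)"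
    using assms by (auto simp: smooth_def)
qed

text \<open>Every statement about Hessians below is about the quadratic form, that is about second derivatives
  along lines.\<close>

lemma hessian_quadratic:
  fixes f :: "real^'n \<Rightarrow> real"
  assumes f: "smooth f"
  shows "v \<bullet> (hessian f x *v v)
    = frechet_derivative (\<lambda>y. frechet_derivative f (at y) v) (at x) v"
proof -
  let ?D = "\<lambda>v y. frechet_derivative f (at y) v"
  have lin: "linear (frechet_derivative f (at y))" for y
    using smooth_has_derivative[OF f] by (rule has_derivative_linear)
  have dD: "(?D u has_derivative frechet_derivative (?D u) (at x)) (at x)" for u
    by (intro smooth_has_derivative smooth_frechet_derivative f)
  have "(gradient f has_derivative (\<lambda>h. \<chi> i. frechet_derivative (?D (axis i 1)) (at x) h)) (at x)"
    unfolding gradient_def[abs_def]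
  proof (subst has_derivative_componentwise_within, intro ballI)
    fix b :: "real^'n" assume "b \<in> Basis"
    then obtain i where b: "b = axis i 1" by (auto simp: Basis_vec_def)
    show "((\<lambda>x. (\<chi> i. ?D (axis i 1) x) \<bullet> b) has_derivative
        (\<lambda>y. (\<chi> i. frechet_derivative (?D (axis i 1)) (at x) y) \<bullet> b)) (at x)"
      using dD[of "axis i 1"] by (simp add: b inner_axis)
  qed
  then have "(\<lambda>h. \<chi> i. frechet_derivative (?D (axis i 1)) (at x) h) = (\<lambda>h. hessian f x *v h)"
    unfolding hessian_def
    using has_derivative_unique jacobian_works differentiableI by blast
  then have H: "hessian f x *v v = (\<chi> i. frechet_derivative (?D (axis i 1)) (at x) v)" by metis
  have v: "v = (\<Sum>i\<in>UNIV. v $ i *\<^sub>R axis i 1)"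
    using basis_expansion[of v] by (simp add: scalar_mult_eq_scaleR)
  have Dv: "?D v y = (\<Sum>i\<in>UNIV. v $ i * ?D (axis i 1) y)" for y
  proof -
    have "?D v y = ?D (\<Sum>i\<in>UNIV. v $ i *\<^sub>R axis i 1) y" using v by simp
    also have "\<dots> = (\<Sum>i\<in>UNIV. v $ i * ?D (axis i 1) y)"
      by (simp add: linear_sum[OF lin] linear_cmul[OF lin])
    finally show ?thesis .
  qed
  have "((\<lambda>y. \<Sum>i\<in>UNIV. v $ i * ?D (axis i 1) y) has_derivative
      (\<lambda>h. \<Sum>i\<in>UNIV. v $ i * frechet_derivative (?D (axis i 1)) (at x) h)) (at x)"
    by (intro has_derivative_sum has_derivative_mult_right dD)
  then have dDv: "(?D v has_derivative
      (\<lambda>h. \<Sum>i\<in>UNIV. v $ i * frechet_derivative (?D (axis i 1)) (at x) h)) (at x)"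
    by (subst Dv)
  have "frechet_derivative (?D v) (at x) v = (\<Sum>i\<in>UNIV. v $ i * frechet_derivative (?D (axis i 1)) (at x) v)"
    by (rule fun_cong[OF frechet_derivative_at[OF dDv], symmetric])
  then show ?thesis by (simp add: H inner_vec_def)
qed

lemma smooth_along_line:
  fixes f :: "'a::euclidean_space \<Rightarrow> real"
  assumes "smooth f"
  shows "((\<lambda>t. f (x + t *\<^sub>R v)) has_real_derivative frechet_derivative f (at (x + t *\<^sub>R v)) v) (at t)"
proof -
  have "((\<lambda>t. f (x + t *\<^sub>R v)) has_derivative (\<lambda>h. frechet_derivative f (at (x + t *\<^sub>R v)) (h *\<^sub>R v))) (at t)"
    by (rule has_derivative_compose[of "\<lambda>t. x + t *\<^sub>R v"])
      (auto intro!: derivative_eq_intros smooth_has_derivative assms)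
  moreover have "frechet_derivative f (at (x + t *\<^sub>R v)) (h *\<^sub>R v) = frechet_derivative f (at (x + t *\<^sub>R v)) v * h" for h
    using linear_cmul[OF has_derivative_linear[OF smooth_has_derivative[OF assms]]] by simp
  ultimately show ?thesis by (simp add: has_field_derivative_def)
qed

lemma hessian_nonneg_of_convex:
  fixes f :: "real^'n \<Rightarrow> real"
  assumes f: "smooth f" and c: "convex_on UNIV f"
  shows "0 \<le> v \<bullet> (hessian f x *v v)"
proof -
  let ?D = "\<lambda>t. frechet_derivative f (at (x + t *\<^sub>R v)) v"
  have d1: "((\<lambda>t. f (x + t *\<^sub>R v)) has_real_derivative ?D t) (at t)" for t
    by (rule smooth_along_line[OF f])
  have d2: "(?D has_real_derivative v \<bullet> (hessian f x *v v)) (at 0)"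
    using smooth_along_line[OF smooth_frechet_derivative[OF f], of x v v 0] by (simp add: hessian_quadratic[OF f])
  have cv: "convex_on UNIV (\<lambda>t. f (x + t *\<^sub>R v))"
  proof (rule convex_onI)
    fix s a b :: real assume s: "0 < s" "s < 1"
    have "x + ((1 - s) *\<^sub>R a + s *\<^sub>R b) *\<^sub>R v = (1 - s) *\<^sub>R (x + a *\<^sub>R v) + s *\<^sub>R (x + b *\<^sub>R v)"
      by (simp add: algebra_simps)
    then show "f (x + ((1 - s) *\<^sub>R a + s *\<^sub>R b) *\<^sub>R v) \<le> (1 - s) * f (x + a *\<^sub>R v) + s * f (x + b *\<^sub>R v)"
      using convex_onD[OF c, of s "x + a *\<^sub>R v" "x + b *\<^sub>R v"] s by simp
  qed simp
  have "mono_on UNIV ?D"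
  proof (rule mono_onI)
    fix a b :: real assume ab: "a \<le> b"
    show "?D a \<le> ?D b"
    proof (cases "a = b")
      case False
      with ab have "a < b" by simp
      have "?D a * (b - a) \<le> f (x + b *\<^sub>R v) - f (x + a *\<^sub>R v)"
        using convex_on_imp_above_tangent[OF cv, of a b "?D a"] d1 by auto
      moreover have "?D b * (a - b) \<le> f (x + a *\<^sub>R v) - f (x + b *\<^sub>R v)"
        using convex_on_imp_above_tangent[OF cv, of b a "?D b"] d1 by auto
      ultimately have "?D a * (b - a) \<le> ?D b * (b - a)" by (simp add: algebra_simps)
      with \<open>a < b\<close> show ?thesis by simp
    qed simp
  qed
  then show ?thesis using mono_on_imp_deriv_nonneg[OF _ d2] by auto
qed

lemma hessian_quadratic_add:
  fixes f g h :: "real^'n \<Rightarrow> real"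
  assumes f: "smooth f" and g: "smooth g" and h: "smooth h" and eq: "\<And>y. h y = f y + g y - c"
  shows "v \<bullet> (hessian h x *v v) = v \<bullet> (hessian f x *v v) + v \<bullet> (hessian g x *v v)"
proof -
  have h_eq: "h = (\<lambda>y. f y + g y - c)" using eq by auto
  have d: "(h has_derivative (\<lambda>v. frechet_derivative f (at y) v + frechet_derivative g (at y) v)) (at y)" for y
    unfolding h_eq
    using has_derivative_diff[OF has_derivative_add[OF smooth_has_derivative[OF f, of y] smooth_has_derivative[OF g, of y]] has_derivative_const[of c]]
    by (simp only: diff_zero)
  have 1: "frechet_derivative h (at y) v = frechet_derivative f (at y) v + frechet_derivative g (at y) v" for y v
    by (rule fun_cong[OF frechet_derivative_at[OF d], symmetric])
  have d2: "((\<lambda>y. frechet_derivative h (at y) v) has_derivative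
      (\<lambda>u. frechet_derivative (\<lambda>y. frechet_derivative f (at y) v) (at x) u
         + frechet_derivative (\<lambda>y. frechet_derivative g (at y) v) (at x) u)) (at x)"
    unfolding 1
    by (intro has_derivative_add smooth_has_derivative smooth_frechet_derivative f g)
  show ?thesis
    unfolding hessian_quadratic[OF f] hessian_quadratic[OF g] hessian_quadratic[OF h]
    by (rule fun_cong[OF frechet_derivative_at[OF d2], symmetric])
qed

text \<open>Along the segment, \<open>f\<close> minus \<open>a |y - x|\<^sup>2 t\<^sup>2 / 2\<close> has a nonnegative second derivative.\<close>

lemma strongly_convex_of_hessian:
  fixes f :: "real^'n \<Rightarrow> real"
  assumes f: "smooth f" and a: "\<And>x v. a * (norm v)\<^sup>2 \<le> v \<bullet> (hessian f x *v v)"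
    and s: "0 \<le> s" "s \<le> 1"
  shows "f ((1 - s) *\<^sub>R x + s *\<^sub>R y) \<le> (1 - s) * f x + s * f y - a / 2 * (s * (1 - s)) * (norm (y - x))\<^sup>2"
proof -
  let ?v = "y - x"
  let ?g = "\<lambda>t. f (x + t *\<^sub>R ?v) - a / 2 * (norm ?v)\<^sup>2 * t\<^sup>2"
  let ?g' = "\<lambda>t. frechet_derivative f (at (x + t *\<^sub>R ?v)) ?v - a * (norm ?v)\<^sup>2 * t"
  have d0: "((\<lambda>t. f (x + t *\<^sub>R ?v)) has_real_derivative frechet_derivative f (at (x + t *\<^sub>R ?v)) ?v) (at t)" for t
    by (rule smooth_along_line[OF f])
  have d1: "(?g has_real_derivative ?g' t) (at t)" for t
    by (rule DERIV_diff[OF d0]) (auto intro!: derivative_eq_intros)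
  have e0: "((\<lambda>t. frechet_derivative f (at (x + t *\<^sub>R ?v)) ?v) has_real_derivative
      ?v \<bullet> (hessian f (x + t *\<^sub>R ?v) *v ?v)) (at t)" for t
    unfolding hessian_quadratic[OF f]
    by (rule smooth_along_line[OF smooth_frechet_derivative[OF f]])
  have d2: "(?g' has_real_derivative (?v \<bullet> (hessian f (x + t *\<^sub>R ?v) *v ?v) - a * (norm ?v)\<^sup>2)) (at t)" for t
    by (rule DERIV_diff[OF e0]) (auto intro!: derivative_eq_intros)
  have "convex_on UNIV ?g"
    by (rule f''_ge0_imp_convex[OF convex_UNIV d1 d2]) (use a in simp)
  from convex_onD[OF this s, of 0 1]
  have "?g s \<le> (1 - s) * ?g 0 + s * ?g 1" by simp
  moreover have "x + s *\<^sub>R ?v = (1 - s) *\<^sub>R x + s *\<^sub>R y" by (simp add: algebra_simps)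
  ultimately have "f ((1 - s) *\<^sub>R x + s *\<^sub>R y)
      \<le> (1 - s) * f x + s * (f y - a / 2 * (norm ?v)\<^sup>2) + a / 2 * (norm ?v)\<^sup>2 * s\<^sup>2" by simp
  also have "\<dots> = (1 - s) * f x + s * f y - a / 2 * (s * (1 - s)) * (norm ?v)\<^sup>2"
  proof -
    have "s * (f y - b * d) + b * d * s\<^sup>2 = s * f y - b * (s * (1 - s)) * d" for b d
      by (simp add: power2_eq_square algebra_simps)
    from this[of "a / 2" "(norm ?v)\<^sup>2"] show ?thesis by linarith
  qed
  finally show ?thesis .
qed

section \<open>The Prekopa-Leindler inequality\<close>

text \<open>With \<open>a\<close> close to \<open>sup X\<close> and \<open>b\<close> close to \<open>inf Y\<close>, the set \<open>Z\<close> contains a scaled copy of the part of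
  \<open>X\<close> below \<open>a\<close> and a scaled copy of the part of \<open>Y\<close> above \<open>b\<close>; they lie on different sides of
  \<open>(1 - s) a + s b\<close>. The superset \<open>Z\<close> stands for the Minkowski sum, which need not be measurable.\<close>

lemma brunn_minkowski_real:
  fixes X Y Z :: "real set"
  assumes [measurable]: "X \<in> sets borel" "Y \<in> sets borel" "Z \<in> sets borel"
    and ne: "X \<noteq> {}" "Y \<noteq> {}" and bd: "X \<subseteq> {-R..R}" "Y \<subseteq> {-R..R}" and s: "0 < s" "s < 1"
    and Z: "\<And>x y. x \<in> X \<Longrightarrow> y \<in> Y \<Longrightarrow> (1 - s) * x + s * y \<in> Z"
  shows "ennreal (1 - s) * emeasure lborel X + ennreal s * emeasure lborel Y \<le> emeasure lborel Z"
proof (rule ennreal_le_epsilon)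
  fix e :: real assume e: "0 < e"
  have bX: "bdd_above X" and bY: "bdd_below Y"
    using bd by (auto intro: bdd_above_mono bdd_below_mono)
  obtain a where a: "a \<in> X" "Sup X - e < a"
    using less_cSup_iff[OF ne(1) bX, of "Sup X - e"] e by auto
  obtain b where b: "b \<in> Y" "b < Inf Y + e"
    using cInf_less_iff[OF ne(2) bY, of "Inf Y + e"] e by auto
  let ?z = "(1 - s) * a + s * b"
  have X: "emeasure lborel X \<le> emeasure lborel (X \<inter> {..a}) + ennreal e"
  proof -
    have "X \<subseteq> (X \<inter> {..a}) \<union> {a..Sup X}" using cSup_upper[OF _ bX] by auto
    then have "emeasure lborel X \<le> emeasure lborel ((X \<inter> {..a}) \<union> {a..Sup X})"
      by (intro emeasure_mono) auto
    also have "\<dots> \<le> emeasure lborel (X \<inter> {..a}) + emeasure lborel {a..Sup X}"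
      by (intro emeasure_subadditive) auto
    also have "emeasure lborel {a..Sup X} \<le> ennreal e"
      using a e cSup_upper[OF a(1) bX] by (simp add: ennreal_leI)
    finally show ?thesis by simp
  qed
  have Y: "emeasure lborel Y \<le> emeasure lborel (Y \<inter> {b<..}) + ennreal e"
  proof -
    have "Y \<subseteq> (Y \<inter> {b<..}) \<union> {Inf Y..b}" using cInf_lower[OF _ bY] by auto
    then have "emeasure lborel Y \<le> emeasure lborel ((Y \<inter> {b<..}) \<union> {Inf Y..b})"
      by (intro emeasure_mono) auto
    also have "\<dots> \<le> emeasure lborel (Y \<inter> {b<..}) + emeasure lborel {Inf Y..b}"
      by (intro emeasure_subadditive) auto
    also have "emeasure lborel {Inf Y..b} \<le> ennreal e"
      using b e cInf_lower[OF b(1) bY] by (simp add: ennreal_leI)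
    finally show ?thesis by simp
  qed
  have ZX: "ennreal (1 - s) * emeasure lborel (X \<inter> {..a}) \<le> emeasure lborel (Z \<inter> {..?z})"
  proof -
    have "emeasure lborel (Z \<inter> {..?z}) = (\<integral>\<^sup>+x. indicator (Z \<inter> {..?z}) x \<partial>lborel)" by simp
    also have "\<dots> = ennreal \<bar>1 - s\<bar> * (\<integral>\<^sup>+x. indicator (Z \<inter> {..?z}) (s * b + (1 - s) * x) \<partial>lborel)"
      using s by (intro nn_integral_real_affine) auto
    also have "\<dots> \<ge> ennreal (1 - s) * (\<integral>\<^sup>+x. indicator (X \<inter> {..a}) x \<partial>lborel)"
      using s b Z by (auto intro!: mult_mono nn_integral_mono simp: indicator_def add.commute)
    finally show ?thesis by simp
  qed
  have ZY: "ennreal s * emeasure lborel (Y \<inter> {b<..}) \<le> emeasure lborel (Z \<inter> {?z<..})"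
  proof -
    have "emeasure lborel (Z \<inter> {?z<..}) = (\<integral>\<^sup>+x. indicator (Z \<inter> {?z<..}) x \<partial>lborel)" by simp
    also have "\<dots> = ennreal \<bar>s\<bar> * (\<integral>\<^sup>+x. indicator (Z \<inter> {?z<..}) ((1 - s) * a + s * x) \<partial>lborel)"
      using s by (intro nn_integral_real_affine) auto
    also have "\<dots> \<ge> ennreal s * (\<integral>\<^sup>+x. indicator (Y \<inter> {b<..}) x \<partial>lborel)"
      using s a Z by (auto intro!: mult_mono nn_integral_mono simp: indicator_def)
    finally show ?thesis by simp
  qed
  have "ennreal (1 - s) * emeasure lborel X + ennreal s * emeasure lborel Y
    \<le> ennreal (1 - s) * (emeasure lborel (X \<inter> {..a}) + ennreal e)
      + ennreal s * (emeasure lborel (Y \<inter> {b<..}) + ennreal e)"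
    by (intro add_mono mult_left_mono X Y) auto
  also have "\<dots> = (ennreal (1 - s) * emeasure lborel (X \<inter> {..a}) + ennreal s * emeasure lborel (Y \<inter> {b<..}))
      + (ennreal (1 - s) * ennreal e + ennreal s * ennreal e)"
    by (simp add: algebra_simps)
  also have "ennreal (1 - s) * ennreal e + ennreal s * ennreal e = ennreal e"
    using s e by (simp add: ennreal_mult[symmetric] ennreal_plus[symmetric] algebra_simps del: ennreal_plus)
  also have "ennreal (1 - s) * emeasure lborel (X \<inter> {..a}) + ennreal s * emeasure lborel (Y \<inter> {b<..})
      \<le> emeasure lborel (Z \<inter> {..?z}) + emeasure lborel (Z \<inter> {?z<..})"
    by (intro add_mono ZX ZY)
  also have "\<dots> = emeasure lborel ((Z \<inter> {..?z}) \<union> (Z \<inter> {?z<..}))"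
    by (intro plus_emeasure) auto
  also have "(Z \<inter> {..?z}) \<union> (Z \<inter> {?z<..}) = Z" by auto
  finally show "ennreal (1 - s) * emeasure lborel X + ennreal s * emeasure lborel Y
     \<le> emeasure lborel Z + ennreal e" by simp
qed

lemma nn_integral_layer_cake:
  fixes f :: "real \<Rightarrow> real"
  assumes f[measurable]: "f \<in> borel_measurable borel" and b: "\<And>x. 0 \<le> f x" "\<And>x. f x \<le> 1"
  shows "(\<integral>\<^sup>+x. ennreal (f x) \<partial>lborel)
    = (\<integral>\<^sup>+u. indicator {0<..<1} u * emeasure lborel {x. u < f x} \<partial>lborel)"
proof -
  have "(\<integral>\<^sup>+u. indicator {0<..<1} u * emeasure lborel {x. u < f x} \<partial>lborel)
      = (\<integral>\<^sup>+u. \<integral>\<^sup>+x. (if 0 < u \<and> u < 1 \<and> u < f x then 1 else 0) \<partial>lborel \<partial>lborel)"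
  proof (rule nn_integral_cong)
    fix u :: real
    have "indicator {0<..<1} u * emeasure lborel {x. u < f x}
        = (\<integral>\<^sup>+x. indicator {0<..<1} u * indicator {x. u < f x} x \<partial>lborel)"
      by (subst nn_integral_cmult) auto
    also have "\<dots> = (\<integral>\<^sup>+x. (if 0 < u \<and> u < 1 \<and> u < f x then 1 else 0) \<partial>lborel)"
      by (intro nn_integral_cong) (auto simp: indicator_def)
    finally show "indicator {0<..<1} u * emeasure lborel {x. u < f x}
        = (\<integral>\<^sup>+x. (if 0 < u \<and> u < 1 \<and> u < f x then 1 else 0) \<partial>lborel)" .
  qed
  also have "\<dots> = (\<integral>\<^sup>+x. \<integral>\<^sup>+u. (if 0 < u \<and> u < 1 \<and> u < f x then 1 else 0) \<partial>lborel \<partial>lborel)"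
    by (rule lborel_pair.Fubini') measurable
  also have "\<dots> = (\<integral>\<^sup>+x. ennreal (f x) \<partial>lborel)"
  proof (rule nn_integral_cong)
    fix x
    have "(\<integral>\<^sup>+u. (if 0 < u \<and> u < 1 \<and> u < f x then 1 else 0) \<partial>lborel)
        = (\<integral>\<^sup>+u. indicator {0<..<f x} u \<partial>lborel)"
      using b(2)[of x] by (intro nn_integral_cong) (auto simp: indicator_def)
    then show "(\<integral>\<^sup>+u. (if 0 < u \<and> u < 1 \<and> u < f x then 1 else 0) \<partial>lborel) = ennreal (f x)"
      using b(1)[of x] by simp
  qed
  finally show ?thesis ..
qed

text \<open>If both functions have supremum 1, their superlevel sets at a level below 1 are nonempty. So the
  Brunn-Minkowski inequality applies at every level, and the layer cake formula sums it up.\<close>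

lemma prekopa_leindler_normalized:
  fixes f g h :: "real \<Rightarrow> real"
  assumes [measurable]: "f \<in> borel_measurable borel" "g \<in> borel_measurable borel" "h \<in> borel_measurable borel"
    and f: "\<And>x. 0 \<le> f x" "\<And>x. f x \<le> 1" "\<And>x. f x \<noteq> 0 \<Longrightarrow> \<bar>x\<bar> \<le> R" "\<And>u. u < 1 \<Longrightarrow> \<exists>x. u < f x"
    and g: "\<And>x. 0 \<le> g x" "\<And>x. g x \<le> 1" "\<And>x. g x \<noteq> 0 \<Longrightarrow> \<bar>x\<bar> \<le> R" "\<And>u. u < 1 \<Longrightarrow> \<exists>x. u < g x"
    and h: "\<And>x. 0 \<le> h x" "\<And>x. h x \<le> 1" and s: "0 < s" "s < 1"
    and le: "\<And>x y u. 0 < u \<Longrightarrow> u < f x \<Longrightarrow> u < g y \<Longrightarrow> u \<le> h ((1 - s) * x + s * y)"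
  shows "ennreal (1 - s) * (\<integral>\<^sup>+x. f x \<partial>lborel) + ennreal s * (\<integral>\<^sup>+x. g x \<partial>lborel) \<le> (\<integral>\<^sup>+x. h x \<partial>lborel)"
proof -
  let ?L = "\<lambda>f u. indicator {0<..<1::real} u * emeasure lborel {x::real. u < (f x::real)}"
  have [measurable]: "?L f \<in> borel_measurable borel" "?L g \<in> borel_measurable borel" by measurable
  have "ennreal (1 - s) * (\<integral>\<^sup>+x. f x \<partial>lborel) + ennreal s * (\<integral>\<^sup>+x. g x \<partial>lborel)
      = (\<integral>\<^sup>+u. ennreal (1 - s) * ?L f u + ennreal s * ?L g u \<partial>lborel)"
    by (simp add: nn_integral_layer_cake f g nn_integral_add nn_integral_cmult)
  also have "\<dots> \<le> (\<integral>\<^sup>+u. ?L h u \<partial>lborel)"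
  proof (rule nn_integral_mono)
    fix u :: real
    show "ennreal (1 - s) * ?L f u + ennreal s * ?L g u \<le> ?L h u"
    proof (cases "0 < u \<and> u < 1")
      case True
      then have u: "0 < u" "u < 1" by auto
      have "ennreal (1 - s) * emeasure lborel {x. u < f x} + ennreal s * emeasure lborel {x. u < g x}
          \<le> emeasure lborel {x. u < h x}"
      proof (rule brunn_minkowski_real[where R=R])
        show "{x. u < f x} \<noteq> {}" "{x. u < g x} \<noteq> {}" using f(4)[of u] g(4)[of u] u by auto
        have "\<bar>x\<bar> \<le> R" if "u < f x" for x using f(3)[of x] that u by auto
        then show "{x. u < f x} \<subseteq> {-R..R}" by fastforce
        have "\<bar>x\<bar> \<le> R" if "u < g x" for x using g(3)[of x] that u by auto
        then show "{x. u < g x} \<subseteq> {-R..R}" by fastforce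
        fix x y assume "x \<in> {x. u < f x}" "y \<in> {x. u < g x}"
        then have *: "u < f x" "u < g y" by auto
        obtain u' where "u < u'" "u' < min (f x) (g y)" using dense[of u "min (f x) (g y)"] * by auto
        then show "(1 - s) * x + s * y \<in> {x. u < h x}" using le[of u' x y] u by auto
      qed (use s in auto)
      then show ?thesis using True by simp
    qed auto
  qed
  also have "\<dots> = (\<integral>\<^sup>+x. h x \<partial>lborel)" by (simp add: nn_integral_layer_cake h)
  finally show ?thesis .
qed

text \<open>Reduction to the normalised case: cut off in value and in space without losing too much of the
  integral, then divide by the supremum \<open>A\<close>. Normalising by the supremum, not by the integral, is what
  makes the superlevel sets nonempty.\<close>

lemma normalized_minorant:
  fixes f :: "real \<Rightarrow> ennreal"
  assumes f[measurable]: "f \<in> borel_measurable borel" and p: "0 < p" "ennreal p < (\<integral>\<^sup>+x. f x \<partial>lborel)"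
  obtains A \<phi> R where "0 < A" "\<phi> \<in> borel_measurable borel" "\<And>x. 0 \<le> \<phi> x" "\<And>x. \<phi> x \<le> (1::real)"
    "\<And>x. \<phi> x \<noteq> 0 \<Longrightarrow> \<bar>x\<bar> \<le> R" "\<And>u. u < 1 \<Longrightarrow> \<exists>x. u < \<phi> x"
    "\<And>x. ennreal (A * \<phi> x) \<le> f x" "ennreal p \<le> ennreal A * (\<integral>\<^sup>+x. \<phi> x \<partial>lborel)"
proof -
  let ?f = "\<lambda>n x. min (f x) (of_nat n) * indicator {- real n..real n} x"
  have SUP: "f x = (SUP n. ?f n x)" for x
  proof (rule antisym)
    obtain m :: nat where m: "\<bar>x\<bar> \<le> real m" using real_arch_simple by blast
    have "f x = (SUP n. min (f x) (of_nat n))"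
    proof (rule antisym)
      show "f x \<le> (SUP n. min (f x) (of_nat n))"
      proof (cases "f x = \<top>")
        case True
        then show ?thesis using ennreal_SUP_of_nat_eq_top by (simp add: min_def top_unique)
      next
        case False
        then obtain n :: nat where "f x \<le> of_nat n"
          using ennreal_Ex_less_of_nat[of "f x"] by (auto simp: less_top intro: less_imp_le)
        then show ?thesis by (intro SUP_upper2[of n]) (auto simp: min_def)
      qed
    qed (auto intro: SUP_least)
    also have "\<dots> \<le> (SUP n. ?f n x)"
    proof (rule SUP_mono)
      fix n :: nat
      have "min (f x) (of_nat n) \<le> ?f (max n m) x"
        using m by (auto simp: indicator_def intro: min.coboundedI2)
      then show "\<exists>k\<in>UNIV. min (f x) (of_nat n) \<le> ?f k x" by blast
    qed
    finally show "f x \<le> (SUP n. ?f n x)" .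
    show "(SUP n. ?f n x) \<le> f x" by (auto intro!: SUP_least simp: indicator_def)
  qed
  have inc: "incseq ?f"
    by (intro monoI le_funI) (auto simp: indicator_def intro: min.coboundedI2)
  have "(\<integral>\<^sup>+x. f x \<partial>lborel) = (SUP n. \<integral>\<^sup>+x. ?f n x \<partial>lborel)"
    by (subst SUP, rule nn_integral_monotone_convergence_SUP[OF inc]) measurable
  with p obtain n where n: "ennreal p < (\<integral>\<^sup>+x. ?f n x \<partial>lborel)" by (auto simp: less_SUP_iff)
  define r where "r x = enn2real (?f n x)" for x
  have rf: "ennreal (r x) = ?f n x" for x
  proof -
    have "?f n x < \<top>" by (auto simp: indicator_def min_less_iff_disj ennreal_of_nat_eq_real_of_nat)
    then show ?thesis by (simp add: r_def)
  qed
  have r0: "0 \<le> r x" for x by (simp add: r_def)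
  have rn: "r x \<le> real n" for x
  proof -
    have "ennreal (r x) \<le> of_nat n" unfolding rf by (auto simp: indicator_def)
    then show ?thesis by (simp add: ennreal_of_nat_eq_real_of_nat)
  qed
  have [measurable]: "r \<in> borel_measurable borel" unfolding r_def[abs_def] by measurable
  have bdd: "bdd_above (range r)" using rn by (auto intro!: bdd_aboveI)
  define A where "A = (SUP x. r x)"
  have rA: "r x \<le> A" for x unfolding A_def by (rule cSUP_upper) (auto intro: bdd)
  have A: "0 < A"
  proof (rule ccontr)
    assume "\<not> 0 < A"
    then have "r x = 0" for x using rA[of x] r0[of x] by simp
    then have "(\<integral>\<^sup>+x. ?f n x \<partial>lborel) = 0" by (simp add: rf[symmetric])
    with n show False by simp
  qed
  show ?thesis
  proof (rule that[of A "\<lambda>x. r x / A" "real n"])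
    show "\<exists>x. u < r x / A" if "u < 1" for u
    proof -
      have "u * A < (SUP x. r x)" using that A by (simp add: A_def[symmetric])
      then obtain x where "u * A < r x" using less_cSUP_iff[OF _ bdd] by auto
      then show ?thesis using A by (intro exI[of _ x]) (simp add: field_simps)
    qed
    show "\<bar>x\<bar> \<le> real n" if "r x / A \<noteq> 0" for x
      using that by (cases "x \<in> {- real n..real n}") (auto simp: r_def)
    show "ennreal (A * (r x / A)) \<le> f x" for x
      using A by (simp add: rf) (auto simp: indicator_def)
    have "(\<integral>\<^sup>+x. ?f n x \<partial>lborel) = (\<integral>\<^sup>+x. ennreal A * ennreal (r x / A) \<partial>lborel)"
      using A by (intro nn_integral_cong) (simp add: rf[symmetric] ennreal_mult[symmetric] r0)
    also have "\<dots> = ennreal A * (\<integral>\<^sup>+x. ennreal (r x / A) \<partial>lborel)" by (rule nn_integral_cmult) measurable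
    finally show "ennreal p \<le> ennreal A * (\<integral>\<^sup>+x. ennreal (r x / A) \<partial>lborel)" using n by simp
  qed (use A r0 rA in auto)
qed

text \<open>The hypothesis and the conclusion quantify over reals strictly below the extended real values. This
  replaces powers of extended reals and gives both the same form, so that the inequality for sections
  can be fed into the inequality for partial integrals.\<close>

lemma prekopa_leindler_real:
  fixes f g h :: "real \<Rightarrow> ennreal"
  assumes [measurable]: "f \<in> borel_measurable borel" "g \<in> borel_measurable borel" "h \<in> borel_measurable borel"
    and s: "0 < s" "s < 1"
    and le: "\<And>x y p q. 0 < p \<Longrightarrow> 0 < q \<Longrightarrow> ennreal p < f x \<Longrightarrow> ennreal q < g y
      \<Longrightarrow> ennreal (p powr (1 - s) * q powr s) \<le> h ((1 - s) * x + s * y)"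
    and p: "0 < p" "ennreal p < (\<integral>\<^sup>+x. f x \<partial>lborel)" and q: "0 < q" "ennreal q < (\<integral>\<^sup>+x. g x \<partial>lborel)"
  shows "ennreal (p powr (1 - s) * q powr s) \<le> (\<integral>\<^sup>+x. h x \<partial>lborel)"
proof -
  obtain A \<phi> R where A: "0 < A" and [measurable]: "\<phi> \<in> borel_measurable borel"
    and \<phi>: "\<And>x. 0 \<le> \<phi> x" "\<And>x. \<phi> x \<le> (1::real)" "\<And>x. \<phi> x \<noteq> 0 \<Longrightarrow> \<bar>x\<bar> \<le> R" "\<And>u. u < 1 \<Longrightarrow> \<exists>x. u < \<phi> x"
    and \<phi>f: "\<And>x. ennreal (A * \<phi> x) \<le> f x" and pA: "ennreal p \<le> ennreal A * (\<integral>\<^sup>+x. \<phi> x \<partial>lborel)"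
    by (rule normalized_minorant[OF assms(1) p]) blast
  obtain B \<gamma> R' where B: "0 < B" and [measurable]: "\<gamma> \<in> borel_measurable borel"
    and \<gamma>: "\<And>x. 0 \<le> \<gamma> x" "\<And>x. \<gamma> x \<le> (1::real)" "\<And>x. \<gamma> x \<noteq> 0 \<Longrightarrow> \<bar>x\<bar> \<le> R'" "\<And>u. u < 1 \<Longrightarrow> \<exists>x. u < \<gamma> x"
    and \<gamma>g: "\<And>x. ennreal (B * \<gamma> x) \<le> g x" and qB: "ennreal q \<le> ennreal B * (\<integral>\<^sup>+x. \<gamma> x \<partial>lborel)"
    by (rule normalized_minorant[OF assms(2) q]) blast
  \<comment> \<open>\<open>C\<close> is the scale of \<open>h\<close> that matches the suprema \<open>A\<close> and \<open>B\<close>.\<close>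
  define C where "C = A powr (1 - s) * B powr s"
  have C: "0 < C" using A B by (simp add: C_def)
  define \<psi> where "\<psi> x = enn2real (min 1 (h x / ennreal C))" for x
  have [measurable]: "\<psi> \<in> borel_measurable borel" unfolding \<psi>_def[abs_def] by measurable
  have \<psi>e: "ennreal (\<psi> x) = min 1 (h x / ennreal C)" for x
    unfolding \<psi>_def by (intro ennreal_enn2real) (auto simp: min_less_iff_disj)
  have \<psi>0: "0 \<le> \<psi> x" for x by (simp add: \<psi>_def)
  have \<psi>1: "\<psi> x \<le> 1" for x
    using \<psi>e[of x] by (metis ennreal_le_1 min.cobounded1)
  have C\<psi>: "ennreal C * ennreal (\<psi> x) \<le> h x" for x
  proof -
    have "ennreal C * ennreal (\<psi> x) \<le> ennreal C * (h x / ennreal C)"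
      unfolding \<psi>e by (intro mult_left_mono) auto
    also have "\<dots> = h x"
      using C by (simp add: ennreal_times_divide ennreal_mult_divide_eq mult.commute[of "ennreal C"])
    finally show ?thesis .
  qed
  have main: "ennreal (1 - s) * (\<integral>\<^sup>+x. \<phi> x \<partial>lborel) + ennreal s * (\<integral>\<^sup>+x. \<gamma> x \<partial>lborel) \<le> (\<integral>\<^sup>+x. \<psi> x \<partial>lborel)"
  proof (rule prekopa_leindler_normalized[where R="max R R'"])
    fix x y u assume u: "0 < u" "u < \<phi> x" "u < \<gamma> y"
    have "ennreal (A * u) < ennreal (A * \<phi> x)" using u A by (intro ennreal_lessI) auto
    then have 1: "ennreal (A * u) < f x" using \<phi>f[of x] by (rule less_le_trans)
    have "ennreal (B * u) < ennreal (B * \<gamma> y)" using u B by (intro ennreal_lessI) auto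
    then have 2: "ennreal (B * u) < g y" using \<gamma>g[of y] by (rule less_le_trans)
    have "(A * u) powr (1 - s) * (B * u) powr s = C * (u powr (1 - s) * u powr s)"
      using A B u by (simp add: powr_mult C_def algebra_simps)
    also have "u powr (1 - s) * u powr s = u" using u by (simp add: powr_add[symmetric])
    finally have "ennreal (C * u) \<le> h ((1 - s) * x + s * y)"
      using le[of "A * u" "B * u" x y] 1 2 A B u by simp
    then have "ennreal (C * u) / ennreal C \<le> h ((1 - s) * x + s * y) / ennreal C"
      by (rule divide_right_mono_ennreal)
    then have "ennreal u \<le> h ((1 - s) * x + s * y) / ennreal C"
      using C u by (simp add: divide_ennreal)
    moreover have "ennreal u \<le> 1" using u \<phi>(2)[of x] by simp
    ultimately have "ennreal u \<le> ennreal (\<psi> ((1 - s) * x + s * y))" by (simp add: \<psi>e)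
    then show "u \<le> \<psi> ((1 - s) * x + s * y)" using \<psi>0 by simp
  next
    show "\<bar>x\<bar> \<le> max R R'" if "\<phi> x \<noteq> 0" for x using \<phi>(3)[OF that] by simp
    show "\<bar>x\<bar> \<le> max R R'" if "\<gamma> x \<noteq> 0" for x using \<gamma>(3)[OF that] by simp
  qed (use \<phi> \<gamma> \<psi>0 \<psi>1 s in auto)
  have "p powr (1 - s) * q powr s = C * ((p / A) powr (1 - s) * (q / B) powr s)"
    using A B p q by (simp add: C_def powr_divide)
  also have "\<dots> \<le> C * ((1 - s) * (p / A) + s * (q / B))"
    using C A B p q s by (intro mult_left_mono Youngs_inequality_0) auto
  finally have "ennreal (p powr (1 - s) * q powr s) \<le> ennreal (C * ((1 - s) * (p / A) + s * (q / B)))"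
    by (rule ennreal_leI)
  also have "\<dots> = ennreal C * (ennreal (1 - s) * ennreal (p / A) + ennreal s * ennreal (q / B))"
    using C A B p q s
    by (simp add: ennreal_mult[symmetric] ennreal_plus[symmetric] del: ennreal_plus)
  also have "\<dots> \<le> ennreal C * (ennreal (1 - s) * (\<integral>\<^sup>+x. \<phi> x \<partial>lborel) + ennreal s * (\<integral>\<^sup>+x. \<gamma> x \<partial>lborel))"
  proof (intro mult_left_mono add_mono)
    have aux: "ennreal (p / A) \<le> I" if "ennreal p \<le> ennreal A * I" "0 < A" "0 < p" for p A I
    proof -
      have "ennreal p / ennreal A \<le> (ennreal A * I) / ennreal A"
        using that(1) by (rule divide_right_mono_ennreal)
      then show ?thesis using that(2,3)
        by (simp add: divide_ennreal ennreal_mult_divide_eq mult.commute[of "ennreal A"])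
    qed
    show "ennreal (p / A) \<le> (\<integral>\<^sup>+x. \<phi> x \<partial>lborel)" using pA A p(1) by (rule aux)
    show "ennreal (q / B) \<le> (\<integral>\<^sup>+x. \<gamma> x \<partial>lborel)" using qB B q(1) by (rule aux)
  qed auto
  also have "\<dots> \<le> ennreal C * (\<integral>\<^sup>+x. \<psi> x \<partial>lborel)" using main by (intro mult_left_mono) auto
  also have "\<dots> = (\<integral>\<^sup>+x. ennreal C * \<psi> x \<partial>lborel)" by (subst nn_integral_cmult) auto
  also have "\<dots> \<le> (\<integral>\<^sup>+x. h x \<partial>lborel)" by (intro nn_integral_mono C\<psi>)
  finally show ?thesis .
qed

text \<open>Induction on the set of coordinates: the one-dimensional inequality on the sections in direction
  \<open>i\<close> is the hypothesis of the inequality for the partial integrals over \<open>i\<close>.\<close>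

lemma prekopa_leindler_PiM:
  fixes f g h :: "('i \<Rightarrow> real) \<Rightarrow> ennreal"
  assumes "finite I" and s: "0 < s" "s < 1"
  shows "f \<in> borel_measurable (PiM I (\<lambda>_. lborel)) \<Longrightarrow> g \<in> borel_measurable (PiM I (\<lambda>_. lborel)) \<Longrightarrow>
    h \<in> borel_measurable (PiM I (\<lambda>_. lborel)) \<Longrightarrow>
    (\<And>x y p q. 0 < p \<Longrightarrow> 0 < q \<Longrightarrow> ennreal p < f x \<Longrightarrow> ennreal q < g y \<Longrightarrow>
      x \<in> extensional I \<Longrightarrow> y \<in> extensional I \<Longrightarrow>
      ennreal (p powr (1 - s) * q powr s) \<le> h (\<lambda>i\<in>I. (1 - s) * x i + s * y i)) \<Longrightarrow>
    0 < p \<Longrightarrow> ennreal p < (\<integral>\<^sup>+x. f x \<partial>PiM I (\<lambda>_. lborel)) \<Longrightarrow>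
    0 < q \<Longrightarrow> ennreal q < (\<integral>\<^sup>+x. g x \<partial>PiM I (\<lambda>_. lborel)) \<Longrightarrow>
    ennreal (p powr (1 - s) * q powr s) \<le> (\<integral>\<^sup>+x. h x \<partial>PiM I (\<lambda>_. lborel))"
  using assms(1)
proof (induction I arbitrary: f g h p q)
  case empty
  interpret product_sigma_finite "\<lambda>_::'i. lborel :: real measure" by standard
  have *: "(\<integral>\<^sup>+x. k x \<partial>PiM {} (\<lambda>_::'i. lborel :: real measure)) = k (\<lambda>_. undefined)" for k :: "('i \<Rightarrow> real) \<Rightarrow> ennreal"
    by (simp add: PiM_empty nn_integral_count_space_finite)
  show ?case
    using empty.prems(4)[of p q "\<lambda>_. undefined" "\<lambda>_. undefined"] empty.prems(5-) by (simp add: * restrict_def)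
next
  case (insert i I)
  interpret product_sigma_finite "\<lambda>_::'i. lborel :: real measure" by standard
  let ?M = "PiM I (\<lambda>_::'i. lborel :: real measure)"
  note [measurable] = insert.prems(1-3)
  have upd: "(\<lambda>(x, y). x(i := y)) \<in> ?M \<Otimes>\<^sub>M lborel \<rightarrow>\<^sub>M PiM (insert i I) (\<lambda>_. lborel)"
    by (rule measurable_add_dim)
  have m2: "(\<lambda>(x, y). k (x(i := y))) \<in> borel_measurable (?M \<Otimes>\<^sub>M lborel)"
    if "k \<in> borel_measurable (PiM (insert i I) (\<lambda>_. lborel))" for k :: "('i \<Rightarrow> real) \<Rightarrow> ennreal"
    using measurable_compose[OF upd that] by (simp add: case_prod_beta')
  have m3: "(\<lambda>x. \<integral>\<^sup>+y. k (x(i := y)) \<partial>lborel) \<in> borel_measurable ?M"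
    if "k \<in> borel_measurable (PiM (insert i I) (\<lambda>_. lborel))" for k :: "('i \<Rightarrow> real) \<Rightarrow> ennreal"
    using lborel.borel_measurable_nn_integral[OF m2[OF that]] .
  have m1: "(\<lambda>y. k (x(i := y))) \<in> borel_measurable borel"
    if "k \<in> borel_measurable (PiM (insert i I) (\<lambda>_. lborel))" "x \<in> extensional I" for k :: "('i \<Rightarrow> real) \<Rightarrow> ennreal" and x
  proof -
    have "(\<lambda>y. (x, y)) \<in> lborel \<rightarrow>\<^sub>M ?M \<Otimes>\<^sub>M lborel"
      using that(2) by (intro measurable_Pair1') (simp add: space_PiM PiE_def)
    from measurable_compose[OF this m2[OF that(1)]] show ?thesis by simp
  qed
  note ins = product_nn_integral_insert[OF insert.hyps(1,2)]
  show ?case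
    unfolding ins[OF insert.prems(3)]
  proof (rule insert.IH[OF m3[OF insert.prems(1)] m3[OF insert.prems(2)] m3[OF insert.prems(3)]])
    show "0 < p" "0 < q" by fact+
    show "ennreal p < (\<integral>\<^sup>+x. \<integral>\<^sup>+y. f (x(i := y)) \<partial>lborel \<partial>?M)"
      using insert.prems(6) unfolding ins[OF insert.prems(1)] .
    show "ennreal q < (\<integral>\<^sup>+x. \<integral>\<^sup>+y. g (x(i := y)) \<partial>lborel \<partial>?M)"
      using insert.prems(8) unfolding ins[OF insert.prems(2)] .
    fix x y :: "'i \<Rightarrow> real" and p q :: real
    assume xy: "x \<in> extensional I" "y \<in> extensional I"
      and pq: "0 < p" "0 < q" "ennreal p < (\<integral>\<^sup>+t. f (x(i := t)) \<partial>lborel)" "ennreal q < (\<integral>\<^sup>+t. g (y(i := t)) \<partial>lborel)"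
    let ?z = "\<lambda>k\<in>I. (1 - s) * x k + s * y k"
    have z: "?z \<in> extensional I" by simp
    show "ennreal (p powr (1 - s) * q powr s) \<le> (\<integral>\<^sup>+t. h (?z(i := t)) \<partial>lborel)"
    proof (rule prekopa_leindler_real[OF m1[OF insert.prems(1) xy(1)] m1[OF insert.prems(2) xy(2)]
          m1[OF insert.prems(3) z] s _ pq(1,3,2,4)])
      fix a b p q :: real
      assume *: "0 < p" "0 < q" "ennreal p < f (x(i := a))" "ennreal q < g (y(i := b))"
      have ext: "x(i := a) \<in> extensional (insert i I)" "y(i := b) \<in> extensional (insert i I)"
        using xy by (auto simp: extensional_def)
      have "ennreal (p powr (1 - s) * q powr s)
          \<le> h (\<lambda>k\<in>insert i I. (1 - s) * (x(i := a)) k + s * (y(i := b)) k)"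
        by (rule insert.prems(4)[OF * ext])
      also have "(\<lambda>k\<in>insert i I. (1 - s) * (x(i := a)) k + s * (y(i := b)) k)
          = ?z(i := (1 - s) * a + s * b)"
        using insert.hyps(2) by (auto simp: restrict_def fun_eq_iff)
      finally show "ennreal (p powr (1 - s) * q powr s) \<le> h (?z(i := (1 - s) * a + s * b))" .
    qed
  qed
qed

lemma prekopa_leindler:
  fixes f g h :: "'a::euclidean_space \<Rightarrow> ennreal"
  assumes [measurable]: "f \<in> borel_measurable borel" "g \<in> borel_measurable borel" "h \<in> borel_measurable borel"
    and s: "0 < s" "s < 1"
    and le: "\<And>x y p q. 0 < p \<Longrightarrow> 0 < q \<Longrightarrow> ennreal p < f x \<Longrightarrow> ennreal q < g y
      \<Longrightarrow> ennreal (p powr (1 - s) * q powr s) \<le> h ((1 - s) *\<^sub>R x + s *\<^sub>R y)"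
    and p: "0 < p" "ennreal p < (\<integral>\<^sup>+x. f x \<partial>lborel)" and q: "0 < q" "ennreal q < (\<integral>\<^sup>+x. g x \<partial>lborel)"
  shows "ennreal (p powr (1 - s) * q powr s) \<le> (\<integral>\<^sup>+x. h x \<partial>lborel)"
proof -
  let ?T = "\<lambda>x. \<Sum>b\<in>(Basis :: 'a set). x b *\<^sub>R b" and ?P = "PiM (Basis :: 'a set) (\<lambda>_. lborel :: real measure)"
  have T[measurable]: "?T \<in> ?P \<rightarrow>\<^sub>M borel" by measurable
  have int: "(\<integral>\<^sup>+x. k x \<partial>lborel) = (\<integral>\<^sup>+x. k (?T x) \<partial>?P)" if [measurable]: "k \<in> borel_measurable borel" for k :: "'a \<Rightarrow> ennreal"
    by (subst lborel_eq, subst nn_integral_distr) auto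
  have m: "(\<lambda>x. k (?T x)) \<in> borel_measurable ?P" if "k \<in> borel_measurable borel" for k :: "'a \<Rightarrow> ennreal"
    using measurable_compose[OF T that] .
  show ?thesis
    unfolding int[OF assms(3)]
  proof (rule prekopa_leindler_PiM[OF finite_Basis s m[OF assms(1)] m[OF assms(2)] m[OF assms(3)] _ p(1) _ q(1)])
    show "ennreal p < (\<integral>\<^sup>+x. f (?T x) \<partial>?P)" "ennreal q < (\<integral>\<^sup>+x. g (?T x) \<partial>?P)"
      using p q by (simp_all add: int)
    fix x y :: "'a \<Rightarrow> real" and p q :: real
    assume *: "0 < p" "0 < q" "ennreal p < f (?T x)" "ennreal q < g (?T y)"
    have "(\<Sum>b\<in>(Basis :: 'a set). (\<lambda>b\<in>Basis. (1 - s) * x b + s * y b) b *\<^sub>R b)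
        = (\<Sum>b\<in>(Basis :: 'a set). ((1 - s) * x b + s * y b) *\<^sub>R b)"
      by (intro sum.cong) auto
    also have "\<dots> = (1 - s) *\<^sub>R ?T x + s *\<^sub>R ?T y"
      by (simp add: scaleR_add_left sum.distrib scaleR_sum_right)
    finally show "ennreal (p powr (1 - s) * q powr s) \<le> h (?T (\<lambda>b\<in>Basis. (1 - s) * x b + s * y b))"
      using le[OF *] by simp
  qed
qed

section \<open>Entropy of exponential tilts\<close>

text \<open>The logarithmic density of an exponential tilt is affine with gradient \<open>\<theta>\<close>.\<close>

lemma tilt_entropy_log_sobolev:
  fixes F :: "real^'n \<Rightarrow> real"
  assumes [measurable]: "F \<in> borel_measurable borel"
    and prob: "prob_space (gibbs F)" "prob_space (gibbs F')" and LS: "log_sobolev (gibbs F) r"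
    and F': "\<And>y. F' y = F y - \<theta> \<bullet> y + k"
  shows "rel_entropy (gibbs F') (gibbs F) \<le> ennreal (r / 2) * ennreal ((norm \<theta>)\<^sup>2)"
proof -
  let ?f = "\<lambda>y. exp (\<theta> \<bullet> y - k)"
  have eq: "gibbs F' = density (gibbs F) (\<lambda>y. ennreal (?f y))"
    by (subst density_gibbs) (auto intro!: arg_cong[where f=gibbs] simp: F')
  have "rel_entropy (gibbs F') (gibbs F) \<le> ennreal (r / 2) * fisher_information (gibbs F') (gibbs F)"
  proof -
    have "absolutely_continuous (gibbs F) (gibbs F')"
      unfolding eq by (rule absolutely_continuousI_density) simp
    then show ?thesis using LS prob unfolding log_sobolev_def by auto
  qed
  also have "fisher_information (gibbs F') (gibbs F) \<le> ennreal ((norm \<theta>)\<^sup>2)"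
  proof -
    have der: "((\<lambda>z. ln (?f z)) has_derivative (\<lambda>h. \<theta> \<bullet> h)) (at y)" for y
      by (auto intro!: derivative_eq_intros)
    have "gradient (\<lambda>z. ln (?f z)) y = \<theta>" for y
      unfolding gradient_def frechet_derivative_at[OF der, symmetric] by (simp add: inner_axis vec_eq_iff)
    then have g: "gradient (\<lambda>z. \<theta> \<bullet> z - k) y = \<theta>" for y by simp
    have "?f differentiable (at y)" for y
      by (rule differentiableI) (auto intro!: derivative_eq_intros)
    then have "fisher_information (gibbs F') (gibbs F)
        \<le> (\<integral>\<^sup>+x. ennreal ((norm (gradient (\<lambda>z. ln (?f z)) x))\<^sup>2) \<partial>gibbs F')"
      unfolding fisher_information_def using eq by (intro INF_lower) auto
    also have "\<dots> = ennreal ((norm \<theta>)\<^sup>2)"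
      using prob_space.emeasure_space_1[OF prob(2)] by (simp add: g)
    finally show ?thesis .
  qed
  finally show ?thesis by (simp add: mult_left_mono)
qed

text \<open>The function \<open>c u\<^sup>2 - u (\<theta> \<bullet> x) + F x\<close> is jointly convex in \<open>(u, x)\<close>, since \<open>F\<close> is \<open>a\<close>-uniformly convex and
  \<open>c = |\<theta>|\<^sup>2 / (2 a)\<close>. Hence \<open>\<integral> exp (u (\<theta> \<bullet> x) - F x - c u\<^sup>2) dx\<close> is log-concave in \<open>u\<close> (Prekopa). This is used
  at the three points \<open>u = 0\<close>, \<open>1\<close> and \<open>1 + t\<close>, where \<open>1 = (1 - s) 0 + s (1 + t)\<close> with
  \<open>s = 1 / (1 + t)\<close>. The values at 0 and 1 are known, and the one at \<open>1 + t\<close> is bounded.\<close>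

lemma tilted_integral_le:
  fixes F :: "'a::euclidean_space \<Rightarrow> real"
  assumes [measurable]: "F \<in> borel_measurable borel" and a: "0 < a" and t: "0 < t"
    and convex: "\<And>x y s. 0 \<le> s \<Longrightarrow> s \<le> 1 \<Longrightarrow>
      F ((1 - s) *\<^sub>R x + s *\<^sub>R y) \<le> (1 - s) * F x + s * F y - a / 2 * (s * (1 - s)) * (norm (y - x))\<^sup>2"
    and Z0: "(\<integral>\<^sup>+x. ennreal (exp (- F x)) \<partial>lborel) = 1"
    and Z1: "(\<integral>\<^sup>+x. ennreal (exp (\<theta> \<bullet> x - F x)) \<partial>lborel) = ennreal (exp k)"
    and c: "c = (norm \<theta>)\<^sup>2 / (2 * a)"
  shows "(\<integral>\<^sup>+x. ennreal (exp ((1 + t) * (\<theta> \<bullet> x) - F x)) \<partial>lborel) \<le> ennreal (exp ((1 + t) * k + c * t * (1 + t)))"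
proof -
  define s where "s = 1 / (1 + t)"
  have s: "0 < s" "s < 1" and st: "s * (1 + t) = 1" "1 - s = t * s" using t by (auto simp: s_def field_simps)
  let ?g = "\<lambda>x. exp ((1 + t) * (\<theta> \<bullet> x) - F x - c * (1 + t)\<^sup>2)"
  let ?h = "\<lambda>x. exp (\<theta> \<bullet> x - F x - c)"
  have hint: "(\<integral>\<^sup>+x. ennreal (?h x) \<partial>lborel) = ennreal (exp (k - c))"
  proof -
    have "(\<integral>\<^sup>+x. ennreal (?h x) \<partial>lborel) = (\<integral>\<^sup>+x. ennreal (exp (- c)) * ennreal (exp (\<theta> \<bullet> x - F x)) \<partial>lborel)"
      by (intro nn_integral_cong) (simp add: ennreal_mult[symmetric] exp_add[symmetric] algebra_simps)
    also have "\<dots> = ennreal (exp (k - c))"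
      by (subst nn_integral_cmult) (auto simp: Z1 ennreal_mult[symmetric] exp_add[symmetric] algebra_simps)
    finally show ?thesis .
  qed
  have PL: "ennreal (p powr (1 - s) * q powr s) \<le> ennreal (exp (k - c))"
    if pq: "0 < p" "p < 1" "0 < q" "ennreal q < (\<integral>\<^sup>+x. ennreal (?g x) \<partial>lborel)" for p q
    unfolding hint[symmetric]
  proof (rule prekopa_leindler[where f="\<lambda>x. ennreal (exp (- F x))" and g="\<lambda>x. ennreal (?g x)"])
    show "ennreal p < (\<integral>\<^sup>+x. ennreal (exp (- F x)) \<partial>lborel)" using pq by (simp add: Z0)
    fix x y and p q :: real
    assume pq: "0 < p" "0 < q" "ennreal p < ennreal (exp (- F x))" "ennreal q < ennreal (?g y)"
    let ?z = "(1 - s) *\<^sub>R x + s *\<^sub>R y" and ?d = "norm (y - x)"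
    have "p powr (1 - s) * q powr s \<le> exp (- F x) powr (1 - s) * ?g y powr s"
      using pq s by (intro mult_mono powr_mono2) (auto simp: ennreal_less_iff)
    also have "\<dots> = exp ((1 - s) * (- F x) + s * ((1 + t) * (\<theta> \<bullet> y) - F y - c * (1 + t)\<^sup>2))"
      by (simp add: powr_def exp_add[symmetric])
    also have "\<dots> \<le> ?h ?z"
    proof (subst exp_le_cancel_iff)
      have "?d * norm \<theta> \<le> (norm \<theta>)\<^sup>2 / (2 * a * s) + a * s * ?d\<^sup>2 / 2"
      proof -
        have "0 \<le> (norm \<theta> - a * s * ?d)\<^sup>2" by simp
        then have "2 * (a * s) * (?d * norm \<theta>) \<le> (norm \<theta>)\<^sup>2 + (a * s)\<^sup>2 * ?d\<^sup>2"
          by (simp add: power2_eq_square algebra_simps)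
        then show ?thesis using a s by (simp add: field_simps power2_eq_square)
      qed
      moreover have "\<theta> \<bullet> (y - x) \<le> ?d * norm \<theta>" using norm_cauchy_schwarz[of \<theta> "y - x"] by (simp add: mult.commute)
      moreover have "(norm \<theta>)\<^sup>2 / (2 * a * s) = c * (1 + t)" using st(1) s a by (simp add: c s_def)
      ultimately have young: "\<theta> \<bullet> (y - x) - a * s * ?d\<^sup>2 / 2 \<le> c * (1 + t)" by linarith
      have "(1 - s) * (\<theta> \<bullet> (y - x) - a * s * ?d\<^sup>2 / 2) \<le> (1 - s) * (c * (1 + t))"
        using young s by (intro mult_left_mono) auto
      also have "\<dots> = c * t * (s * (1 + t))" by (simp add: st(2) algebra_simps)
      also have "\<dots> = c * t" unfolding st(1) by simp
      finally have 1: "(1 - s) * (\<theta> \<bullet> (y - x)) - a / 2 * (s * (1 - s)) * ?d\<^sup>2 \<le> c * t"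
        by (simp add: algebra_simps)
      have 2: "F ?z \<le> (1 - s) * F x + s * F y - a / 2 * (s * (1 - s)) * ?d\<^sup>2"
        using s by (intro convex) auto
      have 3: "\<theta> \<bullet> ?z = \<theta> \<bullet> y - (1 - s) * (\<theta> \<bullet> (y - x))"
        by (simp add: inner_add_right inner_diff_right algebra_simps)
      have 4: "s * ((1 + t) * (\<theta> \<bullet> y) - F y - c * (1 + t)\<^sup>2) = \<theta> \<bullet> y - s * F y - c * (1 + t)"
      proof -
        have "s * ((1 + t) * X - F y - c * (1 + t)\<^sup>2) = (s * (1 + t)) * X - s * F y - c * ((s * (1 + t)) * (1 + t))" for X
          by (simp add: power2_eq_square algebra_simps)
        then show ?thesis unfolding st by simp
      qed
      have 5: "c * (1 + t) = c + c * t" by (simp add: algebra_simps)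
      have 6: "(1 - s) * (- F x) = - ((1 - s) * F x)" by simp
      show "(1 - s) * (- F x) + s * ((1 + t) * (\<theta> \<bullet> y) - F y - c * (1 + t)\<^sup>2) \<le> \<theta> \<bullet> ?z - F ?z - c"
        unfolding 3 4 5 6 using 1 2 by linarith
    qed
    finally show "ennreal (p powr (1 - s) * q powr s) \<le> ennreal (?h ?z)" by (rule ennreal_leI)
  qed (use pq s in auto)
  define E where "E = exp ((1 + t) * (k - c))"
  have gE: "(\<integral>\<^sup>+x. ennreal (?g x) \<partial>lborel) \<le> ennreal E"
  proof (rule ccontr)
    assume "\<not> ?thesis"
    then have "ennreal E < (\<integral>\<^sup>+x. ennreal (?g x) \<partial>lborel)" by simp
    then obtain q' where q': "ennreal E < q'" "q' < (\<integral>\<^sup>+x. ennreal (?g x) \<partial>lborel)" using dense by blast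
    then have "q' < \<top>" by (auto simp: less_top[symmetric])
    then obtain q where q: "q' = ennreal q" "0 \<le> q" by (cases q') auto
    have E: "0 < E" by (simp add: E_def)
    have Eq: "E < q" using q' q E by (simp add: ennreal_less_iff)
    \<comment> \<open>As \<open>E < q\<close>, some \<open>p < 1\<close> still has \<open>p\<^bsup>1 - s\<^esup> q\<^sup>s > E\<^sup>s\<close>; this \<open>p\<close> gives the geometric mean of \<open>E\<^sup>s\<close> and \<open>q\<^sup>s\<close>.\<close>
    define p where "p = (E / q) powr (s / (2 * (1 - s)))"
    have "0 < p" using E Eq by (simp add: p_def)
    moreover have "p < 1"
    proof -
      have "p < 1 powr (s / (2 * (1 - s)))"
        unfolding p_def using E Eq s by (intro powr_less_mono2) auto
      then show ?thesis by simp
    qed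
    ultimately have "ennreal (p powr (1 - s) * q powr s) \<le> ennreal (exp (k - c))"
      using q' q Eq E by (intro PL) auto
    then have "p powr (1 - s) * q powr s \<le> exp (k - c)" by simp
    also have "exp (k - c) = E powr s"
      using st(1) by (simp add: E_def powr_def mult.assoc[symmetric])
    finally have le: "p powr (1 - s) * q powr s \<le> E powr s" .
    have e1: "s / (2 * (1 - s)) * (1 - s) = s / 2" using s by (simp add: field_simps)
    have "p powr (1 - s) * q powr s = (E / q) powr (s / 2) * q powr s"
      unfolding p_def powr_powr e1 ..
    also have "\<dots> = E powr (s / 2) * q powr (s / 2)"
      using E Eq by (simp add: powr_divide powr_half_sqrt flip: powr_add)
        (simp add: field_simps flip: powr_add)
    also have "\<dots> > E powr (s / 2) * E powr (s / 2)"
      using E Eq s by (intro mult_strict_left_mono powr_less_mono2) auto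
    also have "E powr (s / 2) * E powr (s / 2) = E powr s" by (simp flip: powr_add)
    finally show False using le by simp
  qed
  have "(\<integral>\<^sup>+x. ennreal (exp ((1 + t) * (\<theta> \<bullet> x) - F x)) \<partial>lborel)
      = (\<integral>\<^sup>+x. ennreal (exp (c * (1 + t)\<^sup>2)) * ennreal (?g x) \<partial>lborel)"
    by (intro nn_integral_cong) (simp add: ennreal_mult[symmetric] exp_add[symmetric])
  also have "\<dots> = ennreal (exp (c * (1 + t)\<^sup>2)) * (\<integral>\<^sup>+x. ennreal (?g x) \<partial>lborel)"
    by (rule nn_integral_cmult) measurable
  also have "\<dots> \<le> ennreal (exp (c * (1 + t)\<^sup>2)) * ennreal E" by (intro mult_left_mono gE) auto
  also have "\<dots> = ennreal (exp ((1 + t) * k + c * t * (1 + t)))"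
    by (simp add: E_def ennreal_mult[symmetric] exp_add[symmetric] power2_eq_square algebra_simps)
  finally show ?thesis .
qed

text \<open>The entropy of the tilt is the mean of \<open>r = \<theta> \<bullet> y - k\<close> under the tilted measure. As
  \<open>r \<le> (e\<^bsup>t r\<^esup> - 1) / t\<close>, it is at most \<open>(e\<^bsup>c t (1 + t)\<^esup> - 1) / t\<close> by \<open>tilted_integral_le\<close>, and this tends
  to \<open>c\<close> as \<open>t\<close> decreases to 0. A difference quotient in place of the derivative of the log-Laplace
  transform avoids differentiating under the integral.\<close>

lemma tilt_entropy_strongly_convex:
  fixes F :: "'a::euclidean_space \<Rightarrow> real"
  assumes F[measurable]: "F \<in> borel_measurable borel" and a: "0 < a"
    and convex: "\<And>x y s. 0 \<le> s \<Longrightarrow> s \<le> 1 \<Longrightarrow>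
      F ((1 - s) *\<^sub>R x + s *\<^sub>R y) \<le> (1 - s) * F x + s * F y - a / 2 * (s * (1 - s)) * (norm (y - x))\<^sup>2"
    and prob: "prob_space (gibbs F)" "prob_space (gibbs F')"
    and F': "\<And>y. F' y = F y - \<theta> \<bullet> y + k"
  shows "rel_entropy (gibbs F') (gibbs F) \<le> ennreal ((norm \<theta>)\<^sup>2 / (2 * a))"
proof -
  define c where "c = (norm \<theta>)\<^sup>2 / (2 * a)"
  let ?r = "\<lambda>y. \<theta> \<bullet> y - k"
  have F'm[measurable]: "F' \<in> borel_measurable borel" unfolding F'[abs_def] by measurable
  have eq: "gibbs F' = density (gibbs F) (\<lambda>y. ennreal (exp (?r y)))"
    by (subst density_gibbs) (auto intro!: arg_cong[where f=gibbs] simp: F')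
  have Z0: "(\<integral>\<^sup>+x. ennreal (exp (- F x)) \<partial>lborel) = 1"
    using prob(1) unfolding gibbs_def by (rule nn_integral_density_prob_eq_1) measurable
  have Z1: "(\<integral>\<^sup>+x. ennreal (exp (\<theta> \<bullet> x - F x)) \<partial>lborel) = ennreal (exp k)"
  proof -
    have "(\<integral>\<^sup>+x. ennreal (exp (- F' x)) \<partial>lborel) = 1"
      using prob(2) unfolding gibbs_def by (rule nn_integral_density_prob_eq_1) measurable
    moreover have "(\<integral>\<^sup>+x. ennreal (exp (\<theta> \<bullet> x - F x)) \<partial>lborel)
        = (\<integral>\<^sup>+x. ennreal (exp k) * ennreal (exp (- F' x)) \<partial>lborel)"
      by (intro nn_integral_cong) (simp add: F' ennreal_mult[symmetric] exp_add[symmetric])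
    ultimately show ?thesis by (simp add: nn_integral_cmult)
  qed
  have H: "rel_entropy (gibbs F') (gibbs F) = (\<integral>\<^sup>+y. ennreal (entropy_fun (exp (?r y))) \<partial>gibbs F)"
    unfolding eq using prob by (intro rel_entropy_density) (auto simp: eq[symmetric])
  have int1: "(\<integral>\<^sup>+y. ennreal (exp (?r y)) \<partial>gibbs F) = 1"
    using prob(2) unfolding eq by (rule nn_integral_density_prob_eq_1) simp
  have bound: "rel_entropy (gibbs F') (gibbs F) \<le> ennreal ((exp (c * t * (1 + t)) - 1) / t)" if t: "0 < t" for t
  proof -
    have intt: "(\<integral>\<^sup>+y. ennreal (exp ((1 + t) * ?r y)) \<partial>gibbs F) \<le> ennreal (exp (c * t * (1 + t)))"
    proof -
      have "(\<integral>\<^sup>+y. ennreal (exp ((1 + t) * ?r y)) \<partial>gibbs F)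
          = (\<integral>\<^sup>+y. ennreal (exp (- (1 + t) * k)) * ennreal (exp ((1 + t) * (\<theta> \<bullet> y) - F y)) \<partial>lborel)"
        by (subst gibbs_nn_integral)
          (auto intro!: nn_integral_cong simp: ennreal_mult[symmetric] exp_add[symmetric] algebra_simps)
      also have "\<dots> = ennreal (exp (- (1 + t) * k)) * (\<integral>\<^sup>+y. ennreal (exp ((1 + t) * (\<theta> \<bullet> y) - F y)) \<partial>lborel)"
        by (rule nn_integral_cmult) measurable
      also have "\<dots> \<le> ennreal (exp (- (1 + t) * k)) * ennreal (exp ((1 + t) * k + c * t * (1 + t)))"
        by (intro mult_left_mono tilted_integral_le[OF F a t convex Z0 Z1 c_def]) auto
      also have "\<dots> = ennreal (exp (c * t * (1 + t)))"
        by (simp add: ennreal_mult[symmetric] exp_add[symmetric] algebra_simps)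
      finally show ?thesis .
    qed
    have "(\<integral>\<^sup>+y. ennreal (entropy_fun (exp (?r y))) + ennreal (1 / t + 1) * ennreal (exp (?r y)) \<partial>gibbs F)
        \<le> (\<integral>\<^sup>+y. ennreal (1 / t) * ennreal (exp ((1 + t) * ?r y)) + 1 \<partial>gibbs F)"
    proof (rule nn_integral_mono)
      fix y
      let ?x = "?r y"
      have "t * ?x \<le> exp (t * ?x) - 1" using exp_ge_add_one_self[of "t * ?x"] by linarith
      then have "?x \<le> (exp (t * ?x) - 1) / t" using t by (simp add: field_simps)
      then have "exp ?x * ?x \<le> exp ?x * ((exp (t * ?x) - 1) / t)" by (intro mult_left_mono) auto
      also have "\<dots> = 1 / t * exp ((1 + t) * ?x) - 1 / t * exp ?x"
      proof -
        have "exp ((1 + t) * ?x) = exp ?x * exp (t * ?x)" by (simp add: exp_add[symmetric] algebra_simps)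
        moreover have "a * ((b - 1) / t) = 1 / t * (a * b) - 1 / t * a" for a b
          by (simp add: right_diff_distrib diff_divide_distrib)
        ultimately show ?thesis by simp
      qed
      finally have "entropy_fun (exp ?x) + (1 / t + 1) * exp ?x \<le> 1 / t * exp ((1 + t) * ?x) + 1"
        by (simp add: entropy_fun_def algebra_simps)
      then show "ennreal (entropy_fun (exp ?x)) + ennreal (1 / t + 1) * ennreal (exp ?x)
          \<le> ennreal (1 / t) * ennreal (exp ((1 + t) * ?x)) + 1"
        using t entropy_fun_nonneg[of "exp ?x"]
        by (simp add: ennreal_mult[symmetric] ennreal_plus[symmetric] del: ennreal_plus ennreal_1 add: ennreal_1[symmetric])
    qed
    then have "rel_entropy (gibbs F') (gibbs F) + ennreal (1 / t + 1)
        \<le> ennreal (1 / t) * (\<integral>\<^sup>+y. ennreal (exp ((1 + t) * ?r y)) \<partial>gibbs F) + 1"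
      using prob_space.emeasure_space_1[OF prob(1)]
      by (simp add: nn_integral_add nn_integral_cmult int1 H)
    also have "\<dots> \<le> ennreal (1 / t) * ennreal (exp (c * t * (1 + t))) + 1"
      by (intro add_mono mult_left_mono intt) auto
    also have "\<dots> = ennreal ((exp (c * t * (1 + t)) - 1) / t + (1 / t + 1))"
      using t by (simp add: ennreal_mult[symmetric] ennreal_plus[symmetric] diff_divide_distrib
          del: ennreal_plus ennreal_1 add: ennreal_1[symmetric])
    also have "\<dots> = ennreal ((exp (c * t * (1 + t)) - 1) / t) + ennreal (1 / t + 1)"
    proof (rule ennreal_plus)
      have "0 \<le> c" using a by (simp add: c_def)
      then show "0 \<le> (exp (c * t * (1 + t)) - 1) / t" using t by simp
      show "0 \<le> 1 / t + 1" using t by simp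
    qed
    finally show ?thesis
      using ennreal_add_left_cancel_le[of "ennreal (1 / t + 1)"] by (simp add: add.commute)
  qed
  have "((\<lambda>t. exp (c * t * (1 + t))) has_real_derivative c) (at 0)"
    by (auto intro!: derivative_eq_intros)
  then have "((\<lambda>t. (exp (c * t * (1 + t)) - 1) / t) \<longlongrightarrow> c) (at_right 0)"
    by (auto simp: DERIV_def intro: tendsto_mono[OF at_le])
  then have "((\<lambda>t. ennreal ((exp (c * t * (1 + t)) - 1) / t)) \<longlongrightarrow> ennreal c) (at_right 0)"
    by (rule tendsto_ennrealI)
  then show ?thesis
    unfolding c_def[symmetric]
    by (rule tendsto_lowerbound) (auto simp: eventually_at_right_less intro!: eventually_mono[OF eventually_at_right_less] bound)
qed

section \<open>Curvature of the transition potentials\<close>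

text \<open>Normalisation of the kernel makes \<open>f\<close> the log-Laplace transform \<open>x \<mapsto> ln (\<integral> exp (B x \<bullet> y - g y) dy)\<close>,
  which is convex. Directly: the defect \<open>d\<close> of convexity does not depend on \<open>y\<close>, and convexity of the
  exponential gives \<open>exp d \<le> (1 - s) + s\<close> after integration.\<close>

lemma transition_potential_convex:
  fixes w :: "'a::euclidean_space \<Rightarrow> 'b::euclidean_space \<Rightarrow> real"
  assumes w: "\<And>x y. w x y = f x + g y - B x \<bullet> y" and B: "linear B"
    and m[measurable]: "\<And>x. w x \<in> borel_measurable borel" and prob: "\<And>x. prob_space (gibbs (w x))"
  shows "convex_on UNIV (\<lambda>x. w x y)"
proof (rule convex_onI)
  fix s :: real and x1 x2 :: 'a assume s: "0 < s" "s < 1"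
  let ?x = "(1 - s) *\<^sub>R x1 + s *\<^sub>R x2"
  have int: "(\<integral>\<^sup>+y. ennreal (exp (- w x y)) \<partial>lborel) = 1" for x
    using prob[of x] unfolding gibbs_def by (rule nn_integral_density_prob_eq_1) measurable
  define d where "d = f ?x - ((1 - s) * f x1 + s * f x2)"
  have B': "B ?x \<bullet> y = (1 - s) * (B x1 \<bullet> y) + s * (B x2 \<bullet> y)" for y
    by (simp add: linear_add[OF B] linear_scale[OF B] inner_add_left)
  have wd: "w ?x y = (1 - s) * w x1 y + s * w x2 y + d" for y
    unfolding w d_def B' by (simp add: algebra_simps)
  have "ennreal (exp d) = ennreal (exp d) * (\<integral>\<^sup>+y. ennreal (exp (- w ?x y)) \<partial>lborel)"
    by (simp add: int)
  also have "\<dots> = (\<integral>\<^sup>+y. ennreal (exp d) * ennreal (exp (- w ?x y)) \<partial>lborel)"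
    by (rule nn_integral_cmult[symmetric]) measurable
  also have "\<dots> \<le> (\<integral>\<^sup>+y. ennreal (1 - s) * ennreal (exp (- w x1 y)) + ennreal s * ennreal (exp (- w x2 y)) \<partial>lborel)"
  proof (rule nn_integral_mono)
    fix y
    have "exp d * exp (- w ?x y) = exp ((1 - s) *\<^sub>R (- w x1 y) + s *\<^sub>R (- w x2 y))"
      by (simp add: wd exp_add[symmetric])
    also have "\<dots> \<le> (1 - s) * exp (- w x1 y) + s * exp (- w x2 y)"
      using s by (intro convex_onD[OF exp_convex]) auto
    finally show "ennreal (exp d) * ennreal (exp (- w ?x y))
        \<le> ennreal (1 - s) * ennreal (exp (- w x1 y)) + ennreal s * ennreal (exp (- w x2 y))"
      using s by (simp add: ennreal_mult[symmetric] ennreal_plus[symmetric] del: ennreal_plus)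
  qed
  also have "\<dots> = ennreal (1 - s) + ennreal s"
    by (subst nn_integral_add) (auto simp: nn_integral_cmult int)
  also have "\<dots> = 1" using s by (simp add: ennreal_plus[symmetric] del: ennreal_plus)
  finally have "d \<le> 0" by simp
  then show "w ?x y \<le> (1 - s) * w x1 y + s * w x2 y" by (simp add: wd)
qed simp

section \<open>Sinkhorn iterates as Gibbs measures\<close>

text \<open>Even bridges are built from the first coordinate to the second one, odd bridges the other way round.
  Reading every bridge from its source coordinate makes the arguments below independent of the parity.\<close>

definition source_coord :: "nat \<Rightarrow> 'a \<times> 'a \<Rightarrow> 'a" where
  "source_coord m = (if even m then fst else snd)"

definition orient :: "nat \<Rightarrow> ('a::euclidean_space \<times> 'a) measure \<Rightarrow> ('a \<times> 'a) measure" where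
  "orient m P = (if even m then P else distr P borel prod.swap)"

lemma measurable_source_coord[measurable]: "source_coord m \<in> borel \<rightarrow>\<^sub>M (borel :: 'a::euclidean_space measure)"
  by (simp add: source_coord_def measurable_fst_borel measurable_snd_borel)

lemma source_coord_Suc_Suc[simp]: "source_coord (Suc (Suc m)) = source_coord m"
  by (simp add: source_coord_def)

lemma sets_orient: "sets P = sets borel \<Longrightarrow> sets (orient m P) = sets borel"
  by (simp add: orient_def)

lemma distr_orient:
  fixes P :: "('a::euclidean_space \<times> 'a) measure"
  assumes [measurable_cong]: "sets P = sets borel"
  shows "distr (orient m P) borel (source_coord m) = distr P borel fst"
    "distr (orient m P) borel (source_coord (Suc m)) = distr P borel snd"
proof -
  note [measurable] = measurable_fst_borel measurable_snd_borel
  show "distr (orient m P) borel (source_coord m) = distr P borel fst"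
    "distr (orient m P) borel (source_coord (Suc m)) = distr P borel snd"
    by (auto simp: orient_def source_coord_def distr_distr comp_def)
qed

lemma rel_entropy_orient_le:
  assumes "prob_space P" "prob_space Q" "sets P = sets borel" "sets Q = sets borel"
  shows "rel_entropy (orient m Q) (orient m P) \<le> rel_entropy Q P"
  using assms by (auto simp: orient_def intro!: rel_entropy_distr_le cong: measurable_cong_sets)

lemma couplings_orient:
  fixes Q :: "('a::euclidean_space \<times> 'a) measure"
  assumes "Q \<in> couplings (if even m then \<mu> else \<eta>) (if even m then \<eta> else \<mu>)"
  shows "orient m Q \<in> couplings \<mu> \<eta>"
proof -
  have s: "sets Q = sets borel" using assms by (simp add: couplings_def)
  show ?thesis
    using assms distr_orient[OF s, of m] sets_orient[OF s, of m]
    by (auto simp: couplings_def source_coord_def split: if_splits)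
qed

lemma rel_entropy_self:
  assumes "prob_space P" shows "rel_entropy P P = 0"
  using rel_entropy_density[OF assms, of "\<lambda>_. 1"] assms by (simp add: density_1 entropy_fun_def)

lemma prob_space_coupling:
  assumes "Q \<in> couplings \<mu> \<eta>" "prob_space \<mu>"
  shows "prob_space Q"
proof (rule prob_space_distrD)
  show "fst \<in> Q \<rightarrow>\<^sub>M borel"
    using assms by (simp add: couplings_def measurable_fst_borel cong: measurable_cong_sets)
  show "prob_space (distr Q borel fst)" using assms by (simp add: couplings_def)
qed

text \<open>Sinkhorn iterates in terms of potentials: \<open>w m\<close> is the potential of the \<open>m\<close>-th transition and \<open>s m\<close> that
  of the \<open>m\<close>-th free marginal. The last assumption is the Sinkhorn recursion, which says that the
  transition \<open>m + 1\<close> disintegrates the bridge \<open>m\<close> along its target coordinate.\<close>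

locale sinkhorn_potentials =
  fixes U V :: "real^'n \<Rightarrow> real" and K :: "nat \<Rightarrow> real^'n \<Rightarrow> (real^'n) measure"
    and w :: "nat \<Rightarrow> real^'n \<Rightarrow> real^'n \<Rightarrow> real" and s :: "nat \<Rightarrow> real^'n \<Rightarrow> real"
  assumes U: "smooth U" and V: "smooth V" and prob_U: "prob_space (gibbs U)" and prob_V: "prob_space (gibbs V)"
    and K_eq: "K m = gibbs_kernel (w m)" and kernel: "prob_kernel (K m)"
    and w_smooth: "smooth (\<lambda>(x, y). w m x y)" and s_cont: "continuous_on UNIV (s m)"
    and marginal: "sinkhorn_marginal (gibbs U) (gibbs V) K m = gibbs (s m)"
    and disintegration: "(if even m then U else V) x + w m x y = s m y + w (Suc m) y x"

lemma exists_sinkhorn_potentials: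
  fixes U V :: "real^'n \<Rightarrow> real"
  assumes U: "smooth U" and V: "smooth V" and prob: "prob_space (gibbs U)" "prob_space (gibbs V)"
    and S: "sinkhorn_kernels (gibbs U) (gibbs V) K0 K" and T: "smooth_transitions K"
  obtains w s where "sinkhorn_potentials U V K w s"
proof -
  let ?u = "\<lambda>m. if even m then U else V" and ?M = "\<lambda>m. gibbs (if even (m::nat) then U else V)"
  let ?\<pi> = "sinkhorn_marginal (gibbs U) (gibbs V) K"
  have kernel: "prob_kernel (K m)" for m using S by (simp add: sinkhorn_kernels_def)
  have "\<forall>m. \<exists>w. smooth (\<lambda>(x, y). w x y) \<and> K m = gibbs_kernel w"
    using T by (simp add: smooth_transitions_def)
  then obtain w where w: "\<And>m. smooth (\<lambda>(x, y). w m x y)" and K: "\<And>m. K m = gibbs_kernel (w m)" by metis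
  have wc: "continuous_on UNIV (\<lambda>z. w m (fst z) (snd z))" for m
    using smooth_continuous[OF w[of m]] by (simp add: case_prod_beta')
  have wm: "(\<lambda>z. w m (fst z) (snd z)) \<in> borel_measurable borel" for m
    using wc by (rule borel_measurable_continuous_onI)
  have uc: "continuous_on UNIV (?u m)" for m using U V by (auto intro: smooth_continuous)
  have um: "?u m \<in> borel_measurable borel" for m using uc by (rule borel_measurable_continuous_onI)
  have pM: "prob_space (?M m)" for m using prob by simp
  have \<pi>_eq: "?\<pi> m = ?M m \<bind> K m" for m by (simp add: sinkhorn_marginal_def)
  have p\<pi>: "prob_space (?\<pi> m)" "sets (?\<pi> m) = sets borel" for m
    unfolding \<pi>_eq using kernel_bind_prob[OF pM sets_gibbs kernel] by auto
  have ex: "\<exists>s. continuous_on UNIV s \<and> ?\<pi> m = gibbs s \<and> (\<forall>x y. ?u m x + w m x y = s y + w (Suc m) y x)" for m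
  proof -
    let ?J = "\<lambda>z. ?u m (fst z) + w m (fst z) (snd z)"
    have Jc: "continuous_on UNIV ?J"
      using continuous_on_compose2[OF uc continuous_on_fst[OF continuous_on_id], of UNIV m] wc[of m]
      by (intro continuous_on_add) auto
    have Jm: "?J \<in> borel_measurable borel" using Jc by (rule borel_measurable_continuous_onI)
    have P: "fwd_prod (?M m) (K m) = gibbs ?J"
      using fwd_prod_gibbs[OF um pM wm] kernel[of m] unfolding K by blast
    have "fwd_prod (?\<pi> m) (K (Suc m)) = distr (fwd_prod (?M m) (K m)) borel prod.swap"
    proof (cases "even m")
      case True
      then obtain n where n: "m = 2 * n" by (auto elim: evenE)
      have "fwd_prod (gibbs U) (K m) = bwd_prod (?\<pi> m) (K (Suc m))"
        using S n by (auto simp: sinkhorn_kernels_def)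
      also have "\<dots> = distr (fwd_prod (?\<pi> m) (K (Suc m))) borel prod.swap"
        by (rule bwd_prod_eq_distr_swap[OF p\<pi> kernel])
      finally show ?thesis
        using True distr_swap_swap[OF fwd_prod_prob(2)[OF p\<pi>(1,2) kernel]] by simp
    next
      case False
      then obtain n where n: "m = 2 * n + 1" by (auto elim: oddE)
      have "fwd_prod (?\<pi> m) (K (Suc m)) = bwd_prod (gibbs V) (K m)"
        using S n by (auto simp: sinkhorn_kernels_def)
      also have "\<dots> = distr (fwd_prod (gibbs V) (K m)) borel prod.swap"
        by (rule bwd_prod_eq_distr_swap[OF prob(2) sets_gibbs kernel])
      finally show ?thesis using False by simp
    qed
    then have eq: "fwd_prod (?\<pi> m) (gibbs_kernel (w (Suc m))) = gibbs (\<lambda>z. ?J (prod.swap z))"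
      unfolding P distr_gibbs_swap[OF Jm] K[symmetric] .
    have "continuous_on UNIV (\<lambda>z. ?J (prod.swap z))"
      by (rule continuous_on_compose2[OF Jc continuous_on_swap]) auto
    then obtain s where "continuous_on UNIV s" "?\<pi> m = gibbs s"
        "\<And>y x. ?J (prod.swap (y, x)) = s y + w (Suc m) y x"
      using disintegration_gibbs[OF p\<pi> wc _ _ eq] kernel[of "Suc m"] unfolding K by blast
    then show ?thesis by auto
  qed
  then obtain s where "\<And>m. continuous_on UNIV (s m)" "\<And>m. ?\<pi> m = gibbs (s m)"
      "\<And>m x y. ?u m x + w m x y = s m y + w (Suc m) y x" by metis
  then show ?thesis
    using that[of w s] U V prob K kernel w by (simp add: sinkhorn_potentials_def)
qed

context sinkhorn_potentials
begin

definition source_potential :: "nat \<Rightarrow> real^'n \<Rightarrow> real" where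
  "source_potential m = (if even m then U else V)"

definition source :: "nat \<Rightarrow> (real^'n) measure" where
  "source m = gibbs (source_potential m)"

definition bridge :: "nat \<Rightarrow> ((real^'n) \<times> (real^'n)) measure" where
  "bridge m = sinkhorn_bridge (gibbs U) (gibbs V) K m"

text \<open>The amount by which a Sinkhorn step decreases the entropy of every coupling.\<close>

definition marginal_loss :: "nat \<Rightarrow> ennreal" where
  "marginal_loss m = rel_entropy (source (Suc m)) (gibbs (s m))"

abbreviation "plans \<equiv> couplings (gibbs U) (gibbs V)"

lemma source_potential_smooth: "smooth (source_potential m)"
  using U V by (simp add: source_potential_def)

lemma source_prob: "prob_space (source m)"
  using prob_U prob_V by (simp add: source_def source_potential_def)

lemma sets_source[simp]: "sets (source m) = sets borel"
  by (simp add: source_def)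

lemma source_potential_Suc_Suc[simp]: "source_potential (Suc (Suc m)) = source_potential m"
  by (simp add: source_potential_def)

lemma source_Suc_Suc[simp]: "source (Suc (Suc m)) = source m"
  by (simp add: source_def)

lemma disintegration': "source_potential m x + w m x y = s m y + w (Suc m) y x"
  using disintegration by (simp add: source_potential_def)

lemma w_continuous: "continuous_on UNIV (\<lambda>z. w m (fst z) (snd z))"
  using smooth_continuous[OF w_smooth[of m]] by (simp add: case_prod_beta')

lemma w_measurable: "(\<lambda>z. w m (fst z) (snd z)) \<in> borel_measurable borel"
  using w_continuous by (rule borel_measurable_continuous_onI)

lemma w_slice_smooth: "smooth (w m x)" "smooth (\<lambda>x. w m x y)"
  using smooth_slice[OF w_smooth] by blast+

lemma w_slice_measurable: "w m x \<in> borel_measurable borel"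
  by (intro borel_measurable_continuous_onI smooth_continuous w_slice_smooth)

lemma s_measurable: "s m \<in> borel_measurable borel"
  by (intro borel_measurable_continuous_onI s_cont)

lemma source_potential_measurable: "source_potential m \<in> borel_measurable borel"
  by (intro borel_measurable_continuous_onI smooth_continuous source_potential_smooth)

lemma prob_w: "prob_space (gibbs (w m x))"
  using prob_kernelD(1)[OF kernel, of m x] by (simp add: K_eq gibbs_kernel_def)

lemma kernel_w: "prob_kernel (gibbs_kernel (w m))"
  using kernel[of m] by (simp add: K_eq)

lemma marginal_eq_bind: "gibbs (s m) = source m \<bind> K m"
  unfolding marginal[symmetric] by (simp add: sinkhorn_marginal_def source_def source_potential_def)

lemma prob_s: "prob_space (gibbs (s m))"
  unfolding marginal_eq_bind by (rule kernel_bind_prob[OF source_prob sets_source kernel])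

lemma bridge_eq_orient: "bridge m = orient m (fwd_prod (source m) (K m))"
  using bwd_prod_eq_distr_swap[OF prob_V sets_gibbs kernel]
  by (simp add: bridge_def sinkhorn_bridge_def orient_def source_def source_potential_def)

lemma sets_bridge[simp]: "sets (bridge m) = sets borel"
  unfolding bridge_eq_orient by (intro sets_orient fwd_prod_prob source_prob sets_source kernel)

lemma bridge_marginals:
  "distr (bridge m) borel (source_coord m) = source m"
  "distr (bridge m) borel (source_coord (Suc m)) = gibbs (s m)"
  unfolding bridge_eq_orient
  using distr_orient[OF fwd_prod_prob(2)[OF source_prob sets_source kernel]]
    distr_fwd_prod_fst[OF source_prob sets_source kernel]
    distr_fwd_prod_snd[OF source_prob sets_source kernel]
  by (simp_all add: marginal_eq_bind)

lemma bridge_prob: "prob_space (bridge m)"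
proof (rule prob_space_distrD)
  show "source_coord m \<in> bridge m \<rightarrow>\<^sub>M borel" by (simp cong: measurable_cong_sets)
  show "prob_space (distr (bridge m) borel (source_coord m))" by (simp add: bridge_marginals source_prob)
qed

lemma fwd_prod_source:
  "(\<lambda>z. source_potential m (fst z) + w m (fst z) (snd z)) \<in> borel_measurable borel"
  "fwd_prod (source m) (K m) = gibbs (\<lambda>z. source_potential m (fst z) + w m (fst z) (snd z))"
  using measurable_comp_fst[OF source_potential_measurable, of m] w_measurable[of m]
    fwd_prod_gibbs[OF source_potential_measurable _ w_measurable kernel_w] source_prob[of m]
  by (auto intro: borel_measurable_add simp: source_def K_eq)

lemma bridge_gibbs:
  "bridge m = gibbs (\<lambda>z. source_potential m (source_coord m z) + w m (source_coord m z) (source_coord (Suc m) z))"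
  using distr_gibbs_swap[OF fwd_prod_source(1)[of m]]
  by (auto simp: bridge_eq_orient orient_def source_coord_def fwd_prod_source(2))

lemma bridge_potential_measurable:
  "(\<lambda>z. source_potential m (source_coord m z) + w m (source_coord m z) (source_coord (Suc m) z)) \<in> borel_measurable borel"
proof -
  have "(\<lambda>z. (source_coord m z, source_coord (Suc m) z)) \<in> borel \<rightarrow>\<^sub>M (borel :: ((real^'n) \<times> (real^'n)) measure)"
    by (intro borel_measurable_Pair measurable_source_coord)
  from measurable_compose[OF this w_measurable]
  have "(\<lambda>z. w m (source_coord m z) (source_coord (Suc m) z)) \<in> borel_measurable borel" by simp
  then show ?thesis
    using measurable_compose[OF measurable_source_coord source_potential_measurable]
    by (intro borel_measurable_add)
qed

text \<open>A Sinkhorn step only corrects the marginal of the target coordinate.\<close>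

lemma bridge_Suc:
  "bridge (Suc m) = density (bridge m)
    (\<lambda>z. ennreal (exp (s m (source_coord (Suc m) z) - source_potential (Suc m) (source_coord (Suc m) z))))"
proof -
  have m: "(\<lambda>z. s m (source_coord (Suc m) z) - source_potential (Suc m) (source_coord (Suc m) z)) \<in> borel_measurable borel"
    using measurable_compose[OF measurable_source_coord s_measurable]
      measurable_compose[OF measurable_source_coord source_potential_measurable]
    by (intro borel_measurable_diff)
  show ?thesis
    unfolding bridge_gibbs[of m] density_gibbs[OF bridge_potential_measurable m]
    unfolding bridge_gibbs[of "Suc m"]
  proof (intro arg_cong[where f=gibbs] ext)
    fix z
    show "source_potential (Suc m) (source_coord (Suc m) z)
        + w (Suc m) (source_coord (Suc m) z) (source_coord (Suc (Suc m)) z)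
      = source_potential m (source_coord m z) + w m (source_coord m z) (source_coord (Suc m) z)
        - (s m (source_coord (Suc m) z) - source_potential (Suc m) (source_coord (Suc m) z))"
      using disintegration'[of m "source_coord m z" "source_coord (Suc m) z"] by simp
  qed
qed

lemma source_Suc_density:
  "source (Suc m) = density (gibbs (s m)) (\<lambda>x. ennreal (exp (s m x - source_potential (Suc m) x)))"
  using s_measurable[of m] source_potential_measurable[of "Suc m"]
  by (subst density_gibbs) (auto simp: source_def)

section \<open>Entropy along the Sinkhorn recursion\<close>

lemma coupling_marginal: "Q \<in> plans \<Longrightarrow> distr Q borel (source_coord m) = source m"
  by (auto simp: couplings_def source_coord_def source_def source_potential_def)

text \<open>Only the marginal of \<open>Q\<close> that the step corrects is prescribed, so the identity applies to
  couplings and also to the next bridge itself.\<close>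

lemma entropy_chain:
  assumes Q: "prob_space Q" "sets Q = sets borel" "distr Q borel (source_coord (Suc m)) = source (Suc m)"
  shows "rel_entropy Q (bridge m) = marginal_loss m + rel_entropy Q (bridge (Suc m))"
proof -
  have "rel_entropy Q (bridge m)
      = rel_entropy (distr Q borel (source_coord (Suc m))) (distr (bridge m) borel (source_coord (Suc m)))
      + rel_entropy Q (density (bridge m) (\<lambda>z. ennreal ((\<lambda>x. exp (s m x - source_potential (Suc m) x)) (source_coord (Suc m) z))))"
  proof (rule rel_entropy_chain[OF bridge_prob Q(1)])
    show "source_coord (Suc m) \<in> bridge m \<rightarrow>\<^sub>M borel" by (simp cong: measurable_cong_sets)
    show "(\<lambda>x. exp (s m x - source_potential (Suc m) x)) \<in> borel_measurable borel"
      using s_measurable source_potential_measurable by measurable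
    show "distr Q borel (source_coord (Suc m)) = density (distr (bridge m) borel (source_coord (Suc m)))
        (\<lambda>x. ennreal (exp (s m x - source_potential (Suc m) x)))"
      unfolding bridge_marginals Q(3) by (rule source_Suc_density)
  qed (use Q in auto)
  then show ?thesis
    unfolding bridge_Suc[of m] by (simp add: Q(3) bridge_marginals marginal_loss_def)
qed

lemma entropy_chain_coupling:
  "Q \<in> plans \<Longrightarrow> rel_entropy Q (bridge m) = marginal_loss m + rel_entropy Q (bridge (Suc m))"
  using prob_space_coupling[OF _ prob_U] coupling_marginal[of Q "Suc m"]
  by (intro entropy_chain) (auto simp: couplings_def)

text \<open>The entropy of the bridge \<open>m + 1\<close> relative to the bridge \<open>m\<close> is the loss of the step, because the
  chain rule leaves no second term. Project both bridges to the source coordinate of \<open>m\<close>.\<close>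

lemma marginal_entropy_le:
  "rel_entropy (gibbs (s (Suc m))) (source m) \<le> marginal_loss m"
proof -
  have "rel_entropy (bridge (Suc m)) (bridge m) = marginal_loss m"
    using entropy_chain[of "bridge (Suc m)" m, OF bridge_prob sets_bridge bridge_marginals(1)]
    by (simp add: rel_entropy_self bridge_prob)
  moreover have "rel_entropy (distr (bridge (Suc m)) borel (source_coord m)) (distr (bridge m) borel (source_coord m))
      \<le> rel_entropy (bridge (Suc m)) (bridge m)"
    by (intro rel_entropy_distr_le bridge_prob) (simp_all cong: measurable_cong_sets)
  ultimately show ?thesis
    using bridge_marginals(1)[of m] bridge_marginals(2)[of "Suc m"] by simp
qed

text \<open>The losses are the same for all couplings, and they are finite because the minimal entropy is; so
  they cancel from the comparison.\<close>

lemma minimizer_bridge: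
  assumes Pb: "Pb \<in> plans" and fin: "rel_entropy Pb (bridge 0) < \<infinity>"
    and min: "\<forall>Q\<in>plans. rel_entropy Pb (bridge 0) \<le> rel_entropy Q (bridge 0)"
  shows "rel_entropy Pb (bridge m) < \<infinity> \<and> (\<forall>Q\<in>plans. rel_entropy Pb (bridge m) \<le> rel_entropy Q (bridge m))"
proof (induction m)
  case 0
  then show ?case using fin min by blast
next
  case (Suc m)
  have e: "rel_entropy Pb (bridge m) = marginal_loss m + rel_entropy Pb (bridge (Suc m))"
    by (rule entropy_chain_coupling[OF Pb])
  with Suc have f: "marginal_loss m < \<infinity>" "rel_entropy Pb (bridge (Suc m)) < \<infinity>" by auto
  have "rel_entropy Pb (bridge (Suc m)) \<le> rel_entropy Q (bridge (Suc m))" if Q: "Q \<in> plans" for Q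
  proof -
    have "marginal_loss m + rel_entropy Pb (bridge (Suc m)) \<le> marginal_loss m + rel_entropy Q (bridge (Suc m))"
      using Suc Q e entropy_chain_coupling[OF Q, of m] by auto
    then show ?thesis using f by (auto simp: ennreal_add_left_cancel_le)
  qed
  with f show ?case by blast
qed

lemma bind_marginal: "gibbs (s (Suc m)) \<bind> K (Suc (Suc m)) = source (Suc m)"
proof -
  have "fwd_prod (gibbs (s (Suc m))) (K (Suc (Suc m)))
      = gibbs (\<lambda>z. s (Suc m) (fst z) + w (Suc (Suc m)) (fst z) (snd z))"
    using fwd_prod_gibbs[OF s_measurable prob_s w_measurable kernel_w] by (simp add: K_eq)
  also have "\<dots> = gibbs (\<lambda>z. source_potential (Suc m) (snd z) + w (Suc m) (snd z) (fst z))"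
    by (simp add: disintegration')
  also have "\<dots> = distr (fwd_prod (source (Suc m)) (K (Suc m))) borel prod.swap"
  proof -
    let ?J = "\<lambda>z. source_potential (Suc m) (fst z) + w (Suc m) (fst z) (snd z)"
    have "distr (gibbs ?J) borel prod.swap = gibbs (\<lambda>z. ?J (prod.swap z))"
      by (rule distr_gibbs_swap[OF fwd_prod_source(1)])
    then show ?thesis by (simp add: fwd_prod_source(2))
  qed
  finally have eq: "fwd_prod (gibbs (s (Suc m))) (K (Suc (Suc m)))
      = distr (fwd_prod (source (Suc m)) (K (Suc m))) borel prod.swap" .
  have "gibbs (s (Suc m)) \<bind> K (Suc (Suc m)) = distr (fwd_prod (gibbs (s (Suc m))) (K (Suc (Suc m)))) borel snd"
    by (rule distr_fwd_prod_snd[OF prob_s sets_gibbs kernel, symmetric])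
  also have "\<dots> = distr (fwd_prod (source (Suc m)) (K (Suc m))) borel (snd \<circ> prod.swap)"
    unfolding eq using fwd_prod_prob(2)[OF source_prob sets_source kernel] measurable_snd_borel
    by (intro distr_distr) (simp_all cong: measurable_cong_sets)
  also have "snd \<circ> prod.swap = (fst :: (real^'n) \<times> (real^'n) \<Rightarrow> _)" by auto
  also have "distr (fwd_prod (source (Suc m)) (K (Suc m))) borel fst = source (Suc m)"
    by (rule distr_fwd_prod_fst[OF source_prob sets_source kernel])
  finally show ?thesis .
qed

text \<open>The competitor is the glued coupling of \<open>couplings_glue\<close>; then take the infimum over \<open>\<gamma>\<close>.\<close>

lemma bridge_entropy_le_wasserstein:
  assumes min: "\<And>Q. Q \<in> plans \<Longrightarrow> rel_entropy Pb (bridge (Suc (Suc m))) \<le> rel_entropy Q (bridge (Suc (Suc m)))"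
    and D: "0 < D"
    and lip: "\<And>x x'. rel_entropy (K (Suc (Suc m)) x') (K (Suc (Suc m)) x) \<le> ennreal (D / 2 * (norm (x' - x))\<^sup>2)"
  shows "rel_entropy Pb (bridge (Suc (Suc m))) \<le> ennreal (D / 2) * wasserstein2_sq (gibbs (s (Suc m))) (source m)"
proof -
  let ?H = "rel_entropy Pb (bridge (Suc (Suc m)))" and ?K = "K (Suc (Suc m))"
  have bridge_eq: "bridge (Suc (Suc m)) = orient m (fwd_prod (source m) ?K)"
    by (simp add: bridge_eq_orient) (simp add: orient_def)
  have le: "?H \<le> ennreal (D / 2) * (\<integral>\<^sup>+z. ennreal ((norm (fst z - snd z))\<^sup>2) \<partial>\<gamma>)"
    if \<gamma>: "\<gamma> \<in> couplings (gibbs (s (Suc m))) (source m)" for \<gamma>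
  proof -
    obtain Q where Q: "Q \<in> couplings (source m) (gibbs (s (Suc m)) \<bind> ?K)"
      "rel_entropy Q (fwd_prod (source m) ?K) \<le> (\<integral>\<^sup>+z. rel_entropy (?K (fst z)) (?K (snd z)) \<partial>\<gamma>)"
      using couplings_glue[OF w_measurable kernel_w \<gamma> prob_s source_prob] unfolding K_eq[symmetric] by blast
    have Q': "Q \<in> couplings (source m) (source (Suc m))" using Q(1) by (simp add: bind_marginal)
    have "orient m Q \<in> plans"
      using Q' by (intro couplings_orient) (auto simp: source_def source_potential_def)
    then have "?H \<le> rel_entropy (orient m Q) (bridge (Suc (Suc m)))" by (rule min)
    also have "\<dots> \<le> rel_entropy Q (fwd_prod (source m) ?K)"
      unfolding bridge_eq using prob_space_coupling[OF Q' source_prob] Q' fwd_prod_prob[OF source_prob sets_source kernel]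
      by (intro rel_entropy_orient_le) (auto simp: couplings_def)
    also note Q(2)
    also have "(\<integral>\<^sup>+z. rel_entropy (?K (fst z)) (?K (snd z)) \<partial>\<gamma>)
        \<le> (\<integral>\<^sup>+z. ennreal (D / 2) * ennreal ((norm (fst z - snd z))\<^sup>2) \<partial>\<gamma>)"
      using D lip by (intro nn_integral_mono) (simp add: ennreal_mult[symmetric])
    also have "\<dots> = ennreal (D / 2) * (\<integral>\<^sup>+z. ennreal ((norm (fst z - snd z))\<^sup>2) \<partial>\<gamma>)"
    proof (rule nn_integral_cmult)
      have "(\<lambda>z::(real^'n) \<times> (real^'n). ennreal ((norm (fst z - snd z))\<^sup>2)) \<in> borel_measurable borel"
        using measurable_fst_borel measurable_snd_borel by measurable
      then show "(\<lambda>z. ennreal ((norm (fst z - snd z))\<^sup>2)) \<in> borel_measurable \<gamma>"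
        using \<gamma> by (simp add: couplings_def cong: measurable_cong_sets)
    qed
    finally show ?thesis .
  qed
  \<comment> \<open>Dividing by the finite positive constant moves it out of the infimum.\<close>
  have "?H / ennreal (D / 2) \<le> wasserstein2_sq (gibbs (s (Suc m))) (source m)"
    unfolding wasserstein2_sq_def
  proof (rule INF_greatest)
    fix \<gamma> assume "\<gamma> \<in> couplings (gibbs (s (Suc m))) (source m)"
    from divide_right_mono_ennreal[OF le[OF this], of "ennreal (D / 2)"]
    show "?H / ennreal (D / 2) \<le> (\<integral>\<^sup>+z. ennreal ((norm (fst z - snd z))\<^sup>2) \<partial>\<gamma>)"
      using D by (simp add: ennreal_mult_divide_eq mult.commute[of "ennreal (D / 2)"])
  qed
  then have "ennreal (D / 2) * (?H / ennreal (D / 2)) \<le> ennreal (D / 2) * wasserstein2_sq (gibbs (s (Suc m))) (source m)"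
    by (rule mult_left_mono) simp
  then show ?thesis
    using D by (simp add: ennreal_times_divide ennreal_mult_divide_eq mult.commute[of "ennreal (D / 2)" ?H])
qed

text \<open>Two chain rules give \<open>H(P|P\<^sub>m) \<ge> L + H(P|P\<^sub>m\<^sub>+\<^sub>2)\<close> with the loss \<open>L\<close> of step \<open>m\<close>, and
  \<open>H(P|P\<^sub>m\<^sub>+\<^sub>2) \<le> D t L\<close> by the transport inequality.\<close>

lemma entropy_contraction_step:
  assumes Pb: "Pb \<in> plans"
    and min: "\<And>Q. Q \<in> plans \<Longrightarrow> rel_entropy Pb (bridge (Suc (Suc m))) \<le> rel_entropy Q (bridge (Suc (Suc m)))"
    and D: "0 < D" and t: "0 < t" and T2: "talagrand_T2 (source m) t"
    and lip: "\<And>x x'. rel_entropy (K (Suc (Suc m)) x') (K (Suc (Suc m)) x) \<le> ennreal (D / 2 * (norm (x' - x))\<^sup>2)"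
  shows "rel_entropy Pb (bridge (Suc (Suc m))) \<le> ennreal (inverse (1 + inverse (D * t))) * rel_entropy Pb (bridge m)"
proof -
  let ?H = "rel_entropy Pb (bridge (Suc (Suc m)))" and ?G = "rel_entropy Pb (bridge m)"
  note inverse_mult_distrib[simp del]
  have Dt: "0 < D * t" using D t by simp
  have "?H \<le> ennreal (D / 2) * wasserstein2_sq (gibbs (s (Suc m))) (source m)"
    by (intro bridge_entropy_le_wasserstein min D lip)
  also have "\<dots> = ennreal D * (ennreal (1 / 2) * wasserstein2_sq (gibbs (s (Suc m))) (source m))"
  proof -
    have "ennreal (D / 2) = ennreal D * ennreal (1 / 2)"
      using D by (subst ennreal_mult[symmetric]) auto
    then show ?thesis by (simp only: mult.assoc)
  qed
  also have "\<dots> \<le> ennreal D * (ennreal t * rel_entropy (gibbs (s (Suc m))) (source m))"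
    using T2 prob_s by (intro mult_left_mono) (auto simp: talagrand_T2_def)
  also have "\<dots> \<le> ennreal D * (ennreal t * marginal_loss m)"
    by (intro mult_left_mono marginal_entropy_le) auto
  also have "\<dots> = ennreal (D * t) * marginal_loss m"
    using D t by (simp add: ennreal_mult mult.assoc)
  finally have H: "?H \<le> ennreal (D * t) * marginal_loss m" .
  have "ennreal (inverse (D * t)) * ?H \<le> ennreal (inverse (D * t)) * (ennreal (D * t) * marginal_loss m)"
    by (intro mult_left_mono H) auto
  also have "\<dots> = marginal_loss m"
  proof -
    have "ennreal (inverse (D * t)) * ennreal (D * t) = ennreal (inverse (D * t) * (D * t))"
      using D t by (intro ennreal_mult[symmetric]) auto
    also have "inverse (D * t) * (D * t) = 1" using D t by (intro left_inverse) simp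
    finally have "ennreal (inverse (D * t)) * ennreal (D * t) = 1" by simp
    then show ?thesis by (simp only: mult.assoc[symmetric] mult_1)
  qed
  finally have loss: "ennreal (inverse (D * t)) * ?H \<le> marginal_loss m" .
  have "ennreal (1 + inverse (D * t)) * ?H = ennreal (inverse (D * t)) * ?H + ?H"
    using Dt by (simp add: ennreal_plus distrib_right add.commute)
  also have "\<dots> \<le> marginal_loss m + (marginal_loss (Suc m) + ?H)"
    using loss by (intro add_mono) auto
  also have "\<dots> = ?G"
    using entropy_chain_coupling[OF Pb, of m] entropy_chain_coupling[OF Pb, of "Suc m"] by simp
  finally have le: "ennreal (1 + inverse (D * t)) * ?H \<le> ?G" .
  have pos: "0 < 1 + inverse (D * t)" using Dt by (simp add: add_pos_pos)
  have "?H = ennreal (inverse (1 + inverse (D * t))) * (ennreal (1 + inverse (D * t)) * ?H)"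
    using pos by (simp add: mult.assoc[symmetric] ennreal_mult[symmetric])
  also have "\<dots> \<le> ennreal (inverse (1 + inverse (D * t))) * ?G"
    by (intro mult_left_mono le) auto
  finally show ?thesis .
qed

lemma entropy_contraction:
  assumes Pb: "Pb \<in> plans" and fin: "rel_entropy Pb (bridge 0) < \<infinity>"
    and min: "\<forall>Q\<in>plans. rel_entropy Pb (bridge 0) \<le> rel_entropy Q (bridge 0)"
    and D: "0 < D" and t: "0 < t" and T2: "\<And>k. even (k + m) \<Longrightarrow> talagrand_T2 (source k) t"
    and lip: "\<And>k x x'. even (k + m) \<Longrightarrow> k \<ge> 2 \<Longrightarrow> rel_entropy (K k x') (K k x) \<le> ennreal (D / 2 * (norm (x' - x))\<^sup>2)"
  shows "rel_entropy Pb (bridge (2 * n + m)) \<le> ennreal ((1 + inverse (D * t)) powi (- int n)) * rel_entropy Pb (bridge m)"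
proof (induction n)
  case 0
  then show ?case by simp
next
  case (Suc n)
  let ?q = "inverse (1 + inverse (D * t))"
  have q: "0 \<le> ?q" using D t by (simp add: add_nonneg_nonneg)
  have "rel_entropy Pb (bridge (2 * Suc n + m)) = rel_entropy Pb (bridge (Suc (Suc (2 * n + m))))"
    by simp
  also have "\<dots> \<le> ennreal ?q * rel_entropy Pb (bridge (2 * n + m))"
    using minimizer_bridge[OF Pb fin min] by (intro entropy_contraction_step Pb D t T2 lip) auto
  also have "\<dots> \<le> ennreal ?q * (ennreal ((1 + inverse (D * t)) powi (- int n)) * rel_entropy Pb (bridge m))"
    by (intro mult_left_mono Suc.IH) auto
  also have "\<dots> = ennreal ((1 + inverse (D * t)) powi (- int (Suc n))) * rel_entropy Pb (bridge m)"
  proof -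
    have "?q * (1 + inverse (D * t)) powi (- int n) = (1 + inverse (D * t)) powi (- int (Suc n))"
      by (simp add: power_int_minus power_inverse del: of_nat_Suc)
    then show ?thesis
      using q by (simp add: mult.assoc[symmetric] ennreal_mult'[symmetric] del: of_nat_Suc)
  qed
  finally show ?case .
qed

end

section \<open>The linear-Gaussian reference\<close>

text \<open>Expanding the square leaves \<open>- (\<tau>\<^sup>-\<^sup>1 \<beta> x) \<bullet> y\<close> as the only term that mixes \<open>x\<close> and \<open>y\<close>.\<close>

lemma linear_gaussian_potential_bilinear:
  fixes \<tau> \<beta> :: "real^'n^'n"
  assumes "pos_def \<tau>"
  shows "\<exists>f g. continuous_on UNIV g \<and>
    (\<forall>x y. linear_gaussian_potential \<tau> \<alpha> \<beta> x y = f x + g y - ((matrix_inv \<tau> ** \<beta>) *v x) \<bullet> y)"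
proof -
  let ?T = "matrix_inv \<tau>"
  have inv: "invertible \<tau>" by (rule pos_def_invertible[OF assms])
  have sym: "transpose \<tau> = \<tau>" using assms by (simp add: pos_def_def)
  have Tsym: "x \<bullet> (?T *v y) = (?T *v x) \<bullet> y" for x y
    using symmetric_matrix_inner[OF sym, of "?T *v x" "?T *v y"] by (simp add: matrix_inv_mult[OF inv])
  define c where "c = sqrt ((2 * pi) ^ CARD('n) * det \<tau>)"
  \<comment> \<open>Enough for \<open>ln_div\<close>, because \<open>ln\<close> is defined as \<open>ln |x|\<close> on negative reals.\<close>
  have c: "c \<noteq> 0" using inv by (simp add: c_def invertible_det_nz)
  let ?g = "\<lambda>y. (y \<bullet> (?T *v y)) / 2 - (?T *v \<alpha>) \<bullet> y + ln c"
  let ?f = "\<lambda>x. ((\<alpha> + \<beta> *v x) \<bullet> (?T *v (\<alpha> + \<beta> *v x))) / 2"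
  show ?thesis
  proof (rule exI[of _ ?f], rule exI[of _ ?g], intro conjI allI)
    show "continuous_on UNIV ?g"
      by (intro continuous_intros linear_continuous_on matrix_vector_mul_bounded_linear) simp
    fix x y
    let ?m = "\<alpha> + \<beta> *v x"
    have "linear_gaussian_potential \<tau> \<alpha> \<beta> x y = ((y - ?m) \<bullet> (?T *v (y - ?m))) / 2 + ln c"
      unfolding linear_gaussian_potential_def gaussian_density_def c_def[symmetric]
      using c by (simp add: ln_div)
    also have "(y - ?m) \<bullet> (?T *v (y - ?m)) = y \<bullet> (?T *v y) - 2 * ((?T *v ?m) \<bullet> y) + ?m \<bullet> (?T *v ?m)"
      using Tsym[of ?m y] by (simp only: matrix_vector_mult_diff_distrib inner_diff_left inner_diff_right)
        (simp add: inner_commute)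
    also have "(?T *v ?m) \<bullet> y = (?T *v \<alpha>) \<bullet> y + ((?T ** \<beta>) *v x) \<bullet> y"
      by (simp add: matrix_vector_right_distrib matrix_vector_mul_assoc inner_add_left)
    finally show "linear_gaussian_potential \<tau> \<alpha> \<beta> x y = ?f x + ?g y - ((?T ** \<beta>) *v x) \<bullet> y"
      by (simp add: field_simps)
  qed
qed

section \<open>Entropy between transition probabilities\<close>

locale sinkhorn_bilinear = sinkhorn_potentials U V K w s
  for U V :: "real^'n \<Rightarrow> real" and K w s +
  fixes B :: "real^'n^'n" and f0 g0
  assumes w0: "w 0 x y = f0 x + g0 y - (B *v x) \<bullet> y"
begin

definition interaction :: "nat \<Rightarrow> real^'n^'n" where
  "interaction m = (if even m then B else transpose B)"

lemma norm_interaction_le: "norm (interaction m *v x) \<le> spectral_norm B * norm x"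
  using spectral_norm_bound[of B x] spectral_norm_transpose_le[of B x] by (simp add: interaction_def)

lemma interaction_Suc: "(interaction m *v x) \<bullet> y = (interaction (Suc m) *v y) \<bullet> x"
  using dot_lmul_matrix[of x B y] dot_lmul_matrix[of y B x]
  by (simp add: interaction_def inner_commute)

text \<open>A Sinkhorn step adds functions of a single coordinate and exchanges the coordinates, so the mixed
  term survives up to transposition.\<close>

lemma w_bilinear: "\<exists>f g. \<forall>x y. w m x y = f x + g y - (interaction m *v x) \<bullet> y"
proof (induction m)
  case 0
  then show ?case using w0 by (auto simp: interaction_def)
next
  case (Suc m)
  then obtain f g where fg: "\<And>x y. w m x y = f x + g y - (interaction m *v x) \<bullet> y" by auto
  have "w (Suc m) y x = (g y - s m y) + (source_potential m x + f x) - (interaction (Suc m) *v y) \<bullet> x" for x y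
    using disintegration'[of m x y] fg[of x y] interaction_Suc[of m x y] by simp
  then show ?case
    by (intro exI[of _ "\<lambda>y. g y - s m y"] exI[of _ "\<lambda>x. source_potential m x + f x"]) auto
qed

lemma w_tilt: "\<exists>c. \<forall>y. w m x' y = w m x y - (interaction m *v (x' - x)) \<bullet> y + c"
proof -
  obtain f g where fg: "\<And>x y. w m x y = f x + g y - (interaction m *v x) \<bullet> y" using w_bilinear by blast
  have "w m x' y = w m x y - (interaction m *v (x' - x)) \<bullet> y + (f x' - f x)" for y
    unfolding fg by (simp add: matrix_vector_mult_diff_distrib inner_diff_left)
  then show ?thesis by blast
qed

lemma w_convex: "convex_on UNIV (\<lambda>x. w m x y)"
proof -
  obtain f g where fg: "\<And>x y. w m x y = f x + g y - (interaction m *v x) \<bullet> y" using w_bilinear by blast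
  show ?thesis
    by (rule transition_potential_convex[OF fg _ w_slice_measurable prob_w]) simp
qed

text \<open>By the recursion, the potential of a transition is the potential of the prescribed marginal plus the
  previous transition potential, which is convex in this variable.\<close>

lemma hessian_transition_ge:
  "v \<bullet> (hessian (source_potential m) y *v v) \<le> v \<bullet> (hessian (w (Suc m) x) y *v v)"
proof -
  have "v \<bullet> (hessian (w (Suc m) x) y *v v)
      = v \<bullet> (hessian (source_potential m) y *v v) + v \<bullet> (hessian (\<lambda>y. w m y x) y *v v)"
  proof (rule hessian_quadratic_add)
    show "w (Suc m) x y = source_potential m y + w m y x - s m x" for y
      using disintegration'[of m y x] by simp
  qed (intro source_potential_smooth w_slice_smooth)+
  moreover have "0 \<le> v \<bullet> (hessian (\<lambda>y. w m y x) y *v v)"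
    by (rule hessian_nonneg_of_convex[OF w_slice_smooth(2) w_convex])
  ultimately show ?thesis by simp
qed

lemma tilt_bound_imp_kernel_bound:
  assumes "rel_entropy (gibbs (w m x')) (gibbs (w m x)) \<le> ennreal (r / 2 * (norm (interaction m *v (x' - x)))\<^sup>2)"
    and r: "0 \<le> r"
  shows "rel_entropy (K m x') (K m x) \<le> ennreal ((spectral_norm B)\<^sup>2 * r / 2 * (norm (x' - x))\<^sup>2)"
proof -
  have "(norm (interaction m *v (x' - x)))\<^sup>2 \<le> (spectral_norm B * norm (x' - x))\<^sup>2"
    by (intro power_mono norm_interaction_le) auto
  then have "r / 2 * (norm (interaction m *v (x' - x)))\<^sup>2 \<le> r / 2 * (spectral_norm B * norm (x' - x))\<^sup>2"
    using r by (intro mult_left_mono) auto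
  also have "\<dots> = (spectral_norm B)\<^sup>2 * r / 2 * (norm (x' - x))\<^sup>2" by (simp add: power_mult_distrib)
  finally have "ennreal (r / 2 * (norm (interaction m *v (x' - x)))\<^sup>2)
      \<le> ennreal ((spectral_norm B)\<^sup>2 * r / 2 * (norm (x' - x))\<^sup>2)" by (rule ennreal_leI)
  with assms(1) show ?thesis by (auto simp: K_eq gibbs_kernel_def)
qed

lemma kernel_entropy_le_log_sobolev:
  assumes curv: "curvature_bound (source_potential m) (matrix_inv vp) vbar \<delta>" and vp: "pos_def vp"
    and LS: "\<And>F :: real^'n \<Rightarrow> real. smooth F \<Longrightarrow> prob_space (gibbs F) \<Longrightarrow>
      curvature_bound F (mat (inverse (spectral_norm vp))) (mat (spectral_norm vbar)) \<delta> \<Longrightarrow> log_sobolev (gibbs F) r"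
    and r: "0 \<le> r"
  shows "rel_entropy (K (Suc m) x') (K (Suc m) x) \<le> ennreal ((spectral_norm B)\<^sup>2 * r / 2 * (norm (x' - x))\<^sup>2)"
proof (rule tilt_bound_imp_kernel_bound[OF _ r])
  let ?F = "w (Suc m) x"
  have mat: "v \<bullet> (mat c *v v) = c * (norm v)\<^sup>2" for c :: real and v :: "real^'n"
  proof -
    have "mat c *v v = c *\<^sub>R v"
      by (simp add: vec_eq_iff matrix_vector_mult_def mat_def if_distrib if_distribR cong: if_cong)
    then show ?thesis by (simp add: power2_norm_eq_inner)
  qed
  have sub: "v \<bullet> ((p *\<^sub>R A - q *\<^sub>R C) *v v) = p * (v \<bullet> (A *v v)) - q * (v \<bullet> (C *v v))"
    for p q and A C :: "real^'n^'n" and v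
    by (simp add: matrix_vector_mult_diff_rdistrib scaleR_matrix_vector_assoc[symmetric] inner_diff_right)
  have "curvature_bound ?F (mat (inverse (spectral_norm vp))) (mat (spectral_norm vbar)) \<delta>"
    unfolding curvature_bound_def loewner_le_def
  proof (intro allI)
    fix y v :: "real^'n"
    let ?i = "indicator {x. \<delta> \<le> norm x} y :: real" and ?j = "indicator {x. norm x < \<delta>} y :: real"
    have "?i * (inverse (spectral_norm vp) * (norm v)\<^sup>2) - ?j * (spectral_norm vbar * (norm v)\<^sup>2)
        \<le> ?i * (v \<bullet> (matrix_inv vp *v v)) - ?j * (v \<bullet> (vbar *v v))"
      by (intro diff_mono mult_left_mono matrix_inv_ge_inverse_spectral_norm[OF vp] quadratic_form_le_spectral_norm) auto
    also have "\<dots> \<le> v \<bullet> (hessian (source_potential m) y *v v)"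
      using curv unfolding curvature_bound_def loewner_le_def sub by blast
    also have "\<dots> \<le> v \<bullet> (hessian ?F y *v v)" by (rule hessian_transition_ge)
    finally show "v \<bullet> ((?i *\<^sub>R mat (inverse (spectral_norm vp)) - ?j *\<^sub>R mat (spectral_norm vbar)) *v v)
        \<le> v \<bullet> (hessian ?F y *v v)"
      by (simp add: sub mat)
  qed
  then have ls: "log_sobolev (gibbs ?F) r" by (intro LS w_slice_smooth prob_w)
  obtain c where c: "\<And>y. w (Suc m) x' y = ?F y - (interaction (Suc m) *v (x' - x)) \<bullet> y + c"
    using w_tilt by blast
  show "rel_entropy (gibbs (w (Suc m) x')) (gibbs ?F) \<le> ennreal (r / 2 * (norm (interaction (Suc m) *v (x' - x)))\<^sup>2)"
    using tilt_entropy_log_sobolev[OF w_slice_measurable prob_w prob_w ls c] r by (simp add: ennreal_mult[symmetric])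
qed

lemma kernel_entropy_le_strongly_convex:
  assumes curv: "\<And>y. loewner_le (matrix_inv vp) (hessian (source_potential m) y)" and vp: "pos_def vp"
  shows "rel_entropy (K (Suc m) x') (K (Suc m) x)
    \<le> ennreal ((spectral_norm B)\<^sup>2 * spectral_norm vp / 2 * (norm (x' - x))\<^sup>2)"
proof (rule tilt_bound_imp_kernel_bound[OF _ spectral_norm_nonneg])
  let ?F = "w (Suc m) x" and ?a = "inverse (spectral_norm vp)"
  have a: "0 < ?a" using invertible_spectral_norm_pos[OF pos_def_invertible[OF vp]] by simp
  have hess: "?a * (norm v)\<^sup>2 \<le> v \<bullet> (hessian ?F y *v v)" for y v
    using matrix_inv_ge_inverse_spectral_norm[OF vp, of v] curv[of y] hessian_transition_ge[of v m y x]
    unfolding loewner_le_def by (meson order_trans)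
  obtain c where c: "\<And>y. w (Suc m) x' y = ?F y - (interaction (Suc m) *v (x' - x)) \<bullet> y + c"
    using w_tilt by blast
  have "rel_entropy (gibbs (w (Suc m) x')) (gibbs ?F)
      \<le> ennreal ((norm (interaction (Suc m) *v (x' - x)))\<^sup>2 / (2 * ?a))"
    by (rule tilt_entropy_strongly_convex[OF w_slice_measurable a
          strongly_convex_of_hessian[OF w_slice_smooth(1) hess] prob_w prob_w c])
  then show "rel_entropy (gibbs (w (Suc m) x')) (gibbs ?F)
      \<le> ennreal (spectral_norm vp / 2 * (norm (interaction (Suc m) *v (x' - x)))\<^sup>2)"
    by (simp add: field_simps)
qed

lemma entropy_contraction_gaussian:
  assumes Pb: "Pb \<in> plans" and fin: "rel_entropy Pb (bridge 0) < \<infinity>"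
    and min: "\<forall>Q\<in>plans. rel_entropy Pb (bridge 0) \<le> rel_entropy Q (bridge 0)"
    and B: "0 < spectral_norm B" and up: "pos_def up" and vp: "pos_def vp"
    and T2: "talagrand_T2 (source m) (spectral_norm up)"
  shows
    "\<lbrakk>curvature_bound (source_potential (Suc m)) (matrix_inv vp) vbar \<delta>; 0 < r;
      \<And>F :: real^'n \<Rightarrow> real. smooth F \<Longrightarrow> prob_space (gibbs F) \<Longrightarrow>
        curvature_bound F (mat (inverse (spectral_norm vp))) (mat (spectral_norm vbar)) \<delta> \<Longrightarrow> log_sobolev (gibbs F) r\<rbrakk>
      \<Longrightarrow> rel_entropy Pb (bridge (2 * n + m))
        \<le> ennreal ((1 + inverse ((spectral_norm B)\<^sup>2 * r * spectral_norm up)) powi (- int n)) * rel_entropy Pb (bridge m)"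
    "(\<And>y. loewner_le (matrix_inv vp) (hessian (source_potential (Suc m)) y))
      \<Longrightarrow> rel_entropy Pb (bridge (2 * n + m))
        \<le> ennreal ((1 + inverse ((spectral_norm B)\<^sup>2 * spectral_norm vp * spectral_norm up)) powi (- int n)) * rel_entropy Pb (bridge m)"
proof -
  have up_pos: "0 < spectral_norm up" and vp_pos: "0 < spectral_norm vp"
    using up vp by (auto intro: invertible_spectral_norm_pos pos_def_invertible)
  have T2': "talagrand_T2 (source k) (spectral_norm up)" if "even (k + m)" for k
    using T2 that by (simp add: source_def source_potential_def)
  have k: "\<exists>j. k = Suc j \<and> source_potential j = source_potential (Suc m)" if "even (k + m)" "k \<ge> 2" for k
    using that by (intro exI[of _ "k - 1"]) (auto simp: source_potential_def)
  {
    assume curv: "curvature_bound (source_potential (Suc m)) (matrix_inv vp) vbar \<delta>" and r: "0 < r"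
      and LS: "\<And>F :: real^'n \<Rightarrow> real. smooth F \<Longrightarrow> prob_space (gibbs F) \<Longrightarrow>
        curvature_bound F (mat (inverse (spectral_norm vp))) (mat (spectral_norm vbar)) \<delta> \<Longrightarrow> log_sobolev (gibbs F) r"
    show "rel_entropy Pb (bridge (2 * n + m))
        \<le> ennreal ((1 + inverse ((spectral_norm B)\<^sup>2 * r * spectral_norm up)) powi (- int n)) * rel_entropy Pb (bridge m)"
    proof (rule entropy_contraction[OF Pb fin min _ up_pos T2'])
      fix k x x' assume "even (k + m)" "k \<ge> 2"
      then obtain j where "k = Suc j" "source_potential j = source_potential (Suc m)" using k by blast
      then show "rel_entropy (K k x') (K k x) \<le> ennreal ((spectral_norm B)\<^sup>2 * r / 2 * (norm (x' - x))\<^sup>2)"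
        using kernel_entropy_le_log_sobolev[of j vp vbar \<delta> r x' x] curv vp LS r by simp
    qed (use B r in auto)
  }
  {
    assume curv: "\<And>y. loewner_le (matrix_inv vp) (hessian (source_potential (Suc m)) y)"
    show "rel_entropy Pb (bridge (2 * n + m))
        \<le> ennreal ((1 + inverse ((spectral_norm B)\<^sup>2 * spectral_norm vp * spectral_norm up)) powi (- int n)) * rel_entropy Pb (bridge m)"
    proof (rule entropy_contraction[OF Pb fin min _ up_pos T2'])
      fix k x x' assume "even (k + m)" "k \<ge> 2"
      then obtain j where "k = Suc j" "source_potential j = source_potential (Suc m)" using k by blast
      then show "rel_entropy (K k x') (K k x) \<le> ennreal ((spectral_norm B)\<^sup>2 * spectral_norm vp / 2 * (norm (x' - x))\<^sup>2)"
        using kernel_entropy_le_strongly_convex[of vp j x' x] curv vp by simp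
    qed (use B vp_pos in auto)
  }
qed

end

section \<open>Exponential convergence of the Sinkhorn bridges\<close>

theorem theorem8p1:
  fixes U V :: "real^'n \<Rightarrow> real"
    and \<tau> \<beta> :: "real^'n^'n" and \<alpha> :: "real^'n"
    and \<rho> :: "real \<Rightarrow> real \<Rightarrow> real \<Rightarrow> real"
    and K :: "nat \<Rightarrow> real^'n \<Rightarrow> (real^'n) measure"
    and Pb :: "((real^'n) \<times> (real^'n)) measure"
  defines "\<mu> \<equiv> gibbs U" and "\<eta> \<equiv> gibbs V"
    and "KW \<equiv> gibbs_kernel (linear_gaussian_potential \<tau> \<alpha> \<beta>)"
    and "\<kappa> \<equiv> spectral_norm (matrix_inv \<tau> ** \<beta>)"
  assumes "smooth U" and "smooth V" and "prob_space \<mu>" and "prob_space \<eta>"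
    and "pos_def \<tau>" and "invertible \<beta>"
    and "\<exists>Q\<in>couplings \<mu> \<eta>. rel_entropy Q (fwd_prod \<mu> KW) < \<infinity>"
    and "is_schroedinger_bridge \<mu> \<eta> (fwd_prod \<mu> KW) Pb"
    and "sinkhorn_kernels \<mu> \<eta> KW K" and "smooth_transitions K"
    and "\<And>a b \<delta>. a > 0 \<Longrightarrow> b \<ge> 0 \<Longrightarrow> \<delta> \<ge> 0 \<Longrightarrow>
           \<rho> a b \<delta> > 0 \<and>
           (\<forall>F :: real^'n \<Rightarrow> real.
              smooth F \<and> prob_space (gibbs F) \<and> curvature_bound F (mat a) (mat b) \<delta> \<longrightarrow>
              log_sobolev (gibbs F) (\<rho> a b \<delta>))"
  shows
    "(\<forall>(up :: real^'n^'n) (vp :: real^'n^'n) (vbar :: real^'n^'n) \<delta>.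
        pos_def up \<and> pos_def vp \<and> pos_semidef vbar \<and> \<delta> \<ge> 0 \<and>
        talagrand_T2 \<mu> (spectral_norm up) \<and> curvature_bound V (matrix_inv vp) vbar \<delta> \<longrightarrow>
        (let \<epsilon>uv = \<kappa>\<^sup>2 * \<rho> (inverse (spectral_norm vp)) (spectral_norm vbar) \<delta> * spectral_norm up;
             \<epsilon> = \<kappa>\<^sup>2 * spectral_norm up * spectral_norm vp
         in (\<forall>n\<ge>1. \<forall>p.
               rel_entropy Pb (sinkhorn_bridge \<mu> \<eta> K (2 * (n + p)))
               \<le> ennreal ((1 + inverse \<epsilon>uv) powi (- int n)) *
                 rel_entropy Pb (sinkhorn_bridge \<mu> \<eta> K (2 * p))) \<and>
            ((\<forall>y. loewner_le (matrix_inv vp) (hessian V y)) \<longrightarrow>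
             (\<forall>n\<ge>1. \<forall>p.
               rel_entropy Pb (sinkhorn_bridge \<mu> \<eta> K (2 * (n + p)))
               \<le> ennreal ((1 + inverse \<epsilon>) powi (- int n)) *
                 rel_entropy Pb (sinkhorn_bridge \<mu> \<eta> K (2 * p)))))) \<and>
     (\<forall>(up :: real^'n^'n) (vp :: real^'n^'n) (ubar :: real^'n^'n) \<delta>.
        pos_def up \<and> pos_def vp \<and> pos_semidef ubar \<and> \<delta> \<ge> 0 \<and>
        talagrand_T2 \<eta> (spectral_norm vp) \<and> curvature_bound U (matrix_inv up) ubar \<delta> \<longrightarrow>
        (let \<epsilon>vu = \<kappa>\<^sup>2 * \<rho> (inverse (spectral_norm up)) (spectral_norm ubar) \<delta> * spectral_norm vp;
             \<epsilon> = \<kappa>\<^sup>2 * spectral_norm up * spectral_norm vp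
         in (\<forall>n\<ge>1. \<forall>p.
               rel_entropy Pb (sinkhorn_bridge \<mu> \<eta> K (2 * (n + p) + 1))
               \<le> ennreal ((1 + inverse \<epsilon>vu) powi (- int n)) *
                 rel_entropy Pb (sinkhorn_bridge \<mu> \<eta> K (2 * p + 1))) \<and>
            ((\<forall>x. loewner_le (matrix_inv up) (hessian U x)) \<longrightarrow>
             (\<forall>n\<ge>1. \<forall>p.
               rel_entropy Pb (sinkhorn_bridge \<mu> \<eta> K (2 * (n + p) + 1))
               \<le> ennreal ((1 + inverse \<epsilon>) powi (- int n)) *
                 rel_entropy Pb (sinkhorn_bridge \<mu> \<eta> K (2 * p + 1))))))"
proof -
  obtain w s where "sinkhorn_potentials U V K w s"
    by (rule exists_sinkhorn_potentials[OF assms(5,6) assms(7,8)[unfolded \<mu>_def \<eta>_def]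
          assms(13)[unfolded \<mu>_def \<eta>_def] assms(14)])
  then interpret S: sinkhorn_potentials U V K w s .
  \<comment> \<open>The smooth version of the first potential is the Gaussian one, so it has a bilinear mixed term.\<close>
  let ?B = "matrix_inv \<tau> ** \<beta>"
  obtain f0 g0 where
    W: "\<And>x y. linear_gaussian_potential \<tau> \<alpha> \<beta> x y = f0 x + g0 y - (?B *v x) \<bullet> y"
    and g0: "continuous_on UNIV g0"
    using linear_gaussian_potential_bilinear[OF \<open>pos_def \<tau>\<close>, of \<alpha> \<beta>] by blast
  have "w 0 x y = f0 x + g0 y - (?B *v x) \<bullet> y" for x y
  proof -
    have "K 0 = KW" using \<open>sinkhorn_kernels \<mu> \<eta> KW K\<close> by (simp add: sinkhorn_kernels_def)
    then have "gibbs (w 0 x) = gibbs (linear_gaussian_potential \<tau> \<alpha> \<beta> x)"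
      by (metis S.K_eq KW_def gibbs_kernel_def)
    then have "w 0 x = linear_gaussian_potential \<tau> \<alpha> \<beta> x"
    proof (rule gibbs_inject[rotated 2])
      show "continuous_on UNIV (w 0 x)" by (intro smooth_continuous S.w_slice_smooth)
      show "continuous_on UNIV (linear_gaussian_potential \<tau> \<alpha> \<beta> x)"
        unfolding W by (intro continuous_intros g0)
    qed
    then show ?thesis by (simp add: W)
  qed
  then interpret S: sinkhorn_bilinear U V K w s ?B f0 g0
    by unfold_locales
  have \<kappa>: "0 < spectral_norm ?B"
  proof -
    have "invertible (matrix_inv \<tau>)"
      using pos_def_invertible[OF \<open>pos_def \<tau>\<close>] by (rule invertible_matrix_inv)
    then show ?thesis
      using \<open>invertible \<beta>\<close> by (intro invertible_spectral_norm_pos invertible_mult)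
  qed
  have bridge: "sinkhorn_bridge \<mu> \<eta> K m = S.bridge m" for m
    by (simp add: S.bridge_def \<mu>_def \<eta>_def)
  have bridge0: "fwd_prod \<mu> KW = S.bridge 0"
    using \<open>sinkhorn_kernels \<mu> \<eta> KW K\<close> by (simp add: bridge[symmetric] sinkhorn_bridge_def sinkhorn_kernels_def)
  have Pb: "Pb \<in> S.plans"
    and min: "\<forall>Q\<in>S.plans. rel_entropy Pb (S.bridge 0) \<le> rel_entropy Q (S.bridge 0)"
    using \<open>is_schroedinger_bridge \<mu> \<eta> (fwd_prod \<mu> KW) Pb\<close>[unfolded bridge0]
    unfolding is_schroedinger_bridge_def is_arg_min_def \<mu>_def \<eta>_def
    by (auto simp: not_less)
  have fin: "rel_entropy Pb (S.bridge 0) < \<infinity>"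
    using \<open>\<exists>Q\<in>couplings \<mu> \<eta>. rel_entropy Q (fwd_prod \<mu> KW) < \<infinity>\<close>[unfolded bridge0] min
    unfolding \<mu>_def \<eta>_def by (meson le_less_trans)
  note contraction = S.entropy_contraction_gaussian[OF Pb fin min \<kappa>]
  have even: "S.source (2 * p) = \<mu>" "S.source_potential (Suc (2 * p)) = V" for p
    by (simp_all add: S.source_def S.source_potential_def \<mu>_def)
  have odd: "S.source (Suc (2 * p)) = \<eta>" "S.source_potential (2 * p) = U" for p
    by (simp_all add: S.source_def S.source_potential_def \<eta>_def)
  have sum: "2 * (n + p) = 2 * n + 2 * p" "2 * n + 2 * p + 1 = 2 * n + (2 * p + 1)" for n p :: nat
    by simp_all
  have \<rho>: "0 < \<rho> (inverse (spectral_norm v)) (spectral_norm b) \<delta>"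
    "\<And>F :: real^'n \<Rightarrow> real. smooth F \<Longrightarrow> prob_space (gibbs F) \<Longrightarrow>
      curvature_bound F (mat (inverse (spectral_norm v))) (mat (spectral_norm b)) \<delta> \<Longrightarrow>
      log_sobolev (gibbs F) (\<rho> (inverse (spectral_norm v)) (spectral_norm b) \<delta>)"
    if "pos_def v" "0 \<le> \<delta>" for v b :: "real^'n^'n" and \<delta>
    using assms(15)[of "inverse (spectral_norm v)" "spectral_norm b" \<delta>] that
      invertible_spectral_norm_pos[OF pos_def_invertible[OF that(1)]] spectral_norm_nonneg[of b] by auto
  show ?thesis
    unfolding Let_def bridge \<kappa>_def sum
  proof (intro conjI allI impI; elim conjE)
    fix up vp b :: "real^'n^'n" and \<delta> :: real and n p :: nat
    assume *: "pos_def up" "pos_def vp" "0 \<le> \<delta>"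
    {
      assume T2: "talagrand_T2 \<mu> (spectral_norm up)" and curv: "curvature_bound V (matrix_inv vp) b \<delta>"
      show "rel_entropy Pb (S.bridge (2 * n + 2 * p))
          \<le> ennreal ((1 + inverse ((spectral_norm ?B)\<^sup>2 * \<rho> (inverse (spectral_norm vp)) (spectral_norm b) \<delta> * spectral_norm up)) powi (- int n)) *
            rel_entropy Pb (S.bridge (2 * p))"
        using T2 curv by (intro contraction(1)[OF *(1,2)] \<rho> *) (auto simp: even)
      assume "\<forall>y. loewner_le (matrix_inv vp) (hessian V y)"
      then show "rel_entropy Pb (S.bridge (2 * n + 2 * p))
          \<le> ennreal ((1 + inverse ((spectral_norm ?B)\<^sup>2 * spectral_norm up * spectral_norm vp)) powi (- int n)) *
            rel_entropy Pb (S.bridge (2 * p))"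
        using T2 unfolding mult.assoc mult.commute[of "spectral_norm up"]
        unfolding mult.assoc[symmetric]
        by (intro contraction(2)[OF *(1,2)]) (auto simp: even)
    }
    {
      assume T2: "talagrand_T2 \<eta> (spectral_norm vp)" and curv: "curvature_bound U (matrix_inv up) b \<delta>"
      show "rel_entropy Pb (S.bridge (2 * n + (2 * p + 1)))
          \<le> ennreal ((1 + inverse ((spectral_norm ?B)\<^sup>2 * \<rho> (inverse (spectral_norm up)) (spectral_norm b) \<delta> * spectral_norm vp)) powi (- int n)) *
            rel_entropy Pb (S.bridge (2 * p + 1))"
        using T2 curv by (intro contraction(1)[OF *(2,1)] \<rho> *) (auto simp: odd)
      assume "\<forall>x. loewner_le (matrix_inv up) (hessian U x)"
      then show "rel_entropy Pb (S.bridge (2 * n + (2 * p + 1)))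
          \<le> ennreal ((1 + inverse ((spectral_norm ?B)\<^sup>2 * spectral_norm up * spectral_norm vp)) powi (- int n)) *
            rel_entropy Pb (S.bridge (2 * p + 1))"
        using T2 by (intro contraction(2)[OF *(2,1)]) (auto simp: odd)
    }
  qed
qed

end
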